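(* If $n\ge7$ is odd (respectively, $n\ge8$ is even) and $d\equiv n+1\bmod2$, then there exists a positive definite even lattice $L$ of rank $n$ such that the space of Jacobi cusp forms of critical weight $J^{cusp}_{\frac{n+1}2,L}(v_\eta^d)$ is non-zero.
   Context: Let $L$ be a positive definite even lattice with form $(\cdot,\cdot)$ (extended bilinearly to $L\otimes\mathbb C$) and dual $L^\vee$. $v_\eta$ is the multiplier system of the Dedekind eta function: $\eta(\frac{a\tau+b}{c\tau+e})=v_\eta(A)(c\tau+e)^{1/2}\eta(\tau)$ for $A=\begin{pmatrix}a&b\\c&e\end{pmatrix}\in\mathrm{SL}_2(\mathbb Z)$ (principal branch). For $k\in\frac12\mathbb Z$, $d\in\mathbb Z$, $J_{k,L}(v_\eta^d)$ (index one) is the space of holomorphic $\varphi:\mathbb H\times(L\otimes\mathbb C)\to\mathbb C$ such that $\varphi(\frac{a\tau+b}{c\tau+e},\frac{\mathfrak Z}{c\tau+e})=v_\eta^d(A)(c\tau+e)^ke^{\pi i\frac{c(\mathfrak Z,\mathfrak Z)}{c\tau+e}}\varphi(\tau,\mathfrak Z)$ for all $A\in\mathrm{SL}_2(\mathbb Z)$, $\varphi(\tau,\mathfrak Z+x\tau+y)=e^{-\pi i((x,x)\tau+2(x,\mathfrak Z))}\varphi(\tau,\mathfrak Z)$ for $x,y\in L$, and $\varphi=\sum f(n,l)e^{2\pi i(n\tau+(l,\mathfrak Z))}$ with the sum over rational $n\ge0$, $n\equiv\frac d{24}\bmod\mathbb Z$, $l\in L^\vee$, $2n-(l,l)\ge0$.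 $J^{cusp}_{k,L}(v_\eta^d)$ is the subspace of $\varphi$ with $f(n,l)\ne0$ only for $2n-(l,l)>0$. The critical weight for $L$ is $\frac{\mathrm{rank}L+1}2$. *)

theory Defs
  imports "HOL-Analysis.Analysis" "HOL-Number_Theory.Cong"
begin

section \<open>Even lattices\<close>

text \<open>
  A positive definite lattice of rank \<open>n\<close> is realised, up to isometry, as the integral span of a
  basis of Euclidean space \<open>\<real>\<^sup>n\<close>; its form is the standard inner product, so positive definiteness
  is automatic, and the rank is the cardinality of the index type.
\<close>

definition full_lattice :: "(real ^ 'n) set \<Rightarrow> bool" where
  "full_lattice L \<longleftrightarrow>
     (\<exists>B. independent B \<and> span B = UNIV \<and>
          L = {\<Sum>b\<in>B. of_int (m b) *\<^sub>R b | m :: real ^ 'n \<Rightarrow> int. True})"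

text \<open>Integrality of the form on an even lattice follows by polarisation.\<close>

definition even_lattice :: "(real ^ 'n) set \<Rightarrow> bool" where
  "even_lattice L \<longleftrightarrow> full_lattice L \<and> (\<forall>x\<in>L. \<exists>m::int. x \<bullet> x = 2 * of_int m)"

definition dual_lattice :: "(real ^ 'n) set \<Rightarrow> (real ^ 'n) set" where
  "dual_lattice L = {y. \<forall>x\<in>L. x \<bullet> y \<in> \<int>}"

text \<open>
  Since \<open>L\<close> spans \<open>\<real>\<^sup>n\<close>, the complexification \<open>L \<otimes> \<complex>\<close> is \<open>\<complex>\<^sup>n\<close>. The form is extended
  bilinearly, not as a Hermitian form.
\<close>

definition cvec :: "real ^ 'n \<Rightarrow> complex ^ 'n" where
  "cvec x = (\<chi> i. of_real (x $ i))"

definition cform :: "complex ^ 'n \<Rightarrow> complex ^ 'n \<Rightarrow> complex" where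
  "cform z w = (\<Sum>i\<in>UNIV. z $ i * w $ i)"


section \<open>The Dedekind eta function and its multiplier system\<close>

definition dedekind_eta :: "complex \<Rightarrow> complex" where
  "dedekind_eta \<tau> =
     exp (2 * of_real pi * \<i> * \<tau> / 24) *
     (\<Prod>m. 1 - exp (2 * of_real pi * \<i> * of_nat (Suc m) * \<tau>))"

definition moebius :: "int \<Rightarrow> int \<Rightarrow> int \<Rightarrow> int \<Rightarrow> complex \<Rightarrow> complex" where
  "moebius a b c e \<tau> = (of_int a * \<tau> + of_int b) / (of_int c * \<tau> + of_int e)"

text \<open>
  \<open>eta_mult a b c e\<close> is the multiplier at the matrix with rows \<open>(a, b)\<close> and \<open>(c, e)\<close>;
  it is meaningful only if \<open>a * e - b * c = 1\<close>. The value is unique because \<open>\<eta>\<close> has no zeros on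
  the upper half plane. Complex \<open>powr\<close> is the principal branch, with argument in \<open>(-\<pi>, \<pi>]\<close>.
\<close>

definition eta_mult :: "int \<Rightarrow> int \<Rightarrow> int \<Rightarrow> int \<Rightarrow> complex" where
  "eta_mult a b c e =
     (THE v. \<forall>\<tau>. Im \<tau> > 0 \<longrightarrow>
        dedekind_eta (moebius a b c e \<tau>) =
          v * (of_int c * \<tau> + of_int e) powr (1 / 2) * dedekind_eta \<tau>)"


section \<open>Jacobi forms of index one\<close>

text \<open>
  A function of \<open>(\<tau>, z)\<close> is holomorphic if it is Frechet differentiable with complex linear
  derivative; \<open>has_derivative\<close> alone only provides real linearity.
\<close>

definition holomorphic_on_upper :: "(complex \<Rightarrow> complex ^ 'n \<Rightarrow> complex) \<Rightarrow> bool" where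
  "holomorphic_on_upper \<phi> \<longleftrightarrow>
     (\<forall>\<tau> z. Im \<tau> > 0 \<longrightarrow>
        (\<exists>D. ((\<lambda>p. \<phi> (fst p) (snd p)) has_derivative D) (at (\<tau>, z)) \<and>
             (\<forall>s t w. D (s * t, s *s w) = s * D (t, w))))"

definition fourier_index :: "(real ^ 'n) set \<Rightarrow> int \<Rightarrow> (real \<times> (real ^ 'n)) set" where
  "fourier_index L d =
     {(n, l). n \<in> \<rat> \<and> n \<ge> 0 \<and> n - of_int d / 24 \<in> \<int> \<and>
              l \<in> dual_lattice L \<and> 2 * n - l \<bullet> l \<ge> 0}"

definition fourier_expansion ::
  "(real ^ 'n) set \<Rightarrow> int \<Rightarrow> (real \<Rightarrow> real ^ 'n \<Rightarrow> complex) \<Rightarrow>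
   (complex \<Rightarrow> complex ^ 'n \<Rightarrow> complex) \<Rightarrow> bool" where
  "fourier_expansion L d f \<phi> \<longleftrightarrow>
     (\<forall>\<tau> z. Im \<tau> > 0 \<longrightarrow>
        ((\<lambda>(n, l). f n l * exp (2 * of_real pi * \<i> * (of_real n * \<tau> + cform (cvec l) z)))
           has_sum \<phi> \<tau> z) (fourier_index L d))"

text \<open>
  The weight \<open>k\<close> is meant to be a half-integer. Only the values of \<open>\<phi>\<close> for \<open>Im \<tau> > 0\<close> matter:
  members that agree there represent the same Jacobi form.
\<close>

definition jacobi_forms ::
  "real \<Rightarrow> (real ^ 'n) set \<Rightarrow> int \<Rightarrow> (complex \<Rightarrow> complex ^ 'n \<Rightarrow> complex) set" where
  "jacobi_forms k L d =
     {\<phi>. holomorphic_on_upper \<phi> \<and>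
         (\<forall>a b c e \<tau> z. a * e - b * c = 1 \<longrightarrow> Im \<tau> > 0 \<longrightarrow>
            \<phi> (moebius a b c e \<tau>) (inverse (of_int c * \<tau> + of_int e) *s z) =
              eta_mult a b c e powi d *
              (of_int c * \<tau> + of_int e) powr of_real k *
              exp (of_real pi * \<i> * (of_int c * cform z z / (of_int c * \<tau> + of_int e))) *
              \<phi> \<tau> z) \<and>
         (\<forall>x\<in>L. \<forall>y\<in>L. \<forall>\<tau> z. Im \<tau> > 0 \<longrightarrow>
            \<phi> \<tau> (z + \<tau> *s cvec x + cvec y) =
              exp (- of_real pi * \<i> * (of_real (x \<bullet> x) * \<tau> + 2 * cform (cvec x) z)) *
              \<phi> \<tau> z) \<and>
         (\<exists>f. fourier_expansion L d f \<phi>)}"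

text \<open>The coefficients \<open>f n l\<close> with \<open>(n, l)\<close> in the index set are determined by \<open>\<phi>\<close>.\<close>

definition jacobi_cusp_forms ::
  "real \<Rightarrow> (real ^ 'n) set \<Rightarrow> int \<Rightarrow> (complex \<Rightarrow> complex ^ 'n \<Rightarrow> complex) set" where
  "jacobi_cusp_forms k L d =
     {\<phi> \<in> jacobi_forms k L d.
        \<exists>f. fourier_expansion L d f \<phi> \<and>
            (\<forall>(n, l) \<in> fourier_index L d. f n l \<noteq> 0 \<longrightarrow> 2 * n - l \<bullet> l > 0)}"

end

theory Submission
  imports Defs "HOL-Complex_Analysis.Complex_Analysis" "HOL-Probability.Probability"
begin

unbundle no fps_syntax

text \<open>
Write \<open>n\<close> for the rank. A Jacobi form of weight \<open>(n + 1) / 2\<close> arises as a product of theta functions in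
disjoint sets of variables: all factors but one have singular weight (half the number of their
variables), and one factor has critical weight and is a cusp form. A product with a cuspidal factor
is cuspidal, so only the characters have to be matched. The factors are

 \<^item> the odd theta function \<open>\<Sum>(-4/m) q^(m^2/8) \<zeta>^(m/2)\<close>, one variable, singular weight, \<open>d = 3\<close>;

 \<^item> the theta function \<open>\<Sum>(12/m) q^(m^2/24) \<zeta>^(m/2)\<close> of the quintuple product, one variable, singular
   weight, \<open>d = 1\<close>;

 \<^item> the theta function of the hexagonal lattice with the odd character modulo 3, two variables,
   singular weight, \<open>d = 8\<close>;

 \<^item> \<open>\<eta>\<close>, no variable, critical weight \<open>1/2\<close>, \<open>d = 1\<close>;

 \<^item> \<open>\<theta>(z) \<theta>(2z)\<close> for the odd theta function \<open>\<theta>\<close>, one variable, critical weight \<open>1\<close>, \<open>d = 6\<close>; it is a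
   cusp form because \<open>2 u - v\<close> does not vanish for odd \<open>u\<close> and \<open>v\<close>.

In rank 7 the products of \<open>\<eta>\<close> with \<open>c\<close> hexagonal factors and \<open>7 - 2 c\<close> factors in one variable, for
\<open>c \<le> 3\<close>, together with the product of \<open>\<theta>(z) \<theta>(2z)\<close> and three hexagonal factors realise
\<open>d = 8, 10, \<dots>, 30\<close>, which are all even classes modulo 24 (lemma \<open>has_block_rank_7\<close>). Each
further variable is filled with a factor \<open>\<theta>\<close>, which shifts \<open>d\<close> by 3. The character depends only on
\<open>d\<close> modulo 24.

All factors are finite combinations of products of series
\<open>\<Sum>c(m) exp (\<pi> \<i> m^2 \<tau> / N + 2 \<pi> \<i> m w / \<surd>N)\<close> with \<open>c\<close> periodic modulo \<open>N\<close>. The inversion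
\<open>\<tau> \<mapsto> -1/\<tau>\<close> acts on \<open>c\<close> as the finite Fourier transform (lemma \<open>theta_level_inversion\<close>), by Poisson
summation. The eta function is such a series by the pentagonal number theorem; this gives its
inversion formula, its multiplier system, and the fact that the multipliers are 24th roots of unity.
A product of factors is compared with the powers of \<open>\<eta>\<close> under the generators of \<open>SL(2,\<int>)\<close> only
(lemma \<open>jacobi_transformation\<close>). The lattice is an orthogonal sum of rank one lattices on which all
factors are quasi-periodic.
\<close>

section \<open>Theta series in one variable\<close>

abbreviation pi_i :: complex where "pi_i \<equiv> of_real pi * \<i>"

abbreviation two_pi_i :: complex where "two_pi_i \<equiv> 2 * of_real pi * \<i>"

text \<open>
The theta series \<open>\<Sum>c(m) exp (\<pi> \<i> m^2 \<tau> + 2 \<pi> \<i> m w)\<close> over the integers. It is used for bounded \<open>c\<close> and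
\<open>Im \<tau> > 0\<close>, where it converges absolutely.
\<close>

definition theta_term :: "(int \<Rightarrow> complex) \<Rightarrow> complex \<Rightarrow> complex \<Rightarrow> int \<Rightarrow> complex" where
  "theta_term c \<tau> w m = c m * exp (pi_i * (of_int m)\<^sup>2 * \<tau> + two_pi_i * of_int m * w)"

definition theta :: "(int \<Rightarrow> complex) \<Rightarrow> complex \<Rightarrow> complex \<Rightarrow> complex" where
  "theta c \<tau> w = (\<Sum>\<^sub>\<infinity>m. theta_term c \<tau> w m)"

lemma norm_theta_term:
  "norm (theta_term c \<tau> w m) = norm (c m) * exp (- pi * (of_int m)\<^sup>2 * Im \<tau> - 2 * pi * of_int m * Im w)"
  by (simp add: theta_term_def norm_mult power2_eq_square)

text \<open>
A summable majorant of the terms on \<open>Im \<tau> \<ge> \<delta>\<close>, \<open>\<bar>Im w\<bar> \<le> K\<close>. The factor \<open>1 + m^2\<close> makes it also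
majorise the terms of the derivatives.
\<close>

definition theta_bound :: "real \<Rightarrow> real \<Rightarrow> int \<Rightarrow> real" where
  "theta_bound \<delta> K m = (1 + (of_int m)\<^sup>2) * exp (- pi * (of_int m)\<^sup>2 * \<delta> + 2 * pi * \<bar>of_int m\<bar> * K)"

lemma summable_on_exp_abs_int: "(\<lambda>m::int. exp (- \<bar>of_int m\<bar> :: real)) summable_on UNIV"
proof -
  let ?f = "\<lambda>m::int. exp (- \<bar>of_int m\<bar> :: real)"
  have s: "(\<lambda>n::nat. exp (- real n)) summable_on UNIV"
  proof -
    have "(\<lambda>n::nat. exp (- real n)) = (\<lambda>n. exp (-1) ^ n)"
      by (simp add: exp_of_nat_mult[symmetric])
    thus ?thesis by (simp add: summable_on_UNIV_nonneg_real_iff summable_geometric)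
  qed
  have "?f summable_on range int" "?f summable_on range (\<lambda>n. - int n)"
    using s by (subst summable_on_reindex; simp add: inj_def o_def)+
  hence "?f summable_on (range int \<union> range (\<lambda>n. - int n))"
    by (rule summable_on_union)
  also have "range int \<union> range (\<lambda>n. - int n) = UNIV"
    by (auto, metis int_cases2 rangeI)
  finally show ?thesis .
qed

lemma theta_bound_summable:
  assumes "\<delta> > 0"
  shows "theta_bound \<delta> K summable_on UNIV"
proof -
  \<comment> \<open>completing the square bounds the exponent by \<open>C - 2 \<bar>m\<bar>\<close>\<close>
  define C where "C = (2 * pi * K + 2)\<^sup>2 / (4 * pi * \<delta>)"
  have le: "theta_bound \<delta> K m \<le> 3 * exp C * exp (- \<bar>of_int m\<bar>)" for m
  proof -
    define x :: real where "x = \<bar>of_int m\<bar>"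
    have x: "x \<ge> 0" "(of_int m)\<^sup>2 = x\<^sup>2" by (auto simp: x_def)
    have p: "1 + x\<^sup>2 \<le> 3 * exp x"
      using exp_lower_Taylor_quadratic[OF x(1)] x(1) zero_le_power2[of x] by linarith
    have q: "- pi * x\<^sup>2 * \<delta> + 2 * pi * x * K \<le> C - 2 * x"
    proof -
      have "0 \<le> (2 * pi * \<delta> * x - (2 * pi * K + 2))\<^sup>2 / (4 * pi * \<delta>)"
        using assms by simp
      also have "\<dots> = pi * x\<^sup>2 * \<delta> - x * (2 * pi * K + 2) + C"
        using assms by (simp add: C_def field_simps power2_eq_square)
      finally show ?thesis by (simp add: algebra_simps)
    qed
    have "theta_bound \<delta> K m \<le> (3 * exp x) * exp (C - 2 * x)"
      unfolding theta_bound_def x_def[symmetric] x(2) using p q by (intro mult_mono) auto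
    also have "\<dots> = 3 * exp C * exp (-x)"
      by (simp add: exp_add[symmetric] exp_diff field_simps exp_minus)
    finally show ?thesis by (simp add: x_def)
  qed
  show ?thesis
    by (rule summable_on_comparison_test[OF summable_on_cmult_right[OF summable_on_exp_abs_int] le])
      (simp add: theta_bound_def)
qed

lemma theta_term_le_bound:
  assumes "norm (c m) \<le> C" "Im \<tau> \<ge> \<delta>" "\<bar>Im w\<bar> \<le> K"
  shows "norm (theta_term c \<tau> w m) * (1 + (of_int m)\<^sup>2) \<le> C * theta_bound \<delta> K m"
proof -
  have "C \<ge> 0" using assms(1) norm_ge_zero order_trans by blast
  have "exp (- pi * (of_int m)\<^sup>2 * Im \<tau> - 2 * pi * of_int m * Im w) \<le>
        exp (- pi * (of_int m)\<^sup>2 * \<delta> + 2 * pi * \<bar>of_int m\<bar> * K)"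
  proof -
    have a: "pi * (of_int m)\<^sup>2 * \<delta> \<le> pi * (of_int m)\<^sup>2 * Im \<tau>"
      using assms by (intro mult_left_mono) auto
    have "- (of_int m * Im w) \<le> \<bar>of_int m\<bar> * \<bar>Im w\<bar>"
      by (metis abs_ge_minus_self abs_mult)
    also have "\<dots> \<le> \<bar>of_int m\<bar> * K" using assms by (intro mult_left_mono) auto
    finally have "2 * pi * (- (of_int m * Im w)) \<le> 2 * pi * (\<bar>of_int m\<bar> * K)"
      by (intro mult_left_mono) auto
    moreover have "2 * pi * (- (of_int m * Im w)) = - (2 * pi * of_int m * Im w)"
      "2 * pi * (\<bar>of_int m\<bar> * K) = 2 * pi * \<bar>of_int m\<bar> * K"
      by simp_all
    ultimately have "- pi * (of_int m)\<^sup>2 * Im \<tau> - 2 * pi * of_int m * Im w \<le>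
        - pi * (of_int m)\<^sup>2 * \<delta> + 2 * pi * \<bar>of_int m\<bar> * K"
      using a by linarith
    thus ?thesis by simp
  qed
  hence "norm (c m) * exp (- pi * (of_int m)\<^sup>2 * Im \<tau> - 2 * pi * of_int m * Im w) * (1 + (of_int m)\<^sup>2)
     \<le> C * exp (- pi * (of_int m)\<^sup>2 * \<delta> + 2 * pi * \<bar>of_int m\<bar> * K) * (1 + (of_int m)\<^sup>2)"
    using assms \<open>C \<ge> 0\<close> by (intro mult_right_mono mult_mono) auto
  thus ?thesis by (simp add: norm_theta_term theta_bound_def mult_ac)
qed

lemma theta_term_le_bound':
  assumes "norm (c m) \<le> C" "Im \<tau> \<ge> \<delta>" "\<bar>Im w\<bar> \<le> K"
  shows "norm (theta_term c \<tau> w m) \<le> C * theta_bound \<delta> K m"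
proof -
  have "norm (theta_term c \<tau> w m) * 1 \<le> norm (theta_term c \<tau> w m) * (1 + (of_int m)\<^sup>2)"
    by (intro mult_left_mono) auto
  with theta_term_le_bound[of c m C \<delta> \<tau> w K] assms show ?thesis by simp
qed

lemma theta_has_sum:
  assumes "\<And>m. norm (c m) \<le> C" "Im \<tau> > 0"
  shows "(theta_term c \<tau> w has_sum theta c \<tau> w) UNIV"
proof -
  have "(\<lambda>m. norm (theta_term c \<tau> w m)) summable_on UNIV"
  proof (rule summable_on_comparison_test[OF summable_on_cmult_right[OF theta_bound_summable[OF assms(2)]]])
    show "norm (theta_term c \<tau> w m) \<le> C * theta_bound (Im \<tau>) \<bar>Im w\<bar> m" for m
      by (rule theta_term_le_bound'[OF assms(1) order.refl order.refl])
  qed simp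
  thus ?thesis unfolding theta_def by (rule has_sum_infsum[OF abs_summable_summable])
qed

lemma has_sum_int_sums:
  fixes f :: "int \<Rightarrow> 'a::real_normed_vector"
  assumes "(f has_sum S) UNIV"
  shows "(\<lambda>n. f (int_decode n)) sums S"
proof -
  have "((\<lambda>n. f (int_decode n)) has_sum S) UNIV"
    using assms by (subst has_sum_reindex_bij_betw[OF bij_int_decode])
  thus ?thesis by (rule has_sum_imp_sums)
qed

lemma theta_term_has_derivative:
  "((\<lambda>p. theta_term c (fst p) (snd p) m) has_derivative
     (\<lambda>h. theta_term c (fst p) (snd p) m *
        (pi_i * (of_int m)\<^sup>2 * fst h + two_pi_i * of_int m * snd h))) (at p within S)"
proof -
  let ?g = "\<lambda>p. pi_i * (of_int m)\<^sup>2 * fst p + two_pi_i * of_int m * snd p :: complex"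
  have "(?g has_derivative ?g) (at p within S)"
    by (intro has_derivative_add has_derivative_mult_right has_derivative_fst has_derivative_snd has_derivative_ident)
  hence "((\<lambda>p. exp (?g p)) has_derivative (\<lambda>h. ?g h * exp (?g p))) (at p within S)"
    using has_derivative_compose[of ?g ?g p S exp "(*) (exp (?g p))"] DERIV_exp[of "?g p"]
    unfolding has_field_derivative_def by (simp only: mult.commute)
  hence "((\<lambda>p. c m * exp (?g p)) has_derivative (\<lambda>h. c m * (?g h * exp (?g p)))) (at p within S)"
    by (rule has_derivative_mult_right)
  thus ?thesis unfolding theta_term_def by (rule has_derivative_eq_rhs) (simp add: fun_eq_iff mult_ac)
qed

text \<open>
Joint differentiability in \<open>(\<tau>, w)\<close>. The shape of the derivative shows that it is complex linear.
\<close>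

lemma theta_has_derivative:
  assumes c: "\<And>m. norm (c m) \<le> C" and \<tau>: "Im \<tau> > 0"
  shows "\<exists>A B. ((\<lambda>p. theta c (fst p) (snd p)) has_derivative (\<lambda>h. A * fst h + B * snd h)) (at (\<tau>, w))"
proof -
  define \<delta> K where "\<delta> = Im \<tau> / 2" and "K = \<bar>Im w\<bar> + 1"
  define S :: "(complex \<times> complex) set" where "S = {z. Im z > \<delta>} \<times> {z. Im z < K \<and> Im z > -K}"
  have \<delta>: "\<delta> > 0" and K: "K > 0" using \<tau> by (auto simp: \<delta>_def K_def)
  have conv: "convex S" unfolding S_def
    by (intro convex_Times) (auto simp: convex_halfspace_Im_gt convex_halfspace_Im_lt intro!: convex_Int[of "{z. Im z < K}" "{z. Im z > -K}", simplified Int_def mem_Collect_eq])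
  have op: "open S" unfolding S_def
    by (intro open_Times open_halfspace_Im_gt open_Collect_conj open_halfspace_Im_lt)
  have C: "C \<ge> 0" using c[of 0] norm_ge_zero order_trans by blast
  define f where "f n p = theta_term c (fst p) (snd p) (int_decode n)" for n p
  define A where "A n p = f n p * (pi_i * (of_int (int_decode n))\<^sup>2)" for n p
  define B where "B n p = f n p * (two_pi_i * of_int (int_decode n))" for n p
  define b where "b n = 4 * pi * C * theta_bound \<delta> K (int_decode n)" for n
  have b: "summable b"
  proof -
    have "summable (\<lambda>n. theta_bound \<delta> K (int_decode n))"
      using has_sum_int_sums[OF has_sum_infsum[OF theta_bound_summable[OF \<delta>]]] sums_summable by blast
    thus ?thesis unfolding b_def by (intro summable_mult)
  qed
  have fb: "norm (f n p) * (1 + (of_int (int_decode n))\<^sup>2) \<le> C * theta_bound \<delta> K (int_decode n)" if "p \<in> S" for n p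
    unfolding f_def using that by (intro theta_term_le_bound c) (auto simp: S_def)
  have AB: "norm (A n p) \<le> b n / 2" "norm (B n p) \<le> b n / 2" if "p \<in> S" for n p
  proof -
    define x :: real where "x = \<bar>of_int (int_decode n)\<bar>"
    have x: "x \<ge> 0" "(of_int (int_decode n))\<^sup>2 = x\<^sup>2" "norm (of_int (int_decode n) :: complex) = x"
      by (auto simp: x_def)
    have i: "x\<^sup>2 \<le> 1 + x\<^sup>2" "x \<le> 1 + x\<^sup>2"
      using zero_le_power2[of "x - 1"] by (auto simp: power2_eq_square algebra_simps)
        (smt (verit) x(1) mult_nonneg_nonneg)
    have "norm (A n p) = pi * (norm (f n p) * x\<^sup>2)"
      by (simp add: A_def norm_mult norm_power x)
    also have "\<dots> \<le> pi * (norm (f n p) * (1 + x\<^sup>2))"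
      using i by (intro mult_left_mono) auto
    also have "\<dots> \<le> 2 * (pi * (C * theta_bound \<delta> K (int_decode n)))"
      using fb[OF that, of n] unfolding x
      by (smt (verit, best) mult_left_mono pi_gt_zero C theta_bound_def mult_nonneg_nonneg exp_ge_zero zero_le_power2)
    finally show "norm (A n p) \<le> b n / 2" by (simp add: b_def mult_ac)
    have "norm (B n p) = 2 * pi * (norm (f n p) * x)"
      by (simp add: B_def norm_mult x_def)
    also have "\<dots> \<le> 2 * pi * (norm (f n p) * (1 + x\<^sup>2))"
      using i by (intro mult_left_mono) auto
    also have "\<dots> \<le> 2 * pi * (C * theta_bound \<delta> K (int_decode n))"
      using fb[OF that, of n] unfolding x by (intro mult_left_mono) auto
    finally show "norm (B n p) \<le> b n / 2" by (simp add: b_def mult_ac)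
  qed
  define A' B' where "A' p = (\<Sum>n. A n p)" and "B' p = (\<Sum>n. B n p)" for p
  have sA: "summable (\<lambda>n. A n p)" and sB: "summable (\<lambda>n. B n p)" if "p \<in> S" for p
    using AB[OF that] by (auto intro!: summable_comparison_test'[where g = "\<lambda>n. b n / 2" and N = 0] summable_divide b)
  have "\<exists>g. \<forall>p\<in>S. (\<lambda>n. f n p) sums (g p) \<and> (g has_derivative (\<lambda>h. A' p * fst h + B' p * snd h)) (at p within S)"
  proof (rule has_derivative_series[OF conv, where f' = "\<lambda>n p h. A n p * fst h + B n p * snd h"])
    fix n p assume "p \<in> S"
    show "(f n has_derivative (\<lambda>h. A n p * fst h + B n p * snd h)) (at p within S)"
      unfolding f_def A_def B_def
      by (rule has_derivative_eq_rhs[OF theta_term_has_derivative]) (simp add: fun_eq_iff algebra_simps)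
  next
    fix e :: real assume e: "e > 0"
    have "(\<lambda>n. suminf b - sum b {..<n}) \<longlonglongrightarrow> suminf b - suminf b"
      by (intro tendsto_intros summable_LIMSEQ b)
    hence "\<forall>\<^sub>F n in sequentially. suminf b - sum b {..<n} < e"
      using e by (simp add: order_tendstoD(2))
    thus "\<forall>\<^sub>F n in sequentially. \<forall>p\<in>S. \<forall>h. norm ((\<Sum>i<n. A i p * fst h + B i p * snd h) - (A' p * fst h + B' p * snd h)) \<le> e * norm h"
    proof eventually_elim
      case (elim n)
      show ?case
      proof (intro ballI allI)
        fix p h assume p: "p \<in> S"
        have b0: "b i \<ge> 0" for i by (simp add: b_def theta_bound_def C)
        have nb: "norm (A i p * fst h + B i p * snd h) \<le> b i * norm h" for i
        proof -
          have "norm (A i p * fst h + B i p * snd h) \<le> norm (A i p) * norm (fst h) + norm (B i p) * norm (snd h)"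
            by (metis norm_mult norm_triangle_ineq)
          also have "\<dots> \<le> b i / 2 * norm h + b i / 2 * norm h"
            using AB[OF p, of i] norm_fst_le[of "fst h" "snd h"] norm_snd_le[of "snd h" "fst h"] b0[of i]
            by (intro add_mono mult_mono) auto
          finally show ?thesis by (simp add: mult.commute)
        qed
        have ss: "(\<lambda>i. A i p * fst h + B i p * snd h) sums (A' p * fst h + B' p * snd h)"
          unfolding A'_def B'_def by (intro sums_add sums_mult2 summable_sums sA sB p)
        have "(A' p * fst h + B' p * snd h) - (\<Sum>i<n. A i p * fst h + B i p * snd h)
             = (\<Sum>i. A (i + n) p * fst h + B (i + n) p * snd h)"
          using suminf_minus_initial_segment[OF sums_summable[OF ss], of n] sums_unique[OF ss] by simp
        moreover have "norm (\<Sum>i. A (i + n) p * fst h + B (i + n) p * snd h) \<le> (\<Sum>i. b (i + n) * norm h)"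
          by (rule norm_suminf_le[OF nb]) (rule summable_mult2[OF summable_ignore_initial_segment[OF b]])
        moreover have "(\<Sum>i. b (i + n) * norm h) = (suminf b - sum b {..<n}) * norm h"
          using suminf_minus_initial_segment[OF b, of n] suminf_mult2[OF summable_ignore_initial_segment[OF b, of n], of "norm h"]
          by simp
        moreover have "\<dots> \<le> e * norm h" using elim by (intro mult_right_mono) auto
        ultimately have "norm ((A' p * fst h + B' p * snd h) - (\<Sum>i<n. A i p * fst h + B i p * snd h)) \<le> e * norm h"
          by simp
        thus "norm ((\<Sum>i<n. A i p * fst h + B i p * snd h) - (A' p * fst h + B' p * snd h)) \<le> e * norm h"
          by (simp only: norm_minus_commute)
      qed
    qed
  next
    show "(\<tau>, w) \<in> S" using \<tau> by (auto simp: S_def \<delta>_def K_def)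
    show "(\<lambda>n. f n (\<tau>, w)) sums theta c \<tau> w"
      unfolding f_def fst_conv snd_conv by (rule has_sum_int_sums[OF theta_has_sum[OF c \<tau>]])
  qed
  then obtain g where g: "\<And>p. p \<in> S \<Longrightarrow> (\<lambda>n. f n p) sums g p"
    "\<And>p. p \<in> S \<Longrightarrow> (g has_derivative (\<lambda>h. A' p * fst h + B' p * snd h)) (at p within S)" by blast
  have ge: "g p = theta c (fst p) (snd p)" if "p \<in> S" for p
  proof -
    have "(\<lambda>n. f n p) sums theta c (fst p) (snd p)"
      unfolding f_def by (rule has_sum_int_sums[OF theta_has_sum[OF c]]) (use that \<delta> in \<open>auto simp: S_def\<close>)
    thus ?thesis using g(1)[OF that] sums_unique2 by blast
  qed
  have inS: "(\<tau>, w) \<in> S" using \<tau> by (auto simp: S_def \<delta>_def K_def)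
  have "(g has_derivative (\<lambda>h. A' (\<tau>, w) * fst h + B' (\<tau>, w) * snd h)) (at (\<tau>, w))"
    using g(2)[OF inS] unfolding at_within_open[OF inS op] .
  hence "((\<lambda>p. theta c (fst p) (snd p)) has_derivative (\<lambda>h. A' (\<tau>, w) * fst h + B' (\<tau>, w) * snd h)) (at (\<tau>, w))"
    by (rule has_derivative_transform_within_open[OF _ op inS ge])
  thus ?thesis by blast
qed

section \<open>Poisson summation for Gaussians and the inversion formula\<close>

lemma has_sum_int_symmetric:
  assumes "(f has_sum S) (UNIV :: int set)"
  shows "(\<lambda>K::nat. \<Sum>k\<in>{-int K..int K}. f k) \<longlonglongrightarrow> S"
proof -
  have "filterlim (\<lambda>K::nat. {-int K..int K}) (finite_subsets_at_top UNIV) sequentially"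
    unfolding filterlim_finite_subsets_at_top
  proof safe
    fix X :: "int set" assume "finite X"
    then obtain N where N: "\<And>x. x \<in> X \<Longrightarrow> \<bar>x\<bar> \<le> N"
      by (metis finite_abs_int_segment finite_imageI Max_ge image_eqI)
    have "eventually (\<lambda>K. K \<ge> nat N) sequentially" by (rule eventually_ge_at_top)
    thus "\<forall>\<^sub>F K in sequentially. finite {- int K..int K} \<and> X \<subseteq> {- int K..int K} \<and> {- int K..int K} \<subseteq> UNIV"
    proof eventually_elim
      case (elim K)
      thus ?case using N by force
    qed
  qed
  thus ?thesis using assms unfolding has_sum_def by (rule filterlim_compose[rotated])
qed

lemma exp_int_telescope:
  fixes z :: complex
  shows "(\<Sum>k\<in>{-int K..int K}. exp (- of_int k * z)) * (exp z - 1) = exp (of_nat (Suc K) * z) - exp (- of_nat K * z)"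
proof (induction K)
  case 0
  show ?case by simp
next
  case (Suc K)
  have "{-int (Suc K)..int (Suc K)} = insert (-int (Suc K)) (insert (int (Suc K)) {-int K..int K})"
    by auto
  hence "(\<Sum>k\<in>{-int (Suc K)..int (Suc K)}. exp (- of_int k * z)) =
     exp (of_nat (Suc K) * z) + exp (- of_nat (Suc K) * z) + (\<Sum>k\<in>{-int K..int K}. exp (- of_int k * z))"
    by (simp add: algebra_simps)
  hence "(\<Sum>k\<in>{-int (Suc K)..int (Suc K)}. exp (- of_int k * z)) * (exp z - 1) =
     exp (of_nat (Suc K) * z) * (exp z - 1) + exp (- of_nat (Suc K) * z) * (exp z - 1) + 
       (exp (of_nat (Suc K) * z) - exp (- of_nat K * z))"
    using Suc by (simp only: distrib_right)
  also have "exp (of_nat (Suc K) * z) * (exp z - 1) = exp (of_nat (Suc (Suc K)) * z) - exp (of_nat (Suc K) * z)"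
    by (simp add: right_diff_distrib mult_exp_exp algebra_simps)
  also have "exp (- of_nat (Suc K) * z) * (exp z - 1) = exp (- of_nat K * z) - exp (- of_nat (Suc K) * z)"
    by (simp add: right_diff_distrib mult_exp_exp algebra_simps)
  finally show ?case by simp
qed

text \<open>
Convergence of the symmetric Fourier partial sums at the single point 0, by Chernoff's argument: with
\<open>g(x) = (F(x) - F(0)) / (exp (2 \<pi> \<i> x) - 1)\<close> the partial sums of the Fourier series of \<open>F - F(0)\<close>
telescope to a difference of two Fourier coefficients of \<open>g\<close>, which tend to 0.
\<close>

lemma fourier_series_at_zero:
  fixes F :: "complex \<Rightarrow> complex"
  assumes hol: "F holomorphic_on UNIV" and per: "F (1/2) = F (-1/2)"
  shows "(\<lambda>K::nat. \<Sum>k\<in>{-int K..int K}. integral {-1/2..1/2} (\<lambda>x. F (of_real x) * exp (- 2 * of_real pi * \<i> * of_int k * of_real x)))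
           \<longlonglongrightarrow> F 0"
proof -
  define I :: "real set" where "I = {-1/2..1/2}"
  define S where "S = {w::complex. -1 < Re w \<and> Re w < 1}"
  have opS: "open S" and "0 \<in> S" unfolding S_def
    by (auto intro!: open_Collect_conj open_halfspace_Re_gt open_halfspace_Re_lt)
  define E where "E w = exp (two_pi_i * w) - 1" for w :: complex
  define F1 where "F1 = (\<lambda>w. if w = 0 then deriv F 0 else (F w - F 0) / (w - 0))"
  define E1 where "E1 = (\<lambda>w. if w = 0 then deriv E 0 else (E w - E 0) / (w - 0))"
  define g where "g w = F1 w / E1 w" for w
  have E0: "E 0 = 0" by (simp add: E_def)
  have holE: "E holomorphic_on UNIV" unfolding E_def by (intro holomorphic_intros)
  have holF1: "F1 holomorphic_on UNIV" and holE1: "E1 holomorphic_on UNIV" unfolding F1_def E1_def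
    by (rule pole_lemma, use hol holE in auto)+
  have dE: "deriv E 0 = two_pi_i"
    unfolding E_def by (rule DERIV_imp_deriv) (auto intro!: derivative_eq_intros)
  have E1nz: "E1 w \<noteq> 0" if "w \<in> S" for w
  proof (cases "w = 0")
    case True
    thus ?thesis by (simp add: E1_def dE)
  next
    case False
    have "E w \<noteq> 0"
    proof
      assume "E w = 0"
      hence "exp (two_pi_i * w) = 1" by (simp add: E_def)
      then obtain n :: int where n: "Re (two_pi_i * w) = 0" "Im (two_pi_i * w) = of_int (2 * n) * pi"
        unfolding exp_eq_1 by blast
      have "Im w = 0" "Re w = of_int n" using n by auto
      moreover from this have "n = 0" using that by (auto simp: S_def)
      ultimately show False using False by (auto simp: complex_eq_iff)
    qed
    thus ?thesis using False by (simp add: E1_def E0)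
  qed
  have holg: "g holomorphic_on S" unfolding g_def
    using holF1 holE1 E1nz by (intro holomorphic_intros) (auto intro: holomorphic_on_subset)
  have gE: "g w * E w = F w - F 0" if "w \<in> S" for w
    using E1nz[OF that] by (cases "w = 0") (auto simp: g_def F1_def E1_def E0 field_simps)
  have gper: "g (1/2) = g (-1/2)"
  proof -
    have "1/2 \<in> S" "-1/2 \<in> S" by (auto simp: S_def)
    from gE[OF this(1)] gE[OF this(2)] have "g (1/2) * E (1/2) = g (-1/2) * E (-1/2)" using per by simp
    moreover have "E (1/2) = -2" "E (-1/2) = -2"
      using exp_pi_i' by (auto simp: E_def exp_minus mult_ac)
    ultimately show ?thesis by simp
  qed
  have IS: "of_real x \<in> S" if "x \<in> I" for x using that by (auto simp: S_def I_def)
  have contg: "continuous_on I (\<lambda>x. g (of_real x))"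
    by (rule continuous_on_compose2[OF holomorphic_on_imp_continuous_on[OF holg]]) (auto intro!: continuous_intros IS)
  have contg': "continuous_on I (\<lambda>x. deriv g (of_real x))"
    by (rule continuous_on_compose2[OF holomorphic_on_imp_continuous_on[OF holomorphic_deriv[OF holg opS]]])
       (auto intro!: continuous_intros IS)
  have contF: "continuous_on I (\<lambda>x. F (of_real x))"
    by (rule continuous_on_compose2[OF holomorphic_on_imp_continuous_on[OF hol]]) (auto intro!: continuous_intros)
  define e where "e (m::int) x = exp (two_pi_i * of_int m * of_real x)" for m :: int and x :: real
  have conte: "continuous_on I (e m)" for m unfolding e_def by (intro continuous_intros)
  have e_norm: "norm (e m x) = 1" for m x by (simp add: e_def)
  have dere: "((e m) has_vector_derivative (two_pi_i * of_int m * e m x)) (at x within I)" for m x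
    unfolding e_def by (rule has_vector_derivative_eq_rhs, rule has_vector_derivative_real_field)
       (auto intro!: derivative_eq_intros)
  have e_end: "e m (1/2) = e m (-1/2)" for m
  proof -
    have "e m (1/2) = exp (- (pi_i * of_int m) + 2 * of_int m * of_real pi * \<i>)"
      unfolding e_def by (rule arg_cong[where f = exp]) (simp add: algebra_simps)
    also have "\<dots> = exp (- (pi_i * of_int m)) * exp (2 * of_int m * of_real pi * \<i>)"
      by (rule exp_add)
    also have "exp (2 * of_int m * of_real pi * \<i>) = (1 :: complex)" by (simp add: exp_eq_1)
    finally show ?thesis by (simp add: e_def mult.assoc)
  qed
  have inte: "integral I (e m) = (if m = 0 then 1 else 0)" for m
  proof (cases "m = 0")
    case False
    define c where "c = two_pi_i * (of_int m :: complex)"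
    have "((\<lambda>x. two_pi_i * of_int m * e m x) has_integral (e m (1/2) - e m (-1/2))) I"
      unfolding I_def by (rule fundamental_theorem_of_calculus) (use dere in \<open>auto simp: I_def\<close>)
    hence "((\<lambda>x. inverse c * (c * e m x)) has_integral inverse c * 0) I"
      using e_end unfolding c_def by (intro has_integral_mult_right) simp
    moreover have "inverse c * (c * y) = y" for y using False by (simp add: c_def field_simps)
    ultimately have "(e m has_integral 0) I" by simp
    thus ?thesis using False by (simp add: integral_unique)
  next
    case True
    hence "e m = (\<lambda>x. 1)" by (simp add: e_def fun_eq_iff)
    thus ?thesis using True by (simp add: I_def)
  qed
  \<comment> \<open>Fourier coefficients of \<open>g\<close> decay by integration by parts; the boundary terms cancel by periodicity.\<close>
  obtain M where M: "\<And>x. x \<in> I \<Longrightarrow> norm (deriv g (of_real x)) \<le> M"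
  proof -
    have "compact ((\<lambda>x. deriv g (of_real x)) ` I)"
      by (rule compact_continuous_image[OF contg']) (simp add: I_def)
    then obtain M where "\<forall>y\<in>(\<lambda>x. deriv g (of_real x)) ` I. norm y \<le> M"
      using compact_imp_bounded bounded_iff by metis
    thus ?thesis using that by auto
  qed
  have M0: "M \<ge> 0" using order_trans[OF norm_ge_zero M[of 0]] by (simp add: I_def)
  have decay: "norm (integral I (\<lambda>x. g (of_real x) * e m x)) \<le> M / of_int \<bar>m\<bar>" if "m \<noteq> 0" for m
  proof -
    define c where "c = two_pi_i * (of_int m :: complex)"
    have c: "c \<noteq> 0" using that by (simp add: c_def)
    have "((\<lambda>x. g (of_real x) * (c * e m x) + deriv g (of_real x) * e m x) has_integral
        (g (of_real (1/2)) * e m (1/2) - g (of_real (-1/2)) * e m (-1/2))) I"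
      unfolding I_def
    proof (rule fundamental_theorem_of_calculus)
      fix x :: real assume "x \<in> {-1/2..1/2}"
      hence "x \<in> I" by (simp add: I_def)
      have dg: "((\<lambda>x. g (of_real x)) has_vector_derivative deriv g (of_real x)) (at x within I)"
        by (rule has_vector_derivative_real_field)
          (rule holomorphic_derivI[OF holg opS IS[OF \<open>x \<in> I\<close>]])
      show "((\<lambda>x. g (of_real x) * e m x) has_vector_derivative g (of_real x) * (c * e m x) + deriv g (of_real x) * e m x) (at x within {-1/2..1/2})"
        using has_vector_derivative_mult[OF dg dere[of m x]] unfolding I_def c_def .
    qed simp
    hence "((\<lambda>x. g (of_real x) * (c * e m x) + deriv g (of_real x) * e m x) has_integral 0) I"
      using gper e_end[of m] by simp
    moreover have i1: "(\<lambda>x. g (of_real x) * e m x) integrable_on I"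
       and i2: "(\<lambda>x. deriv g (of_real x) * e m x) integrable_on I"
      unfolding I_def using contg contg' conte by (auto intro!: integrable_continuous_interval continuous_intros simp: I_def)
    ultimately have "0 = integral I (\<lambda>x. c * (g (of_real x) * e m x)) + integral I (\<lambda>x. deriv g (of_real x) * e m x)"
      by (subst integral_add[symmetric]) (auto intro: integrable_on_mult_right simp: mult_ac dest!: integral_unique)
    hence "c * integral I (\<lambda>x. g (of_real x) * e m x) = - integral I (\<lambda>x. deriv g (of_real x) * e m x)"
      by (simp add: eq_neg_iff_add_eq_0)
    hence "norm c * norm (integral I (\<lambda>x. g (of_real x) * e m x)) = norm (integral I (\<lambda>x. deriv g (of_real x) * e m x))"
      by (metis norm_minus_cancel norm_mult)
    also have "\<dots> \<le> M * (1/2 - (-1/2))"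
      unfolding I_def
      by (rule integral_bound) (use contg' conte M in \<open>auto intro!: continuous_intros simp: I_def norm_mult e_norm\<close>)
    finally have "norm c * norm (integral I (\<lambda>x. g (of_real x) * e m x)) \<le> M" by simp
    moreover have "of_int \<bar>m\<bar> * norm (integral I (\<lambda>x. g (of_real x) * e m x)) \<le> norm c * norm (integral I (\<lambda>x. g (of_real x) * e m x))"
    proof (rule mult_right_mono)
      have "1 * of_int \<bar>m\<bar> \<le> 2 * pi * of_int \<bar>m\<bar>"
        using pi_ge_two by (intro mult_right_mono) auto
      thus "of_int \<bar>m\<bar> \<le> norm c" by (simp add: c_def norm_mult)
    qed simp
    ultimately show ?thesis using that by (simp add: field_simps)
  qed
  define b where "b m = integral I (\<lambda>x. g (of_real x) * e m x)" for m
  define a where "a k = integral I (\<lambda>x. F (of_real x) * e (-k) x)" for k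
  have sum_a: "(\<Sum>k\<in>{-int K..int K}. a k) - F 0 = b (int K + 1) - b (- int K)" for K
  proof -
    have ia: "(\<lambda>x. F (of_real x) * e (-k) x) integrable_on I" for k
      unfolding I_def using contF conte by (auto intro!: integrable_continuous_interval continuous_intros simp: I_def)
    have ie: "e k integrable_on I" for k
      unfolding I_def using conte by (auto intro!: integrable_continuous_interval simp: I_def)
    have ib: "(\<lambda>x. g (of_real x) * e k x) integrable_on I" for k
      unfolding I_def using contg conte by (auto intro!: integrable_continuous_interval continuous_intros simp: I_def)
    have "F 0 = (\<Sum>k\<in>{-int K..int K}. if k = 0 then F 0 else 0)" by simp
    also have "\<dots> = (\<Sum>k\<in>{-int K..int K}. integral I (\<lambda>x. F 0 * e (-k) x))"
      by (intro sum.cong) (auto simp: inte)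
    finally have "(\<Sum>k\<in>{-int K..int K}. a k) - F 0 = (\<Sum>k\<in>{-int K..int K}. a k - integral I (\<lambda>x. F 0 * e (-k) x))"
      by (simp add: sum_subtractf)
    also have "\<dots> = (\<Sum>k\<in>{-int K..int K}. integral I (\<lambda>x. (F (of_real x) - F 0) * e (-k) x))"
      unfolding a_def by (intro sum.cong refl, subst integral_diff[symmetric])
        (auto intro!: ia ie integrable_on_mult_right simp: algebra_simps)
    also have "\<dots> = integral I (\<lambda>x. \<Sum>k\<in>{-int K..int K}. (F (of_real x) - F 0) * e (-k) x)"
    proof (rule integral_sum[symmetric])
      fix k
      have "(\<lambda>x. F (of_real x) * e (-k) x - F 0 * e (-k) x) integrable_on I"
        by (intro integrable_diff ia integrable_on_mult_right ie)
      thus "(\<lambda>x. (F (of_real x) - F 0) * e (-k) x) integrable_on I" by (simp add: algebra_simps)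
    qed simp
    also have "\<dots> = integral I (\<lambda>x. g (of_real x) * e (int K + 1) x - g (of_real x) * e (- int K) x)"
    proof (rule integral_cong)
      fix x assume "x \<in> I"
      have "(\<Sum>k\<in>{-int K..int K}. (F (of_real x) - F 0) * e (-k) x) =
         g (of_real x) * ((\<Sum>k\<in>{-int K..int K}. exp (- of_int k * (two_pi_i * of_real x))) * (exp (two_pi_i * of_real x) - 1))"
        unfolding gE[OF IS[OF \<open>x \<in> I\<close>], symmetric] sum_distrib_left[symmetric] E_def e_def
        by (simp add: mult_ac)
      also have "\<dots> = g (of_real x) * (e (int K + 1) x - e (- int K) x)"
        unfolding exp_int_telescope e_def by (simp add: mult_ac add.commute)
      finally show "(\<Sum>k\<in>{-int K..int K}. (F (of_real x) - F 0) * e (-k) x) = g (of_real x) * e (int K + 1) x - g (of_real x) * e (- int K) x"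
        by (simp add: algebra_simps)
    qed
    also have "\<dots> = b (int K + 1) - b (- int K)"
      unfolding b_def by (rule integral_diff) (rule ib)+
    finally show ?thesis .
  qed
  have "(\<lambda>K. (\<Sum>k\<in>{-int K..int K}. a k) - F 0) \<longlonglongrightarrow> 0"
  proof (rule Lim_null_comparison)
    show "\<forall>\<^sub>F K in sequentially. norm ((\<Sum>k\<in>{-int K..int K}. a k) - F 0) \<le> M / of_nat K + M / of_nat K"
      using eventually_gt_at_top[of 0]
    proof eventually_elim
      case (elim K)
      have "norm (b (int K + 1)) \<le> M / of_int \<bar>int K + 1\<bar>" "norm (b (- int K)) \<le> M / of_int \<bar>- int K\<bar>"
        unfolding b_def using elim decay[of "int K + 1"] decay[of "- int K"] by simp_all
      moreover have "M / of_int \<bar>int K + 1\<bar> \<le> M / of_nat K"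
        using elim M0 by (intro divide_left_mono) auto
      ultimately show ?case unfolding sum_a using norm_triangle_ineq4[of "b (int K + 1)" "b (- int K)"] by simp
    qed
    have "(\<lambda>K. M * inverse (of_nat K) + M * inverse (of_nat K)) \<longlonglongrightarrow> M * 0 + M * 0"
      by (intro tendsto_intros lim_inverse_n)
    thus "(\<lambda>K. M / of_nat K + M / of_nat K) \<longlonglongrightarrow> 0" by (simp add: divide_inverse)
  qed
  hence "(\<lambda>K. \<Sum>k\<in>{-int K..int K}. a k) \<longlonglongrightarrow> F 0" by (simp add: LIM_zero_iff)
  thus ?thesis by (simp add: a_def e_def I_def mult_ac)
qed

text \<open>
The Fourier transform of a Gaussian, from the characteristic function of the standard normal distribution.
\<close>

lemma gaussian_fourier_integral:
  fixes t x :: real and k :: int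
  assumes t: "t > 0"
  defines "f \<equiv> \<lambda>y. exp (of_real (- pi * (x + y)\<^sup>2 / t) - 2 * of_real pi * \<i> * of_int k * of_real y :: complex)"
  shows "integrable lborel f"
    and "integral\<^sup>L lborel f = of_real (sqrt t) * exp (of_real (- pi * t * (of_int k)\<^sup>2) + two_pi_i * of_int k * of_real x)"
proof -
  define u where "u = - of_int k * sqrt (2 * pi * t)"
  define r where "r = sqrt (2 * pi / t)"
  have r: "r > 0" using t by (simp add: r_def)
  define h where "h z = std_normal_density z *\<^sub>R iexp (u * z)" for z
  have inth: "integrable lborel h"
  proof -
    have "integrable lborel std_normal_density"
      using integrable_std_normal_moment[of 0] by simp
    thus ?thesis unfolding h_def
      by (rule Bochner_Integration.integrable_bound) auto
  qed
  have vh: "integral\<^sup>L lborel h = exp (of_real (- u\<^sup>2 / 2))"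
  proof -
    have "char std_normal_distribution u = integral\<^sup>L lborel h"
      unfolding char_def h_def by (subst integral_density) auto
    thus ?thesis unfolding char_std_normal_distribution exp_of_real by (rule sym)
  qed
  have affine: "h (r * x + r * y) = (1 / sqrt (2 * pi)) *\<^sub>R (exp (- 2 * of_real pi * \<i> * of_int k * of_real x) * f y)" for y
  proof -
    have s: "(r * x + r * y)\<^sup>2 / 2 = pi * (x + y)\<^sup>2 / t"
    proof -
      have "(r * x + r * y)\<^sup>2 = r\<^sup>2 * (x + y)\<^sup>2" by (simp add: power2_eq_square algebra_simps)
      thus ?thesis using t by (simp add: r_def)
    qed
    have ur: "u * (r * x + r * y) = - 2 * pi * of_int k * (x + y)"
    proof -
      have "sqrt (2 * pi * t) * sqrt (2 * pi / t) = sqrt ((2 * pi)\<^sup>2)"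
        using t by (simp add: real_sqrt_mult[symmetric] power2_eq_square)
      also have "\<dots> = 2 * pi" by (rule real_sqrt_unique) auto
      finally have "u * r = - 2 * pi * of_int k" by (simp add: u_def r_def)
      thus ?thesis by (metis distrib_left mult.assoc)
    qed
    have "h (r * x + r * y) = (1 / sqrt (2 * pi)) *\<^sub>R (of_real (exp (- (pi * (x + y)\<^sup>2 / t))) * exp (\<i> * of_real (- 2 * pi * of_int k * (x + y))))"
      unfolding h_def ur std_normal_density_def using s by (simp add: scaleR_conv_of_real)
    also have "of_real (exp (- (pi * (x + y)\<^sup>2 / t))) * exp (\<i> * of_real (- 2 * pi * of_int k * (x + y))) =
        exp (- 2 * of_real pi * \<i> * of_int k * of_real x) * f y"
      unfolding f_def exp_of_real[symmetric] mult_exp_exp by (rule arg_cong[where f = exp]) (simp add: algebra_simps)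
    finally show ?thesis .
  qed
  have fh: "f y = (sqrt (2 * pi)) *\<^sub>R (exp (two_pi_i * of_int k * of_real x) * h (r * x + r * y))" for y
    unfolding affine by (simp add: exp_minus field_simps scaleR_conv_of_real)
  have "integrable lborel (\<lambda>y. h (r * x + r * y))"
    using lborel_integrable_real_affine[OF inth, of r "r * x"] r by simp
  thus "integrable lborel f" unfolding fh[abs_def] by simp
  have "integral\<^sup>L lborel h = \<bar>r\<bar> *\<^sub>R integral\<^sup>L lborel (\<lambda>y. h (r * x + r * y))"
    by (rule lborel_integral_real_affine) (use r in auto)
  hence i: "integral\<^sup>L lborel (\<lambda>y. h (r * x + r * y)) = (1 / r) *\<^sub>R exp (of_real (- u\<^sup>2 / 2))"
    using r vh by (simp add: field_simps scaleR_conv_of_real)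
  have "integral\<^sup>L lborel f = (sqrt (2 * pi)) *\<^sub>R (exp (two_pi_i * of_int k * of_real x) * ((1 / r) *\<^sub>R exp (of_real (- u\<^sup>2 / 2))))"
    unfolding fh[abs_def] i[symmetric] by simp
  also have "\<dots> = of_real (sqrt (2 * pi) / r) * (exp (of_real (- u\<^sup>2 / 2)) * exp (two_pi_i * of_int k * of_real x))"
    by (simp add: scaleR_conv_of_real mult_ac)
  also have "sqrt (2 * pi) / r = sqrt t" using t by (simp add: r_def real_sqrt_divide)
  also have "- u\<^sup>2 / 2 = - pi * t * (of_int k)\<^sup>2" using t by (simp add: u_def power_mult_distrib)
  finally show "integral\<^sup>L lborel f = of_real (sqrt t) * exp (of_real (- pi * t * (of_int k)\<^sup>2) + two_pi_i * of_int k * of_real x)"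
    by (simp only: exp_add)
qed

lemma theta_holomorphic_compose:
  assumes c: "\<And>m. norm (c m) \<le> C" and f: "f holomorphic_on A" and g: "g holomorphic_on A"
    and im: "\<And>x. x \<in> A \<Longrightarrow> Im (f x) > 0"
  shows "(\<lambda>x. theta c (f x) (g x)) holomorphic_on A"
  unfolding holomorphic_on_def field_differentiable_def
proof
  fix x assume x: "x \<in> A"
  obtain f' g' where f': "(f has_field_derivative f') (at x within A)" and g': "(g has_field_derivative g') (at x within A)"
    using f g x unfolding holomorphic_on_def field_differentiable_def by blast
  obtain P Q where PQ: "((\<lambda>p. theta c (fst p) (snd p)) has_derivative (\<lambda>h. P * fst h + Q * snd h)) (at (f x, g x))"
    using theta_has_derivative[of c C "f x" "g x", OF c im[OF x]] by blast
  have "((\<lambda>x. (f x, g x)) has_derivative (\<lambda>h. (f' * h, g' * h))) (at x within A)"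
    by (intro has_derivative_Pair f'[unfolded has_field_derivative_def] g'[unfolded has_field_derivative_def])
  from has_derivative_compose[OF this PQ]
  have "((\<lambda>x. theta c (f x) (g x)) has_derivative (\<lambda>h. (P * f' + Q * g') * h)) (at x within A)"
    by (simp add: algebra_simps)
  thus "\<exists>D. ((\<lambda>x. theta c (f x) (g x)) has_field_derivative D) (at x within A)"
    unfolding has_field_derivative_def by blast
qed

lemma theta_holomorphic_right:
  assumes "\<And>m. norm (c m) \<le> C" "Im \<tau> > 0"
  shows "theta c \<tau> holomorphic_on A"
  using theta_holomorphic_compose[of c C "\<lambda>_. \<tau>" A "\<lambda>w. w"] assms by simp

text \<open>
The theta series with all coefficients equal to 1.
\<close>

abbreviation "theta1 \<equiv> theta (\<lambda>_. 1)"

lemma theta1_has_sum: "Im \<tau> > 0 \<Longrightarrow> (theta_term (\<lambda>_. 1) \<tau> w has_sum theta1 \<tau> w) UNIV"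
  by (rule theta_has_sum[of _ 1]) auto

lemma theta1_minus:
  assumes "Im \<tau> > 0"
  shows "theta1 \<tau> (- w) = theta1 \<tau> w"
proof -
  have "bij (uminus :: int \<Rightarrow> int)" by (rule bij_uminus)
  have "((\<lambda>m. theta_term (\<lambda>_. 1) \<tau> w (- m)) has_sum theta1 \<tau> w) UNIV"
    using has_sum_reindex_bij_betw[OF bij_uminus[where 'a = int], of "theta_term (\<lambda>_. 1) \<tau> w"] theta1_has_sum[OF assms, of w] by blast
  moreover have "theta_term (\<lambda>_. 1) \<tau> w (- m) = theta_term (\<lambda>_. 1) \<tau> (- w) m" for m
    by (simp add: theta_term_def)
  ultimately have "(theta_term (\<lambda>_. 1) \<tau> (- w) has_sum theta1 \<tau> w) UNIV" by simp
  thus ?thesis using theta1_has_sum[OF assms, of "-w"] infsumI by metis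
qed

text \<open>
Poisson summation for a translated Gaussian: both sides are the value at 0 of the 1-periodic function
\<open>\<Sum>exp (-\<pi> (x + w + n)^2 / t)\<close> of \<open>w\<close>, on the right through its Fourier series.
\<close>

lemma poisson_gaussian:
  fixes t x :: real
  assumes t: "t > 0"
  shows "exp (of_real (- pi * x\<^sup>2 / t)) * theta1 (\<i> / of_real t) (\<i> * of_real x / of_real t) = of_real (sqrt t) * theta1 (\<i> * of_real t) (of_real x)"
proof -
  define F where "F w = exp (- of_real pi * (of_real x + w)\<^sup>2 / of_real t) * theta1 (\<i> / of_real t) (\<i> * (of_real x + w) / of_real t)" for w :: complex
  define G where "G n w = exp (- of_real pi * (of_real x + w + of_int n)\<^sup>2 / of_real t)" for n :: int and w :: complex
  have imt: "Im (\<i> / of_real t) > 0" using t by (simp add: Im_divide_of_real)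
  have Gt: "G n w = exp (- of_real pi * (of_real x + w)\<^sup>2 / of_real t) * theta_term (\<lambda>_. 1) (\<i> / of_real t) (\<i> * (of_real x + w) / of_real t) n" for n w
    unfolding G_def theta_term_def mult_1 mult_exp_exp using t
    by (intro arg_cong[where f = exp]) (simp add: field_simps power2_eq_square)
  have GF: "((\<lambda>n. G n w) has_sum F w) UNIV" for w
    unfolding Gt F_def by (intro has_sum_cmult_right theta1_has_sum imt)
  have holF: "F holomorphic_on UNIV"
  proof -
    have "(theta1 (\<i> / of_real t) \<circ> (\<lambda>w. \<i> * (of_real x + w) / of_real t)) holomorphic_on UNIV"
      by (rule holomorphic_on_compose[OF _ theta_holomorphic_right[of _ 1]]) (use imt t in \<open>auto intro!: holomorphic_intros\<close>)
    thus ?thesis unfolding F_def using t by (auto intro!: holomorphic_intros simp: o_def)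
  qed
  have perF: "F (1/2) = F (-1/2)"
  proof -
    have "((\<lambda>n. G (n + 1) (-1/2)) has_sum F (-1/2)) UNIV"
      using has_sum_reindex_bij_betw[of "\<lambda>n::int. n + 1" UNIV UNIV "\<lambda>n. G n (-1/2)"] GF[of "-1/2"] bij_plus_right[of "1::int"] by blast
    moreover have "G (n + 1) (-1/2) = G n (1/2)" for n
      unfolding G_def by (rule arg_cong[where f = exp]) (simp add: algebra_simps)
    ultimately have "((\<lambda>n. G n (1/2)) has_sum F (-1/2)) UNIV" by simp
    thus ?thesis using GF[of "1/2"] infsumI by metis
  qed
  have coeff: "integral {-1/2..1/2} (\<lambda>y. F (of_real y) * exp (- 2 * of_real pi * \<i> * of_int k * of_real y)) =
      of_real (sqrt t) * exp (of_real (- pi * t * (of_int k)\<^sup>2) + two_pi_i * of_int k * of_real x)" for k :: int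
  proof -
    define f where "f y = exp (of_real (- pi * (x + y)\<^sup>2 / t) - 2 * of_real pi * \<i> * of_int k * of_real y :: complex)" for y :: real
    define e where "e y = exp (- 2 * of_real pi * \<i> * of_int k * of_real y)" for y :: real
    have intf: "integrable lborel f"
      and vf: "integral\<^sup>L lborel f = of_real (sqrt t) * exp (of_real (- pi * t * (of_int k)\<^sup>2) + two_pi_i * of_int k * of_real x)"
      unfolding f_def using gaussian_fourier_integral[OF t, of x k] by auto
    have contf: "continuous_on A f" for A unfolding f_def using t by (intro continuous_intros) auto
    define J where "J n = {of_int (int_decode n) - 1/2 ..< of_int (int_decode n) + 1/2 :: real}" for n
    have disj: "J i \<inter> J j = {}" if "i \<noteq> j" for i j
    proof -
      have "int_decode i \<noteq> int_decode j" using that by (metis int_decode_inverse)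
      hence "\<bar>of_int (int_decode i) - of_int (int_decode j) :: real\<bar> \<ge> 1" by linarith
      thus ?thesis by (auto simp: J_def)
    qed
    have UJ: "(\<Union>n. J n) = UNIV"
    proof -
      have "y \<in> J (int_encode \<lfloor>y + 1/2\<rfloor>)" for y :: real
        unfolding J_def int_encode_inverse atLeastLessThan_iff by linarith
      thus ?thesis by blast
    qed
    have setint: "set_integrable lborel A f" if "A \<in> sets lborel" for A
      using intf that unfolding set_integrable_def by (intro integrable_mult_indicator) auto
    have "integral\<^sup>L lborel f = (LINT y:(\<Union>n. J n)|lborel. f y)"
      unfolding UJ by (simp add: set_lebesgue_integral_def)
    also have "\<dots> = (\<Sum>n. LINT y:J n|lborel. f y)"
      by (rule lebesgue_integral_countable_add) (use disj setint in \<open>auto simp: J_def\<close>)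
    finally have Lsum: "integral\<^sup>L lborel f = (\<Sum>n. LINT y:J n|lborel. f y)" .
    have LJ: "(LINT y:J n|lborel. f y) = integral {-1/2..1/2} (\<lambda>y. G (int_decode n) (of_real y) * e y)" for n
    proof -
      let ?j = "of_int (int_decode n) :: real"
      have "(LINT y:J n|lborel. f y) = integral (J n) f"
        by (rule set_borel_integral_eq_integral) (auto simp: J_def intro!: setint)
      also have "\<dots> = integral {?j - 1/2..?j + 1/2} f"
      proof (rule integral_subset_negligible)
        have "{?j - 1/2..?j + 1/2} - J n \<subseteq> {?j + 1/2}" by (auto simp: J_def)
        thus "negligible ({?j - 1/2..?j + 1/2} - J n)" using negligible_sing negligible_subset by blast
      qed (auto simp: J_def)
      also have "\<dots> = integral {-1/2 + ?j..1/2 + ?j} f" by (simp add: algebra_simps)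
      also have "\<dots> = integral {-1/2..1/2} (f \<circ> (\<lambda>y. y + ?j))"
        by (rule integral_shift[symmetric]) (rule contf)
      also have "\<dots> = integral {-1/2..1/2} (\<lambda>y. G (int_decode n) (of_real y) * e y)"
      proof (rule integral_cong)
        fix y :: real
        have "f (y + ?j) = G (int_decode n) (of_real y) * e y * exp (2 * of_int (- k * int_decode n) * of_real pi * \<i>)"
          unfolding f_def G_def e_def mult_exp_exp by (rule arg_cong[where f = exp]) (simp add: algebra_simps)
        also have "exp (2 * of_int (- k * int_decode n) * of_real pi * \<i>) = (1::complex)"
          unfolding exp_eq_1 by (auto intro!: exI[of _ "- k * int_decode n"])
        finally show "(f \<circ> (\<lambda>y. y + ?j)) y = G (int_decode n) (of_real y) * e y" by simp
      qed
      finally show ?thesis .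
    qed
    have ul: "uniform_limit {-1/2..1/2} (\<lambda>N y. \<Sum>n<N. G (int_decode n) (of_real y) * e y) (\<lambda>y. F (of_real y) * e y) sequentially"
    proof -
      define K where "K = (\<bar>x\<bar> + 1) / t"
      have "uniform_limit {-1/2..1/2} (\<lambda>N y. \<Sum>n<N. G (int_decode n) (of_real y) * e y) (\<lambda>y. \<Sum>n. G (int_decode n) (of_real y) * e y) sequentially"
      proof (rule Weierstrass_m_test)
        show "summable (\<lambda>n. theta_bound (1 / t) K (int_decode n))"
          using has_sum_int_sums[OF has_sum_infsum[OF theta_bound_summable[of "1 / t"]]] t sums_summable by force
        fix n and y :: real assume y: "y \<in> {-1/2..1/2}"
        have "norm (theta_term (\<lambda>_. 1) (\<i> / of_real t) (\<i> * (of_real x + of_real y) / of_real t) (int_decode n)) \<le> 1 * theta_bound (1 / t) K (int_decode n)"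
          using y t by (intro theta_term_le_bound') (auto simp: K_def Im_divide_of_real abs_divide intro!: divide_right_mono)
        moreover have "norm (exp (- of_real pi * (of_real x + of_real y)\<^sup>2 / of_real t :: complex)) \<le> 1"
        proof -
          have "- of_real pi * (of_real x + of_real y)\<^sup>2 / of_real t = (of_real (- pi * (x + y)\<^sup>2 / t) :: complex)" by simp
          hence "norm (exp (- of_real pi * (of_real x + of_real y)\<^sup>2 / of_real t :: complex)) = exp (- pi * (x + y)\<^sup>2 / t)"
            by (simp only: norm_exp_eq_Re Re_complex_of_real)
          thus ?thesis using t by simp
        qed
        moreover have "norm (e y) = 1" by (simp add: e_def)
        ultimately show "norm (G (int_decode n) (of_real y) * e y) \<le> theta_bound (1 / t) K (int_decode n)"
          unfolding Gt norm_mult using mult_mono[of "norm (exp (- of_real pi * (of_real x + of_real y)\<^sup>2 / of_real t :: complex))" 1] by fastforce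
      qed
      moreover have "(\<Sum>n. G (int_decode n) (of_real y) * e y) = F (of_real y) * e y" for y
        by (rule sums_unique[symmetric], rule sums_mult2, rule has_sum_int_sums, rule GF)
      ultimately show ?thesis by simp
    qed
    have contG: "continuous_on {-1/2..1/2} (\<lambda>y. \<Sum>n<N. G (int_decode n) (of_real y) * e y)" for N
      unfolding G_def e_def using t by (intro continuous_intros) auto
    have intG: "(\<lambda>y. G (int_decode n) (of_real y) * e y) integrable_on {-1/2..1/2}" for n
      unfolding G_def e_def using t by (intro integrable_continuous_interval continuous_intros) auto
    obtain I1 J1 where IJ: "\<And>N. ((\<lambda>y. \<Sum>n<N. G (int_decode n) (of_real y) * e y) has_integral I1 N) {-1/2..1/2}"
        "((\<lambda>y. F (of_real y) * e y) has_integral J1) {-1/2..1/2}" "I1 \<longlonglongrightarrow> J1"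
      using uniform_limit_integral[OF ul contG] by auto
    have "I1 N = (\<Sum>n<N. integral {-1/2..1/2} (\<lambda>y. G (int_decode n) (of_real y) * e y))" for N
    proof -
      have "integral {-1/2..1/2} (\<lambda>y. \<Sum>n<N. G (int_decode n) (of_real y) * e y) = (\<Sum>n<N. integral {-1/2..1/2} (\<lambda>y. G (int_decode n) (of_real y) * e y))"
        by (rule integral_sum) (simp, rule intG)
      thus ?thesis using integral_unique[OF IJ(1), of N] by simp
    qed
    hence "(\<lambda>n. integral {-1/2..1/2} (\<lambda>y. G (int_decode n) (of_real y) * e y)) sums J1"
      using IJ(3) unfolding sums_def by presburger
    hence "J1 = integral\<^sup>L lborel f" unfolding Lsum LJ by (rule sums_unique)
    thus ?thesis using integral_unique[OF IJ(2)] vf by (simp add: e_def)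
  qed
  have "(\<lambda>K::nat. \<Sum>k\<in>{-int K..int K}. of_real (sqrt t) * theta_term (\<lambda>_. 1) (\<i> * of_real t) (of_real x) k) \<longlonglongrightarrow> F 0"
  proof -
    have "of_real (sqrt t) * theta_term (\<lambda>_. 1) (\<i> * of_real t) (of_real x) k = 
       integral {-1/2..1/2} (\<lambda>y. F (of_real y) * exp (- 2 * of_real pi * \<i> * of_int k * of_real y))" for k
      unfolding coeff theta_term_def by (simp add: algebra_simps)
    thus ?thesis using fourier_series_at_zero[OF holF perF] by simp
  qed
  moreover have "(\<lambda>K::nat. \<Sum>k\<in>{-int K..int K}. of_real (sqrt t) * theta_term (\<lambda>_. 1) (\<i> * of_real t) (of_real x) k) 
     \<longlonglongrightarrow> of_real (sqrt t) * theta1 (\<i> * of_real t) (of_real x)"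
    by (intro has_sum_int_symmetric has_sum_cmult_right theta1_has_sum) (use t in auto)
  ultimately have "F 0 = of_real (sqrt t) * theta1 (\<i> * of_real t) (of_real x)"
    by (rule LIMSEQ_unique)
  thus ?thesis by (simp add: F_def)
qed

text \<open>
The previous identity is the case of imaginary \<open>\<tau>\<close> and real \<open>w\<close>; analytic continuation, first in \<open>w\<close> and
then in \<open>\<tau>\<close>, gives the general case.
\<close>

lemma theta1_inversion:
  assumes \<tau>: "Im \<tau> > 0"
  shows "theta1 (- 1 / \<tau>) (w / \<tau>) = csqrt (- \<i> * \<tau>) * exp (pi_i * w\<^sup>2 / \<tau>) * theta1 \<tau> w"
proof -
  define H :: "complex set" where "H = {\<tau>. Im \<tau> > 0}"
  have opH: "open H" and conH: "connected H" unfolding H_def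
    by (auto intro: open_halfspace_Im_gt convex_connected convex_halfspace_Im_gt)
  have H0: "\<tau> \<noteq> 0" if "\<tau> \<in> H" for \<tau> using that by (auto simp: H_def)
  have inv: "- 1 / \<tau> \<in> H" if "\<tau> \<in> H" for \<tau>
    using that by (auto simp: H_def Im_divide power2_eq_square intro!: divide_pos_pos add_nonneg_pos)
  have H1: "theta1 (- 1 / \<tau>) (w / \<tau>) - csqrt (- \<i> * \<tau>) * exp (pi_i * w\<^sup>2 / \<tau>) * theta1 \<tau> w = 0"
    if "\<tau> = \<i> * of_real t" "t > 0" for t w \<tau>
  proof -
    have tH: "\<tau> \<in> H" using that by (simp add: H_def)
    show ?thesis
    proof (rule analytic_continuation[where f = "\<lambda>w. theta1 (- 1 / \<tau>) (w / \<tau>) - csqrt (- \<i> * \<tau>) * exp (pi_i * w\<^sup>2 / \<tau>) * theta1 \<tau> w"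
          and S = UNIV and U = "\<real>" and \<xi> = 0])
      have "(theta1 (- 1 / \<tau>) \<circ> (\<lambda>w. w / \<tau>)) holomorphic_on UNIV"
        by (rule holomorphic_on_compose[OF _ theta_holomorphic_right[of _ 1]])
           (use inv[OF tH] H0[OF tH] in \<open>auto intro!: holomorphic_intros simp: H_def\<close>)
      thus "(\<lambda>w. theta1 (- 1 / \<tau>) (w / \<tau>) - csqrt (- \<i> * \<tau>) * exp (pi_i * w\<^sup>2 / \<tau>) * theta1 \<tau> w) holomorphic_on UNIV"
        using H0[OF tH] tH by (auto intro!: holomorphic_intros theta_holomorphic_right[of _ 1] simp: o_def H_def)
      show "(0::complex) islimpt \<real>"
      proof (rule islimptI)
        fix T :: "complex set" assume "0 \<in> T" "open T"
        then obtain e where e: "e > 0" "ball 0 e \<subseteq> T" by (auto simp: open_contains_ball)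
        hence "of_real (e / 2) \<in> T" by (intro subsetD[OF e(2)]) auto
        thus "\<exists>y\<in>\<real>. y \<in> T \<and> y \<noteq> 0" using e(1) by (intro bexI[of _ "of_real (e/2)"]) auto
      qed
      fix w :: complex assume "w \<in> \<real>"
      then obtain x where x: "w = of_real x" by (auto elim: Reals_cases)
      have m: "- \<i> * \<tau> = of_real t" using that by simp
      have c: "csqrt (- \<i> * \<tau>) = of_real (sqrt t)" unfolding m using that(2) by (simp add: csqrt_of_real_nonneg)
      have i1: "- 1 / \<tau> = \<i> / of_real t" using that by (simp add: field_simps)
      have i2: "w / \<tau> = - (\<i> * of_real x / of_real t)" using that x by (simp add: field_simps)
      have i3: "pi_i * w\<^sup>2 / \<tau> = of_real (pi * x\<^sup>2 / t)" using that x by (simp add: field_simps)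
      have "theta1 (- 1 / \<tau>) (w / \<tau>) = theta1 (\<i> / of_real t) (\<i> * of_real x / of_real t)"
        unfolding i1 i2 by (rule theta1_minus) (use that in \<open>simp add: Im_divide_of_real\<close>)
      also have "\<dots> = exp (of_real (pi * x\<^sup>2 / t)) * (exp (of_real (- pi * x\<^sup>2 / t)) * theta1 (\<i> / of_real t) (\<i> * of_real x / of_real t))"
        by (simp add: mult.assoc[symmetric] mult_exp_exp)
      also have "\<dots> = exp (of_real (pi * x\<^sup>2 / t)) * (of_real (sqrt t) * theta1 \<tau> w)"
        unfolding poisson_gaussian[OF that(2)] x that(1) ..
      finally show "theta1 (- 1 / \<tau>) (w / \<tau>) - csqrt (- \<i> * \<tau>) * exp (pi_i * w\<^sup>2 / \<tau>) * theta1 \<tau> w = 0"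
        unfolding c i3 by simp
    qed auto
  qed
  have "theta1 (- 1 / \<tau>) (w / \<tau>) - csqrt (- \<i> * \<tau>) * exp (pi_i * w\<^sup>2 / \<tau>) * theta1 \<tau> w = 0"
  proof (rule analytic_continuation[where f = "\<lambda>\<tau>. theta1 (- 1 / \<tau>) (w / \<tau>) - csqrt (- \<i> * \<tau>) * exp (pi_i * w\<^sup>2 / \<tau>) * theta1 \<tau> w"
        and S = H and U = "{\<i> * of_real t | t. t > 0}" and \<xi> = \<i>])
    have "- \<i> * \<tau> \<notin> \<real>\<^sub>\<le>\<^sub>0" if "\<tau> \<in> H" for \<tau>
      using that by (auto simp: H_def complex_nonpos_Reals_iff)
    moreover have "Im (- 1 / \<tau>) > 0" "Im \<tau> > 0" if "\<tau> \<in> H" for \<tau>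
      using inv[OF that] that by (simp_all only: H_def mem_Collect_eq)
    ultimately show "(\<lambda>\<tau>. theta1 (- 1 / \<tau>) (w / \<tau>) - csqrt (- \<i> * \<tau>) * exp (pi_i * w\<^sup>2 / \<tau>) * theta1 \<tau> w) holomorphic_on H"
      using H0 by (intro holomorphic_intros theta_holomorphic_compose[of _ 1]) auto
    show "\<i> islimpt {\<i> * of_real t | t. t > 0}"
    proof (rule islimptI)
      fix T :: "complex set" assume "\<i> \<in> T" "open T"
      then obtain e where e: "e > 0" "ball \<i> e \<subseteq> T" by (auto simp: open_contains_ball)
      have "dist \<i> (\<i> * of_real (1 + e / 2)) = e / 2"
        using e(1) by (simp add: dist_norm algebra_simps norm_mult)
      hence "\<i> * of_real (1 + e / 2) \<in> T" using e(1) by (intro subsetD[OF e(2)]) simp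
      moreover have "\<i> * of_real (1 + e / 2) \<noteq> \<i>" using e(1) by (simp add: complex_eq_iff)
      ultimately show "\<exists>y\<in>{\<i> * of_real t | t. t > 0}. y \<in> T \<and> y \<noteq> \<i>"
        using e(1) by (intro bexI[of _ "\<i> * of_real (1 + e / 2)"]) (auto intro!: exI[of _ "1 + e / 2"])
    qed
    show "{\<i> * of_real t | t. t > 0} \<subseteq> H" "\<i> \<in> H" "\<tau> \<in> H" using \<tau> by (auto simp: H_def)
  qed (use opH conH H1 in auto)
  thus ?thesis by simp
qed

section \<open>Theta series with periodic coefficients\<close>

text \<open>
Coefficient functions with a positive period \<open>N\<close>.
\<close>

definition periodic :: "nat \<Rightarrow> (int \<Rightarrow> complex) \<Rightarrow> bool" where
  "periodic N c \<longleftrightarrow> N > 0 \<and> (\<forall>m. c (m + int N) = c m)"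

lemma periodic_mult:
  assumes "periodic N c"
  shows "c (m + int N * k) = c m"
proof (induction k rule: int_induct[where k = 0])
  case base
  show ?case by simp
next
  case (step1 i)
  have "c (m + int N * (i + 1)) = c (m + int N * i + int N)" by (simp add: algebra_simps)
  thus ?case using step1 assms by (simp add: periodic_def)
next
  case (step2 i)
  have "c (m + int N * (i - 1)) = c (m + int N * (i - 1) + int N)" using assms by (simp only: periodic_def)
  also have "m + int N * (i - 1) + int N = m + int N * i" by (simp add: algebra_simps)
  finally show ?case using step2 by simp
qed

lemma periodic_mod:
  assumes "periodic N c"
  shows "c (m mod int N) = c m"
  using periodic_mult[OF assms, of "m mod int N" "m div int N"] by simp

lemma periodic_bounded:
  assumes "periodic N c"
  shows "norm (c m) \<le> (\<Sum>a<N. norm (c (int a)))"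
proof -
  have N: "N > 0" using assms by (simp add: periodic_def)
  hence "0 \<le> m mod int N" "m mod int N < int N" by auto
  then obtain a where a: "m mod int N = int a" "a < N"
    by (metis nonneg_int_cases of_nat_less_iff)
  have "norm (c m) = norm (c (int a))" using periodic_mod[OF assms, of m] a by simp
  also have "\<dots> \<le> (\<Sum>a<N. norm (c (int a)))"
    using a(2) by (intro member_le_sum) auto
  finally show ?thesis .
qed

lemma theta_add:
  assumes "\<And>m. norm (c m) \<le> C" "\<And>m. norm (c' m) \<le> C'" "Im \<tau> > 0"
  shows "theta (\<lambda>m. c m + c' m) \<tau> w = theta c \<tau> w + theta c' \<tau> w"
proof -
  have "((\<lambda>m. theta_term c \<tau> w m + theta_term c' \<tau> w m) has_sum (theta c \<tau> w + theta c' \<tau> w)) UNIV"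
    by (intro has_sum_add theta_has_sum[of c C] theta_has_sum[of c' C'] assms)
  moreover have "(\<lambda>m. theta_term c \<tau> w m + theta_term c' \<tau> w m) = theta_term (\<lambda>m. c m + c' m) \<tau> w"
    by (simp add: theta_term_def fun_eq_iff distrib_right)
  ultimately show ?thesis by (simp add: theta_def infsumI)
qed

lemma theta_cmult: "theta (\<lambda>m. k * c m) \<tau> w = k * theta c \<tau> w"
proof -
  have "theta_term (\<lambda>m. k * c m) \<tau> w = (\<lambda>m. k * theta_term c \<tau> w m)"
    by (simp add: theta_term_def fun_eq_iff mult_ac)
  thus ?thesis by (simp add: theta_def infsum_cmult_right')
qed

lemma theta_sum:
  assumes "finite A" "\<And>a m. a \<in> A \<Longrightarrow> norm (c a m) \<le> C a" "Im \<tau> > 0"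
  shows "theta (\<lambda>m. \<Sum>a\<in>A. c a m) \<tau> w = (\<Sum>a\<in>A. theta (c a) \<tau> w)"
  using assms
proof (induction A rule: finite_induct)
  case empty
  show ?case by (simp add: theta_def theta_term_def)
next
  case (insert b A)
  have "norm (\<Sum>a\<in>A. c a m) \<le> (\<Sum>a\<in>A. C a)" for m
    using insert.prems by (intro sum_norm_le) auto
  hence "theta (\<lambda>m. c b m + (\<Sum>a\<in>A. c a m)) \<tau> w = theta (c b) \<tau> w + theta (\<lambda>m. \<Sum>a\<in>A. c a m) \<tau> w"
    using insert.prems by (intro theta_add[of _ "C b" _ "\<Sum>a\<in>A. C a"]) auto
  thus ?case using insert by simp
qed

text \<open>
Sorting the summation index by its residue modulo \<open>N\<close> reduces periodic coefficients to constant ones.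
\<close>

lemma theta_residue_classes:
  assumes c: "periodic N c" and \<tau>: "Im \<tau> > 0"
  shows "theta c \<tau> w = (\<Sum>a<N. c (int a) * exp (pi_i * (of_nat a)\<^sup>2 * \<tau> + two_pi_i * of_nat a * w) *
            theta1 ((of_nat N)\<^sup>2 * \<tau>) (of_nat N * (of_nat a * \<tau> + w)))"
proof -
  have N: "N > 0" using c by (simp add: periodic_def)
  define d where "d a m = (if m mod int N = int a then c (int a) else 0)" for a m
  have cd: "c m = (\<Sum>a<N. d a m)" for m
  proof -
    have "0 \<le> m mod int N" "m mod int N < int N" using N by auto
    then obtain a where a: "m mod int N = int a" "a < N"
      by (metis nonneg_int_cases of_nat_less_iff)
    have "(\<Sum>b<N. d b m) = (\<Sum>b<N. if b = a then c (int a) else 0)"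
      by (intro sum.cong) (auto simp: d_def a)
    thus ?thesis using a periodic_mod[OF c, of m] by simp
  qed
  have dn: "norm (d a m) \<le> norm (c (int a))" for a m by (simp add: d_def)
  have "theta c \<tau> w = theta (\<lambda>m. \<Sum>a<N. d a m) \<tau> w" using cd by (metis ext)
  also have "\<dots> = (\<Sum>a<N. theta (d a) \<tau> w)"
    by (rule theta_sum[where C = "\<lambda>a. norm (c (int a))"]) (use dn \<tau> in auto)
  also have "\<dots> = (\<Sum>a<N. c (int a) * exp (pi_i * (of_nat a)\<^sup>2 * \<tau> + two_pi_i * of_nat a * w) *
            theta1 ((of_nat N)\<^sup>2 * \<tau>) (of_nat N * (of_nat a * \<tau> + w)))"
  proof (rule sum.cong[OF refl])
    fix a assume "a \<in> {..<N}"
    hence a: "a < N" by simp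
    define h where "h k = int a + int N * k" for k
    have inj: "inj h" using N by (auto simp: inj_def h_def)
    have rng: "m \<in> range h \<longleftrightarrow> m mod int N = int a" for m
    proof
      assume "m \<in> range h"
      thus "m mod int N = int a" using a by (auto simp: h_def)
    next
      assume "m mod int N = int a"
      hence "m = h (m div int N)" unfolding h_def by (metis mult_div_mod_eq add.commute)
      thus "m \<in> range h" by blast
    qed
    have im: "Im ((of_nat N)\<^sup>2 * \<tau>) > 0" using \<tau> N
      by (simp add: power2_eq_square)
    have t: "theta_term (d a) \<tau> w (h k) = c (int a) * exp (pi_i * (of_nat a)\<^sup>2 * \<tau> + two_pi_i * of_nat a * w) *
         theta_term (\<lambda>_. 1) ((of_nat N)\<^sup>2 * \<tau>) (of_nat N * (of_nat a * \<tau> + w)) k" for k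
    proof -
      have "h k mod int N = int a" using rng by blast
      moreover have "exp (pi_i * (of_int (h k))\<^sup>2 * \<tau> + two_pi_i * of_int (h k) * w) =
          exp (pi_i * (of_nat a)\<^sup>2 * \<tau> + two_pi_i * of_nat a * w) *
          exp (pi_i * (of_int k)\<^sup>2 * ((of_nat N)\<^sup>2 * \<tau>) + two_pi_i * of_int k * (of_nat N * (of_nat a * \<tau> + w)))"
        unfolding mult_exp_exp by (rule arg_cong[where f = exp]) (simp add: h_def power2_eq_square algebra_simps)
      ultimately show ?thesis by (simp add: theta_term_def d_def)
    qed
    have "((\<lambda>k. theta_term (d a) \<tau> w (h k)) has_sum c (int a) * exp (pi_i * (of_nat a)\<^sup>2 * \<tau> + two_pi_i * of_nat a * w) *
            theta1 ((of_nat N)\<^sup>2 * \<tau>) (of_nat N * (of_nat a * \<tau> + w))) UNIV"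
      unfolding t by (intro has_sum_cmult_right theta1_has_sum im)
    hence "(theta_term (d a) \<tau> w has_sum c (int a) * exp (pi_i * (of_nat a)\<^sup>2 * \<tau> + two_pi_i * of_nat a * w) *
            theta1 ((of_nat N)\<^sup>2 * \<tau>) (of_nat N * (of_nat a * \<tau> + w))) (range h)"
      using has_sum_reindex[OF inj, of "theta_term (d a) \<tau> w"] by (simp add: o_def)
    hence "(theta_term (d a) \<tau> w has_sum c (int a) * exp (pi_i * (of_nat a)\<^sup>2 * \<tau> + two_pi_i * of_nat a * w) *
            theta1 ((of_nat N)\<^sup>2 * \<tau>) (of_nat N * (of_nat a * \<tau> + w))) UNIV"
      by (rule has_sum_cong_neutral[THEN iffD1, rotated -1]) (auto simp: theta_term_def d_def rng)
    thus "theta (d a) \<tau> w = c (int a) * exp (pi_i * (of_nat a)\<^sup>2 * \<tau> + two_pi_i * of_nat a * w) *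
            theta1 ((of_nat N)\<^sup>2 * \<tau>) (of_nat N * (of_nat a * \<tau> + w))"
      unfolding theta_def by (rule infsumI)
  qed
  finally show ?thesis .
qed

text \<open>
The theta series of the lattice \<open>\<surd>N \<int>\<close> and its dual: the summation runs over \<open>m / \<surd>N\<close> in the dual
lattice, and the variable \<open>w\<close> is normalised such that the quadratic form is \<open>w^2\<close>. For even \<open>N\<close> the
lattice is even.
\<close>

definition theta_level :: "nat \<Rightarrow> (int \<Rightarrow> complex) \<Rightarrow> complex \<Rightarrow> complex \<Rightarrow> complex" where
  "theta_level N c \<tau> w = theta c (\<tau> / of_nat N) (w / of_real (sqrt N))"

text \<open>
The finite Fourier transform modulo \<open>N\<close>, without normalising factor.
\<close>

definition dft :: "nat \<Rightarrow> (int \<Rightarrow> complex) \<Rightarrow> int \<Rightarrow> complex" where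
  "dft N c k = (\<Sum>a<N. c (int a) * exp (- 2 * of_real pi * \<i> * of_nat a * of_int k / of_nat N))"

lemma Im_divide_nat: "Im (\<tau> / of_nat N) = Im \<tau> / of_nat N"
  using Im_divide_of_real[of \<tau> "of_nat N"] by simp

lemma csqrt_divide_nat:
  assumes "N > 0"
  shows "csqrt (z / of_nat N) = csqrt z / of_real (sqrt N)"
proof (rule csqrt_unique)
  show "(csqrt z / of_real (sqrt (real N)))\<^sup>2 = z / of_nat N"
    by (simp add: power_divide of_real_power[symmetric] del: of_real_power)
  show "0 < Re (csqrt z / of_real (sqrt (real N))) \<or> Re (csqrt z / of_real (sqrt (real N))) = 0 \<and> 0 \<le> Im (csqrt z / of_real (sqrt (real N)))"
    using csqrt_principal[of z] assms by (simp add: Re_divide_of_real Im_divide_of_real) (auto simp: zero_less_divide_iff)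
qed

lemma theta_level_inversion:
  assumes c: "periodic N c" and \<tau>: "Im \<tau> > 0"
  shows "theta_level N c (- 1 / \<tau>) (w / \<tau>) =
     csqrt (- \<i> * \<tau>) / of_real (sqrt N) * exp (pi_i * w\<^sup>2 / \<tau>) * theta_level N (dft N c) \<tau> w"
proof -
  have N: "N > 0" using c by (simp add: periodic_def)
  have \<tau>0: "\<tau> \<noteq> 0" using \<tau> by auto
  have im1: "Im (- 1 / \<tau> / of_nat N) > 0"
    using \<tau> N by (simp add: Im_divide_nat Im_divide power2_eq_square) (auto intro!: divide_pos_pos add_nonneg_pos)
  have im2: "Im (\<tau> / of_nat N) > 0" using \<tau> N by (simp add: Im_divide_nat)
  define s :: complex where "s = of_real (sqrt N)"
  have s2: "s * s = of_nat N"
    unfolding s_def by (metis of_real_mult of_real_of_nat_eq real_sqrt_mult_self abs_of_nat)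
  have s0: "s \<noteq> 0" using N by (simp add: s_def)
  have Ns: "of_nat N \<noteq> (0::complex)" using N by simp
  define e where "e a k = exp (- 2 * of_real pi * \<i> * of_nat a * of_int k / of_nat N :: complex)" for a :: nat and k :: int
  have ne: "norm (e a k) = 1" for a k
  proof -
    have "- 2 * of_real pi * \<i> * of_nat a * of_int k / of_nat N = \<i> * of_real (- 2 * pi * real a * of_int k / real N)"
      by simp
    thus ?thesis unfolding e_def by (simp only: norm_exp_i_times)
  qed
  have term_a: "exp (pi_i * (of_nat a)\<^sup>2 * (- 1 / \<tau> / of_nat N) + two_pi_i * of_nat a * (w / \<tau> / s)) *
        theta1 ((of_nat N)\<^sup>2 * (- 1 / \<tau> / of_nat N)) (of_nat N * (of_nat a * (- 1 / \<tau> / of_nat N) + w / \<tau> / s)) =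
        csqrt (- \<i> * \<tau>) / s * exp (pi_i * w\<^sup>2 / \<tau>) * theta (e a) (\<tau> / of_nat N) (w / s)" for a
  proof -
    define T where "T = \<tau> / of_nat N"
    define W where "W = w / s - of_nat a / of_nat N"
    have T0: "T \<noteq> 0" using \<tau>0 N by (simp add: T_def)
    have e1: "(of_nat N)\<^sup>2 * (- 1 / \<tau> / of_nat N) = - 1 / T" using \<tau>0 Ns by (simp add: T_def power2_eq_square)
    have e2: "of_nat N * (of_nat a * (- 1 / \<tau> / of_nat N) + w / \<tau> / s) = W / T"
      using \<tau>0 Ns s0 by (simp add: T_def W_def field_simps)
    have e3: "theta1 T W = theta (e a) T (w / s)"
    proof -
      have "theta_term (\<lambda>_. 1) T W k = theta_term (e a) T (w / s) k" for k
        unfolding theta_term_def e_def mult_1 mult_exp_exp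
        by (rule arg_cong[where f = exp]) (simp add: W_def algebra_simps)
      thus ?thesis by (simp add: theta_def)
    qed
    have e4: "csqrt (- \<i> * T) = csqrt (- \<i> * \<tau>) / s"
      using csqrt_divide_nat[OF N, of "- \<i> * \<tau>"] by (simp add: T_def s_def)
    have e5: "pi_i * (of_nat a)\<^sup>2 * (- 1 / \<tau> / of_nat N) + two_pi_i * of_nat a * (w / \<tau> / s) + pi_i * W\<^sup>2 / T
          = pi_i * w\<^sup>2 / \<tau>"
    proof -
      have W2: "W\<^sup>2 / T = (w\<^sup>2 - 2 * of_nat a * w / s + (of_nat a)\<^sup>2 / of_nat N) / \<tau>"
        using \<tau>0 Ns s0 unfolding T_def W_def s2[symmetric] by (simp add: field_simps power2_eq_square)
      have "pi_i * (of_nat a)\<^sup>2 * (- 1 / \<tau> / of_nat N) + two_pi_i * of_nat a * (w / \<tau> / s) + pi_i * W\<^sup>2 / T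
        = pi_i * (((of_nat a)\<^sup>2 * (- 1 / of_nat N) + 2 * of_nat a * w / s) / \<tau> + W\<^sup>2 / T)"
        by (simp add: algebra_simps add_divide_distrib diff_divide_distrib)
      also have "((of_nat a)\<^sup>2 * (- 1 / of_nat N) + 2 * of_nat a * w / s) / \<tau> + W\<^sup>2 / T = w\<^sup>2 / \<tau>"
        unfolding W2 by (simp add: add_divide_distrib diff_divide_distrib)
      finally show ?thesis by simp
    qed
    have "theta1 (- 1 / T) (W / T) = csqrt (- \<i> * T) * exp (pi_i * W\<^sup>2 / T) * theta1 T W"
      by (rule theta1_inversion) (use im2 in \<open>simp add: T_def\<close>)
    thus ?thesis unfolding e1 e2 e4 e3 T_def[symmetric] e5[symmetric] exp_add by (simp add: mult_ac)
  qed
  have "theta_level N c (- 1 / \<tau>) (w / \<tau>) = (\<Sum>a<N. c (int a) * (csqrt (- \<i> * \<tau>) / s * exp (pi_i * w\<^sup>2 / \<tau>) * theta (e a) (\<tau> / of_nat N) (w / s)))"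
    unfolding theta_level_def theta_residue_classes[OF c im1] s_def[symmetric] term_a[symmetric] by (simp add: mult_ac)
  also have "\<dots> = csqrt (- \<i> * \<tau>) / s * exp (pi_i * w\<^sup>2 / \<tau>) * (\<Sum>a<N. theta (\<lambda>k. c (int a) * e a k) (\<tau> / of_nat N) (w / s))"
    unfolding theta_cmult sum_distrib_left by (simp add: mult_ac)
  also have "(\<Sum>a<N. theta (\<lambda>k. c (int a) * e a k) (\<tau> / of_nat N) (w / s)) = theta (\<lambda>k. \<Sum>a<N. c (int a) * e a k) (\<tau> / of_nat N) (w / s)"
    by (rule theta_sum[symmetric, where C = "\<lambda>a. norm (c (int a))"]) (use im2 ne in \<open>auto simp: norm_mult\<close>)
  finally show ?thesis unfolding theta_level_def dft_def e_def s_def .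
qed

lemma theta_level_lattice:
  fixes x y :: int
  assumes c: "periodic N c" and \<tau>: "Im \<tau> > 0"
  shows "theta_level N c \<tau> (w + of_real (sqrt N) * (of_int x * \<tau> + of_int y)) =
     exp (- of_real pi * \<i> * ((of_real (sqrt N) * of_int x)\<^sup>2 * \<tau> + 2 * of_real (sqrt N) * of_int x * w)) * theta_level N c \<tau> w"
proof -
  have N: "N > 0" using c by (simp add: periodic_def)
  define s :: complex where "s = of_real (sqrt N)"
  have s2: "s * s = of_nat N"
    unfolding s_def by (metis of_real_mult of_real_of_nat_eq real_sqrt_mult_self abs_of_nat)
  have s0: "s \<noteq> 0" using N by (simp add: s_def)
  define E where "E = exp (- of_real pi * \<i> * ((s * of_int x)\<^sup>2 * \<tau> + 2 * s * of_int x * w))"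
  have im: "Im (\<tau> / of_nat N) > 0" using \<tau> N by (simp add: Im_divide_nat)
  have ts: "(theta_term c (\<tau> / of_nat N) (w / s) has_sum theta c (\<tau> / of_nat N) (w / s)) UNIV"
    by (rule theta_has_sum[OF periodic_bounded[OF c] im])
  have tt: "theta_term c (\<tau> / of_nat N) ((w + s * (of_int x * \<tau> + of_int y)) / s) m =
      E * theta_term c (\<tau> / of_nat N) (w / s) (m + int N * x)" for m
  proof -
    have "exp (pi_i * (of_int m)\<^sup>2 * (\<tau> / of_nat N) + two_pi_i * of_int m * ((w + s * (of_int x * \<tau> + of_int y)) / s)) =
      exp (2 * of_int (m * y) * of_real pi * \<i>) * (E * exp (pi_i * (of_int (m + int N * x))\<^sup>2 * (\<tau> / of_nat N) + two_pi_i * of_int (m + int N * x) * (w / s)))"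
      unfolding E_def mult_exp_exp
      using s0 by (intro arg_cong[where f = exp]) (simp add: s2[symmetric] field_simps power2_eq_square)
    also have "exp (2 * of_int (m * y) * of_real pi * \<i>) = (1::complex)"
      unfolding exp_eq_1 by (auto intro!: exI[of _ "m * y"])
    finally show ?thesis unfolding theta_term_def periodic_mult[OF c] by simp
  qed
  have "((\<lambda>m. theta_term c (\<tau> / of_nat N) (w / s) (m + int N * x)) has_sum theta c (\<tau> / of_nat N) (w / s)) UNIV"
    using has_sum_reindex_bij_betw[of "\<lambda>m. m + int N * x" UNIV UNIV "theta_term c (\<tau> / of_nat N) (w / s)"] ts bij_plus_right[of "int N * x"] by blast
  hence "((\<lambda>m. E * theta_term c (\<tau> / of_nat N) (w / s) (m + int N * x)) has_sum E * theta c (\<tau> / of_nat N) (w / s)) UNIV"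
    by (rule has_sum_cmult_right)
  hence "theta c (\<tau> / of_nat N) ((w + s * (of_int x * \<tau> + of_int y)) / s) = E * theta c (\<tau> / of_nat N) (w / s)"
    unfolding tt[symmetric] theta_def by (rule infsumI)
  thus ?thesis unfolding theta_level_def E_def s_def .
qed

section \<open>The pentagonal number theorem and the eta function\<close>

text \<open>
The triangular numbers.
\<close>

fun tri :: "nat \<Rightarrow> nat" where
  "tri 0 = 0"
| "tri (Suc n) = tri n + Suc n"

lemma of_nat_tri: "2 * of_nat (tri n) = of_nat n * (of_nat n + 1 :: 'a::comm_semiring_1)"
proof -
  have "2 * tri n = n * (n + 1)" by (induction n) auto
  hence "of_nat (2 * tri n) = (of_nat (n * (n + 1)) :: 'a)" by simp
  thus ?thesis by (simp add: algebra_simps)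
qed

lemma exp_two_pi_int: "exp (2 * of_int n * of_real pi * \<i>) = 1"
  unfolding exp_eq_1 by (intro conjI exI[of _ n]) simp_all

text \<open>
Shanks' finite form of the pentagonal number theorem. As \<open>n\<close> grows, only the term \<open>s = 0\<close> on the left
survives, and it tends to Euler's product. The exponents on the right are \<open>j (3 j + 1) / 2\<close> and
\<open>j (3 j - 1) / 2\<close>.
\<close>

lemma shanks_identity:
  fixes q :: "'a::comm_ring_1"
  defines "P \<equiv> \<lambda>s n. \<Prod>m\<in>{s<..n}. 1 - q ^ m"
  shows "(\<Sum>s\<le>n. (-1) ^ s * P s n * q ^ (s * n + tri s)) =
         1 + (\<Sum>j=1..n. (-1) ^ j * (q ^ (j * j + tri j) + q ^ (j * j + tri (j - 1))))"
proof (induction n)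
  case 0
  show ?case by (simp add: P_def)
next
  case (Suc n)
  define a where "a n s = (-1) ^ s * P s n * q ^ (s * n + tri s)" for n s
  have PS: "P s (Suc n) = P s n * (1 - q ^ Suc n)" if "s \<le> n" for s
  proof -
    have "{s<..Suc n} = insert (Suc n) {s<..n}" using that by auto
    thus ?thesis unfolding P_def by (simp add: mult.commute)
  qed
  have Pl: "P s n = (1 - q ^ Suc s) * P (Suc s) n" if "s < n" for s
  proof -
    have "{s<..n} = insert (Suc s) {Suc s<..n}" using that by auto
    thus ?thesis unfolding P_def by simp
  qed
  have part: "(\<Sum>s\<le>t. a (Suc n) s - a n s) = (-1) ^ Suc t * P t n * q ^ (tri t + t * Suc n + Suc n)" if "t \<le> n" for t
    using that
  proof (induction t)
    case 0
    show ?case by (simp add: a_def PS algebra_simps)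
  next
    case (Suc t)
    hence t: "t < n" by simp
    have "(\<Sum>s\<le>Suc t. a (Suc n) s - a n s) = (-1) ^ Suc t * P t n * q ^ (tri t + t * Suc n + Suc n) + (a (Suc n) (Suc t) - a n (Suc t))"
      using Suc by simp
    also have "\<dots> = (-1) ^ Suc t * P (Suc t) n * q ^ (tri (Suc t) + Suc t * n) * ((1 - q ^ Suc t) + (1 - q ^ Suc n) * q ^ Suc t - 1)"
      unfolding a_def PS[OF Suc.prems] Pl[OF t]
      by (simp add: algebra_simps power_add)
    also have "\<dots> = (-1) ^ Suc (Suc t) * P (Suc t) n * q ^ (tri (Suc t) + Suc t * Suc n + Suc n)"
      by (simp add: algebra_simps power_add)
    finally show ?case .
  qed
  have "(\<Sum>s\<le>Suc n. a (Suc n) s) = (\<Sum>s\<le>n. a n s) + (\<Sum>s\<le>n. a (Suc n) s - a n s) + a (Suc n) (Suc n)"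
    by (simp add: sum_subtractf)
  also have "\<dots> = (\<Sum>s\<le>n. a n s) + (-1) ^ Suc n * (q ^ (tri n + n * Suc n + Suc n) + q ^ (Suc n * Suc n + tri (Suc n)))"
    unfolding part[OF order.refl] by (simp add: a_def P_def algebra_simps)
  also have "tri n + n * Suc n + Suc n = Suc n * Suc n + tri (Suc n - 1)" by simp
  finally show ?case using Suc.IH unfolding a_def by (simp add: algebra_simps)
qed

lemma pentagonal_number_limit:
  fixes q :: complex
  assumes q: "norm q < 1"
  shows "(\<lambda>n. 1 + (\<Sum>j=1..n. (-1) ^ j * (q ^ (j * j + tri j) + q ^ (j * j + tri (j - 1))))) \<longlonglongrightarrow> (\<Prod>m. 1 - q ^ Suc m)"
proof -
  define P where "P s n = (\<Prod>m\<in>{s<..n}. 1 - q ^ m)" for s n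
  define r where "r = norm q"
  have r: "0 \<le> r" "r < 1" using q by (auto simp: r_def)
  define C where "C = exp (1 / (1 - r))"
  have Pb: "norm (P s n) \<le> C" for s n
  proof -
    have "norm (P s n) \<le> (\<Prod>m\<in>{s<..n}. exp (r ^ m))"
      unfolding P_def prod_norm[symmetric]
    proof (rule prod_mono, safe)
      fix m
      have "norm (1 - q ^ m) \<le> 1 + r ^ m"
        using norm_triangle_ineq4[of 1 "q ^ m"] by (simp add: norm_power r_def)
      also have "\<dots> \<le> exp (r ^ m)" by (rule exp_ge_add_one_self)
      finally show "norm (1 - q ^ m) \<le> exp (r ^ m)" .
    qed simp
    also have "\<dots> = exp (\<Sum>m\<in>{s<..n}. r ^ m)" by (simp add: exp_sum)
    also have "(\<Sum>m\<in>{s<..n}. r ^ m) \<le> (\<Sum>m. r ^ m)"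
      by (rule sum_le_suminf) (use r in \<open>auto intro: summable_geometric\<close>)
    also have "(\<Sum>m. r ^ m) = 1 / (1 - r)" using r by (intro suminf_geometric) auto
    finally show ?thesis by (simp add: C_def)
  qed
  have prodlim: "(\<lambda>n. P 0 n) \<longlonglongrightarrow> (\<Prod>m. 1 - q ^ Suc m)"
  proof -
    have "summable (\<lambda>m. norm ((1 - q ^ Suc m) - 1))"
    proof -
      have "summable (\<lambda>m. r * r ^ m)" using r by (intro summable_mult summable_geometric) auto
      thus ?thesis by (simp add: norm_mult norm_power r_def)
    qed
    hence "convergent_prod (\<lambda>m. 1 - q ^ Suc m)"
      by (intro abs_convergent_prod_imp_convergent_prod) (simp add: abs_convergent_prod_conv_summable)
    hence "(\<lambda>n. \<Prod>m\<le>n. 1 - q ^ Suc m) \<longlonglongrightarrow> (\<Prod>m. 1 - q ^ Suc m)"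
      by (rule convergent_prod_LIMSEQ)
    moreover have "(\<Prod>m\<le>n. 1 - q ^ Suc m) = P 0 (Suc n)" for n
    proof -
      have "{0<..Suc n} = Suc ` {..n}" by (auto simp: image_iff) (metis Suc_le_mono gr0_implies_Suc atMost_iff)
      thus ?thesis unfolding P_def by (simp add: prod.reindex)
    qed
    ultimately have "(\<lambda>n. P 0 (Suc n)) \<longlonglongrightarrow> (\<Prod>m. 1 - q ^ Suc m)" by simp
    thus ?thesis by (rule LIMSEQ_imp_Suc)
  qed
  have restlim: "(\<lambda>n. \<Sum>s=1..n. (-1) ^ s * P s n * q ^ (s * n + tri s)) \<longlonglongrightarrow> 0"
  proof (rule Lim_null_comparison)
    show "\<forall>\<^sub>F n in sequentially. norm (\<Sum>s=1..n. (-1) ^ s * P s n * q ^ (s * n + tri s)) \<le> C * (of_nat n * r ^ n)"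
    proof (rule always_eventually, safe)
      fix n
      have "norm (\<Sum>s=1..n. (-1) ^ s * P s n * q ^ (s * n + tri s)) \<le> (\<Sum>s=1..n. C * r ^ n)"
      proof (rule sum_norm_le)
        fix s assume s: "s \<in> {1..n}"
        have "n \<le> s * n + tri s" using s by (cases s) auto
        hence "r ^ (s * n + tri s) \<le> r ^ n" using r by (intro power_decreasing) auto
        hence "norm (P s n) * r ^ (s * n + tri s) \<le> C * r ^ n"
          using Pb[of s n] r by (intro mult_mono) (auto simp: C_def)
        thus "norm ((-1) ^ s * P s n * q ^ (s * n + tri s)) \<le> C * r ^ n"
          by (simp add: norm_mult norm_power r_def)
      qed
      thus "norm (\<Sum>s=1..n. (-1) ^ s * P s n * q ^ (s * n + tri s)) \<le> C * (of_nat n * r ^ n)"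
        by (simp add: mult_ac)
    qed
    have "(\<lambda>n. of_nat n * r ^ n) \<longlonglongrightarrow> 0" using r by (intro powser_times_n_limit_0) auto
    thus "(\<lambda>n. C * (of_nat n * r ^ n)) \<longlonglongrightarrow> 0" by (rule tendsto_mult_right_zero)
  qed
  have "(\<lambda>n. P 0 n + (\<Sum>s=1..n. (-1) ^ s * P s n * q ^ (s * n + tri s))) \<longlonglongrightarrow> (\<Prod>m. 1 - q ^ Suc m) + 0"
    by (intro tendsto_add prodlim restlim)
  moreover have "P 0 n + (\<Sum>s=1..n. (-1) ^ s * P s n * q ^ (s * n + tri s)) =
      1 + (\<Sum>j=1..n. (-1) ^ j * (q ^ (j * j + tri j) + q ^ (j * j + tri (j - 1))))" for n
  proof -
    have "{..n} = insert 0 {1..n}" by auto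
    hence "(\<Sum>s\<le>n. (-1) ^ s * P s n * q ^ (s * n + tri s)) = P 0 n + (\<Sum>s=1..n. (-1) ^ s * P s n * q ^ (s * n + tri s))"
      by simp
    thus ?thesis using shanks_identity[where q = q and n = n] unfolding P_def by simp
  qed
  ultimately show ?thesis by simp
qed

text \<open>
The quadratic character \<open>(12/m)\<close>.
\<close>

definition chi12 :: "int \<Rightarrow> complex" where
  "chi12 m = (if m mod 12 \<in> {1, 11} then 1 else if m mod 12 \<in> {5, 7} then -1 else 0)"

lemma periodic_chi12: "periodic 12 chi12"
  by (simp add: periodic_def chi12_def)

lemma chi12_minus: "chi12 (- m) = chi12 m"
proof -
  have "(- m) mod 12 = (if m mod 12 = 0 then 0 else 12 - m mod 12)"
    by (simp add: zmod_zminus1_eq_if)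
  thus ?thesis unfolding chi12_def by auto
qed

text \<open>
The indices with nonzero coefficient are \<open>6 k + 1\<close> and \<open>- (6 k + 1)\<close>. The two classes contribute equally, and
each of them is the pentagonal number series; this explains the factor 2.
\<close>

lemma dedekind_eta_theta:
  assumes \<tau>: "Im \<tau> > 0"
  shows "theta_level 12 chi12 \<tau> 0 = 2 * dedekind_eta \<tau>"
proof -
  define q where "q = exp (two_pi_i * \<tau>)"
  define t where "t = exp (two_pi_i * \<tau> / 24)"
  have q: "norm q < 1" using \<tau> by (simp add: q_def)
  have eta: "dedekind_eta \<tau> = t * (\<Prod>m. 1 - q ^ Suc m)"
  proof -
    have "exp (two_pi_i * of_nat (Suc m) * \<tau>) = q ^ Suc m" for m
      unfolding q_def exp_of_nat_mult[symmetric] by (simp only: mult_ac)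
    thus ?thesis by (simp add: dedekind_eta_def t_def)
  qed
  define f where "f = theta_term chi12 (\<tau> / of_nat 12) (0 / of_real (sqrt (real 12)))"
  have im: "Im (\<tau> / of_nat 12) > 0" using \<tau> by (simp add: Im_divide_nat)
  have hs: "(f has_sum theta_level 12 chi12 \<tau> 0) UNIV"
    unfolding f_def theta_level_def by (rule theta_has_sum[OF periodic_bounded[OF periodic_chi12] im])
  define h where "h k = 6 * k + 1" for k :: int
  have chih: "chi12 (h k) = (if even k then 1 else -1)" for k
  proof -
    have "h k mod 12 = (if even k then 1 else 7)" unfolding h_def by presburger
    thus ?thesis by (simp add: chi12_def)
  qed
  have fe: "f m = chi12 m * exp (two_pi_i * \<tau> * (of_int m)\<^sup>2 / 24)" for m
    unfolding f_def theta_term_def by (simp add: field_simps)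
  have feven: "f (- m) = f m" for m by (simp add: fe chi12_minus)
  have "f summable_on range h" using hs summable_on_subset_banach has_sum_imp_summable by blast
  then obtain S where S: "(f has_sum S) (range h)" by (auto simp: summable_on_def)
  have injh: "inj h" by (auto simp: inj_def h_def)
  have S1: "((\<lambda>k. f (h k)) has_sum S) UNIV" using S has_sum_reindex[OF injh, of f] by (simp add: o_def)
  have S2: "(f has_sum S) (range (\<lambda>k. - h k))"
  proof -
    have "inj (\<lambda>k. - h k)" by (auto simp: inj_def h_def)
    from has_sum_reindex[OF this, of f] S1 show ?thesis by (simp add: o_def feven)
  qed
  have rh: "m \<in> range h \<longleftrightarrow> m mod 6 = 1" for m
  proof
    assume "m mod 6 = 1"
    hence "m = h (m div 6)" unfolding h_def by presburger
    thus "m \<in> range h" by blast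
  qed (auto simp: h_def)
  have rh': "m \<in> range (\<lambda>k. - h k) \<longleftrightarrow> m mod 6 = 5" for m
  proof
    assume "m mod 6 = 5"
    hence "m = - h (- (m div 6) - 1)" unfolding h_def by presburger
    thus "m \<in> range (\<lambda>k. - h k)" by blast
  next
    assume "m \<in> range (\<lambda>k. - h k)"
    then obtain k where "m = - (6 * k + 1)" by (auto simp: h_def)
    thus "m mod 6 = 5" by presburger
  qed
  have "(f has_sum (S + S)) (range h \<union> range (\<lambda>k. - h k))"
    by (rule has_sum_Un_disjoint[OF S S2]) (simp add: disjoint_iff rh rh')
  hence "(f has_sum (S + S)) UNIV"
  proof (rule has_sum_cong_neutral[THEN iffD1, rotated -1])
    fix m assume "m \<in> UNIV - (range h \<union> range (\<lambda>k. - h k))"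
    hence "m mod 6 \<noteq> 1" "m mod 6 \<noteq> 5" using rh[of m] rh'[of m] by auto
    moreover have "m mod 6 = m mod 12 mod 6" by (simp add: mod_mod_cancel)
    ultimately have "m mod 12 \<notin> {1, 11, 5, 7}" by auto
    thus "f m = 0" by (simp add: fe chi12_def)
  qed auto
  hence two: "theta_level 12 chi12 \<tau> 0 = 2 * S" using hs infsumI by (metis mult_2)
  have part: "(\<Sum>k\<in>{-int n..int n}. f (h k)) = t * (1 + (\<Sum>j=1..n. (-1) ^ j * (q ^ (j * j + tri j) + q ^ (j * j + tri (j - 1)))))" for n
  proof (induction n)
    case 0
    show ?case by (simp add: fe h_def t_def chi12_def)
  next
    case (Suc n)
    have r: "(if even (int (Suc n)) then 1 else -1) = ((-1) ^ Suc n :: complex)" by simp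
    have "{-int (Suc n)..int (Suc n)} = insert (-int (Suc n)) (insert (int (Suc n)) {-int n..int n})"
      by auto
    hence "(\<Sum>k\<in>{-int (Suc n)..int (Suc n)}. f (h k)) = f (h (int (Suc n))) + f (h (- int (Suc n))) + (\<Sum>k\<in>{-int n..int n}. f (h k))"
      by (simp add: algebra_simps)
    moreover have "f (h (int (Suc n))) = t * ((-1) ^ Suc n * q ^ (Suc n * Suc n + tri (Suc n)))"
    proof -
      have "exp (two_pi_i * \<tau> * (of_int (h (int (Suc n))))\<^sup>2 / 24) = t * q ^ (Suc n * Suc n + tri (Suc n))"
        unfolding t_def q_def exp_of_nat_mult[symmetric] mult_exp_exp
        using of_nat_tri[of "Suc n", where 'a = complex]
        by (intro arg_cong[where f = exp]) (simp add: h_def field_simps power2_eq_square)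
      thus ?thesis unfolding fe chih r by simp
    qed
    moreover have "f (h (- int (Suc n))) = t * ((-1) ^ Suc n * q ^ (Suc n * Suc n + tri n))"
    proof -
      have "exp (two_pi_i * \<tau> * (of_int (h (- int (Suc n))))\<^sup>2 / 24) = t * q ^ (Suc n * Suc n + tri n)"
        unfolding t_def q_def exp_of_nat_mult[symmetric] mult_exp_exp
        using of_nat_tri[of "n", where 'a = complex]
        by (intro arg_cong[where f = exp]) (simp add: h_def field_simps power2_eq_square)
      moreover have "(if even (- int (Suc n)) then 1 else -1) = ((-1) ^ Suc n :: complex)" by simp
      ultimately show ?thesis unfolding fe chih by simp
    qed
    ultimately show ?case using Suc by (simp add: algebra_simps)
  qed
  have "(\<lambda>n. t * (1 + (\<Sum>j=1..n. (-1) ^ j * (q ^ (j * j + tri j) + q ^ (j * j + tri (j - 1)))))) \<longlonglongrightarrow> S"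
    using has_sum_int_symmetric[OF S1] unfolding part .
  moreover have "(\<lambda>n. t * (1 + (\<Sum>j=1..n. (-1) ^ j * (q ^ (j * j + tri j) + q ^ (j * j + tri (j - 1)))))) \<longlonglongrightarrow> dedekind_eta \<tau>"
    unfolding eta by (intro tendsto_mult_left pentagonal_number_limit q)
  ultimately show ?thesis using two LIMSEQ_unique by blast
qed

lemma dedekind_eta_nonzero:
  assumes \<tau>: "Im \<tau> > 0"
  shows "dedekind_eta \<tau> \<noteq> 0"
proof -
  define q where "q = exp (two_pi_i * \<tau>)"
  have q: "norm q < 1" using \<tau> by (simp add: q_def)
  have e: "exp (two_pi_i * of_nat (Suc m) * \<tau>) = q ^ Suc m" for m
    unfolding q_def exp_of_nat_mult[symmetric] by (simp only: mult_ac)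
  have "summable (\<lambda>m. norm ((1 - q ^ Suc m) - 1))"
  proof -
    have "summable (\<lambda>m. norm q * norm q ^ m)" using q by (intro summable_mult summable_geometric) auto
    thus ?thesis by (simp add: norm_mult norm_power)
  qed
  hence "convergent_prod (\<lambda>m. 1 - q ^ Suc m)"
    by (intro abs_convergent_prod_imp_convergent_prod) (simp add: abs_convergent_prod_conv_summable)
  moreover have "1 - q ^ Suc m \<noteq> 0" for m
  proof
    assume "1 - q ^ Suc m = 0"
    hence "norm (q ^ Suc m) = 1" by (metis eq_iff_diff_eq_0 norm_one)
    moreover have "norm (q ^ Suc m) < 1"
      unfolding norm_power using q by (intro le_less_trans[OF power_Suc_le_self]) auto
    ultimately show False by simp
  qed
  ultimately have "(\<Prod>m. 1 - q ^ Suc m) \<noteq> 0" by (rule prodinf_nonzero)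
  thus ?thesis by (simp add: dedekind_eta_def e del: power_Suc of_nat_Suc)
qed

lemma dedekind_eta_translation: "dedekind_eta (\<tau> + 1) = exp (two_pi_i / 24) * dedekind_eta \<tau>"
proof -
  have "exp (two_pi_i * of_nat (Suc m) * (\<tau> + 1)) = exp (two_pi_i * of_nat (Suc m) * \<tau>)" for m
  proof -
    have "exp (two_pi_i * of_nat (Suc m) * (\<tau> + 1)) = exp (two_pi_i * of_nat (Suc m) * \<tau>) * exp (2 * of_int (int (Suc m)) * of_real pi * \<i>)"
      unfolding mult_exp_exp by (rule arg_cong[where f = exp]) (simp add: algebra_simps)
    also have "exp (2 * of_int (int (Suc m)) * of_real pi * \<i>) = (1::complex)"
      by (rule exp_two_pi_int)
    finally show ?thesis by simp
  qed
  moreover have "exp (two_pi_i * (\<tau> + 1) / 24) = exp (two_pi_i / 24) * exp (two_pi_i * \<tau> / 24)"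
    unfolding mult_exp_exp by (rule arg_cong[where f = exp]) (simp add: field_simps)
  ultimately show ?thesis unfolding dedekind_eta_def by (simp only: mult_ac)
qed

subsection \<open>Finite Fourier transforms of some characters\<close>

text \<open>
A primitive 12th root of unity. All moduli below divide 12, so a table of its powers evaluates their finite
Fourier transforms.
\<close>

definition zeta12 :: complex where "zeta12 = Complex (sqrt 3 / 2) (- 1 / 2)"

lemma zeta12_exp: "zeta12 = exp (- 2 * of_real pi * \<i> / 12)"
proof -
  have "exp (- 2 * of_real pi * \<i> / 12) = cis (- (pi / 6))"
    by (simp add: cis_conv_exp)
  thus ?thesis by (simp add: zeta12_def complex_eq_iff cos_30 sin_30)
qed

lemma zeta12_powers:
  "zeta12 ^ 2 = Complex (1/2) (- sqrt 3 / 2)" "zeta12 ^ 3 = - \<i>" "zeta12 ^ 4 = Complex (-1/2) (- sqrt 3 / 2)"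
  "zeta12 ^ 5 = Complex (- sqrt 3 / 2) (-1/2)" "zeta12 ^ 6 = - 1" "zeta12 ^ 12 = 1"
proof -
  show 2: "zeta12 ^ 2 = Complex (1/2) (- sqrt 3 / 2)"
    by (simp add: zeta12_def power2_eq_square complex_eq_iff field_simps)
  have "zeta12 ^ 3 = zeta12 ^ 2 * zeta12" by (simp add: power3_eq_cube power2_eq_square)
  thus 3: "zeta12 ^ 3 = - \<i>" unfolding 2 by (simp add: zeta12_def complex_eq_iff field_simps)
  have "zeta12 ^ 4 = zeta12 ^ 3 * zeta12" by (simp add: eval_nat_numeral)
  thus "zeta12 ^ 4 = Complex (-1/2) (- sqrt 3 / 2)" unfolding 3 by (simp add: zeta12_def complex_eq_iff)
  have "zeta12 ^ 5 = zeta12 ^ 3 * zeta12 ^ 2" by (simp add: eval_nat_numeral)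
  thus "zeta12 ^ 5 = Complex (- sqrt 3 / 2) (-1/2)" unfolding 3 2 by (simp add: complex_eq_iff)
  have "zeta12 ^ 6 = zeta12 ^ 3 * zeta12 ^ 3" by (simp add: eval_nat_numeral)
  thus 6: "zeta12 ^ 6 = - 1" unfolding 3 by simp
  have "zeta12 ^ 12 = zeta12 ^ 6 * zeta12 ^ 6" by (simp add: eval_nat_numeral)
  thus "zeta12 ^ 12 = 1" unfolding 6 by simp
qed

lemma zeta12_mod: "zeta12 ^ n = zeta12 ^ (n mod 12)"
proof -
  have "zeta12 ^ n = zeta12 ^ (12 * (n div 12) + n mod 12)" by simp
  also have "\<dots> = (zeta12 ^ 12) ^ (n div 12) * zeta12 ^ (n mod 12)" by (simp only: power_add power_mult)
  finally show ?thesis by (simp add: zeta12_powers)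
qed

lemma zeta12_reduce: "n < 6 \<Longrightarrow> zeta12 ^ (n + 6) = - (zeta12 ^ n)"
  by (simp add: power_add zeta12_powers)

lemmas zeta12_table = zeta12_powers
  zeta12_reduce[of 1, simplified] zeta12_reduce[of 2, simplified] zeta12_reduce[of 3, simplified]
  zeta12_reduce[of 4, simplified] zeta12_reduce[of 5, simplified]

lemma zeta12_kernel:
  assumes "N * M = 12"
  shows "exp (- 2 * of_real pi * \<i> * of_nat a * of_int k / of_nat N) = zeta12 ^ ((M * a * nat (k mod int N)) mod 12)"
proof -
  have N: "N > 0" using assms by (cases N) auto
  define r where "r = nat (k mod int N)"
  have k: "k = int N * (k div int N) + int r" using N by (simp add: r_def)
  have M: "of_nat M = (12 / of_nat N :: complex)" using assms N
    by (metis nonzero_mult_div_cancel_left of_nat_eq_0_iff of_nat_mult of_nat_numeral less_numeral_extra(3))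
  have "exp (- 2 * of_real pi * \<i> * of_nat a * of_int k / of_nat N) =
     exp (2 * of_int (- int a * (k div int N)) * of_real pi * \<i>) * exp (of_nat (M * a * r) * (- 2 * of_real pi * \<i> / 12))"
    unfolding mult_exp_exp using N
    by (intro arg_cong[where f = exp], subst k) (simp add: M field_simps)
  also have "exp (2 * of_int (- int a * (k div int N)) * of_real pi * \<i>) = (1::complex)"
    by (rule exp_two_pi_int)
  also have "exp (of_nat (M * a * r) * (- 2 * of_real pi * \<i> / 12)) = zeta12 ^ (M * a * r)"
    unfolding zeta12_exp exp_of_nat_mult ..
  finally show ?thesis unfolding r_def[symmetric] zeta12_mod[symmetric] by simp
qed

lemma dft_zeta12:
  assumes "N * M = 12"
  shows "dft N c k = (\<Sum>a<N. c (int a) * zeta12 ^ ((M * a * nat (k mod int N)) mod 12))"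
  unfolding dft_def zeta12_kernel[OF assms] ..

lemma int_mod_less_cases:
  fixes k :: int
  assumes "\<And>r. r < N \<Longrightarrow> k mod int N = int r \<Longrightarrow> P" "N > 0"
  shows P
proof -
  have "0 \<le> k mod int N" "k mod int N < int N" using assms(2) by auto
  then obtain a where "k mod int N = int a" "a < N"
    by (metis nonneg_int_cases of_nat_less_iff)
  thus P using assms(1) by blast
qed

text \<open>
The odd quadratic character \<open>(-4/m)\<close>.
\<close>

definition chi4 :: "int \<Rightarrow> complex" where
  "chi4 m = (if m mod 4 = 1 then 1 else if m mod 4 = 3 then -1 else 0)"

text \<open>
The indicator function of the residue class of \<open>j\<close> modulo 2, for \<open>j < 2\<close>.
\<close>

definition parity_ind :: "nat \<Rightarrow> int \<Rightarrow> complex" where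
  "parity_ind j m = (if m mod 2 = int j then 1 else 0)"

text \<open>
The odd quadratic character modulo 3, restricted to the residue class of \<open>j\<close> modulo 2.
\<close>

definition chi3_parity :: "nat \<Rightarrow> int \<Rightarrow> complex" where
  "chi3_parity j m = (if m mod 2 = int j then if m mod 3 = 1 then 1 else if m mod 3 = 2 then -1 else 0 else 0)"

lemma dft_chi4: "dft 4 chi4 k = - 2 * \<i> * chi4 k"
proof (rule int_mod_less_cases[of 4 k])
  fix r assume r: "r < 4" "k mod int 4 = int r"
  hence "r \<in> {0, 1, 2, 3}" by auto
  thus ?thesis using r
    by (subst dft_zeta12[of 4 3]) (auto simp: lessThan_nat_numeral lessThan_Suc chi4_def zeta12_table)
qed simp

lemma dft_chi12: "dft 12 chi12 k = of_real (sqrt 12) * chi12 k"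
proof (rule int_mod_less_cases[of 12 k])
  have s12: "sqrt 12 = 2 * sqrt 3" using real_sqrt_mult[of 4 3] by simp
  fix r assume r: "r < 12" "k mod int 12 = int r"
  hence "r \<in> {0, 1, 2, 3, 4, 5, 6, 7, 8, 9, 10, 11}" by (auto simp: less_Suc_eq eval_nat_numeral)
  thus ?thesis using r
    by (subst dft_zeta12[of 12 1], simp, elim insertE emptyE)
      (simp_all add: lessThan_nat_numeral lessThan_Suc chi12_def zeta12_table,
       simp_all add: zeta12_def s12 complex_eq_iff)
qed simp

lemma dft_parity_ind:
  "dft 2 (parity_ind 0) k = parity_ind 0 k + parity_ind 1 k"
  "dft 2 (parity_ind 1) k = parity_ind 0 k - parity_ind 1 k"
proof -
  have "k mod 2 = 0 \<or> k mod 2 = 1" by presburger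
  thus "dft 2 (parity_ind 0) k = parity_ind 0 k + parity_ind 1 k"
    "dft 2 (parity_ind 1) k = parity_ind 0 k - parity_ind 1 k"
    by (auto simp: dft_zeta12[of 2 6] lessThan_nat_numeral lessThan_Suc parity_ind_def zeta12_table)
qed

lemma dft_chi3_parity:
  "dft 6 (chi3_parity 0) k = \<i> * of_real (sqrt 3) * (chi3_parity 0 k + chi3_parity 1 k)"
  "dft 6 (chi3_parity 1) k = \<i> * of_real (sqrt 3) * (chi3_parity 0 k - chi3_parity 1 k)"
proof -
  have "dft 6 (chi3_parity 0) k = \<i> * of_real (sqrt 3) * (chi3_parity 0 k + chi3_parity 1 k) \<and>
    dft 6 (chi3_parity 1) k = \<i> * of_real (sqrt 3) * (chi3_parity 0 k - chi3_parity 1 k)"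
  proof (rule int_mod_less_cases[of 6 k])
    fix r assume r: "r < 6" "k mod int 6 = int r"
    have k2: "k mod 2 = int r mod 2" and k3: "k mod 3 = int r mod 3"
      using r(2) mod_mod_cancel[of 2 6 k] mod_mod_cancel[of 3 6 k] by auto
    have "r \<in> {0, 1, 2, 3, 4, 5}" using r by auto
    thus ?thesis using r
      by (elim insertE emptyE; simp add: dft_zeta12[of 6 2] lessThan_nat_numeral lessThan_Suc chi3_parity_def k2 k3 zeta12_table;
          simp add: complex_eq_iff)
  qed simp
  thus "dft 6 (chi3_parity 0) k = \<i> * of_real (sqrt 3) * (chi3_parity 0 k + chi3_parity 1 k)"
    "dft 6 (chi3_parity 1) k = \<i> * of_real (sqrt 3) * (chi3_parity 0 k - chi3_parity 1 k)" by auto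
qed

lemma dedekind_eta_inversion:
  assumes \<tau>: "Im \<tau> > 0"
  shows "dedekind_eta (- 1 / \<tau>) = csqrt (- \<i> * \<tau>) * dedekind_eta \<tau>"
proof -
  have im: "Im (- 1 / \<tau>) > 0"
    using \<tau> by (simp add: Im_divide power2_eq_square) (auto intro!: divide_pos_pos add_nonneg_pos)
  have "dft 12 chi12 = (\<lambda>k. of_real (sqrt 12) * chi12 k)" using dft_chi12 by auto
  hence "theta_level 12 (dft 12 chi12) \<tau> 0 = of_real (sqrt 12) * theta_level 12 chi12 \<tau> 0"
    by (simp add: theta_level_def theta_cmult)
  hence "theta_level 12 chi12 (- 1 / \<tau>) 0 = csqrt (- \<i> * \<tau>) * theta_level 12 chi12 \<tau> 0"
    using theta_level_inversion[OF periodic_chi12 \<tau>, of 0] by simp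
  thus ?thesis using dedekind_eta_theta[OF im] dedekind_eta_theta[OF \<tau>] by simp
qed

lemma dedekind_eta_holomorphic: "dedekind_eta holomorphic_on {\<tau>. Im \<tau> > 0}"
proof -
  have "(\<lambda>\<tau>. theta chi12 (\<tau> / of_nat 12) (0 / of_real (sqrt (real 12))) / 2) holomorphic_on {\<tau>. Im \<tau> > 0}"
    by (intro holomorphic_intros theta_holomorphic_compose[OF periodic_bounded[OF periodic_chi12]]) (auto simp: Im_divide_nat)
  thus ?thesis
    by (rule holomorphic_transform) (use dedekind_eta_theta in \<open>auto simp: theta_level_def\<close>)
qed

section \<open>The modular group and the eta multiplier\<close>

text \<open>
The matrices with rows \<open>(1, 1), (0, 1)\<close> and \<open>(0, -1), (1, 0)\<close> generate \<open>SL(2,\<int>)\<close>, stated as an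
induction rule for left multiplication by the generators.
\<close>

lemma sl2_induct:
  fixes P :: "int \<Rightarrow> int \<Rightarrow> int \<Rightarrow> int \<Rightarrow> bool"
  assumes det: "a * e - b * c = 1"
    and one: "P 1 0 0 1"
    and T: "\<And>a b c e. a * e - b * c = 1 \<Longrightarrow> P a b c e \<Longrightarrow> P (a + c) (b + e) c e"
    and Ti: "\<And>a b c e. a * e - b * c = 1 \<Longrightarrow> P a b c e \<Longrightarrow> P (a - c) (b - e) c e"
    and S: "\<And>a b c e. a * e - b * c = 1 \<Longrightarrow> P a b c e \<Longrightarrow> P (- c) (- e) a b"
  shows "P a b c e"
proof -
  have TK: "P (a + k * c) (b + k * e) c e" if "a * e - b * c = 1" "P a b c e" for a b c e k
  proof (induction k rule: int_induct[where k = 0])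
    case base
    show ?case using that by simp
  next
    case (step1 i)
    have "(a + i * c) * e - (b + i * e) * c = 1" using that(1) by (simp add: algebra_simps)
    from T[OF this step1(2)] show ?case by (simp add: algebra_simps)
  next
    case (step2 i)
    have "(a + i * c) * e - (b + i * e) * c = 1" using that(1) by (simp add: algebra_simps)
    from Ti[OF this step2(2)] show ?case by (simp add: algebra_simps)
  qed
  show ?thesis using det
  proof (induction "nat \<bar>c\<bar>" arbitrary: a b c e rule: less_induct)
    case less
    show ?case
    proof (cases "c = 0")
      case True
      hence "a * e = 1" using less.prems by simp
      hence "a = 1 \<and> e = 1 \<or> a = -1 \<and> e = -1" by (auto simp: zmult_eq_1_iff)
      thus ?thesis
      proof
        assume "a = 1 \<and> e = 1"
        thus ?thesis using TK[of 1 1 0 0 b] one True by simp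
      next
        assume ae: "a = -1 \<and> e = -1"
        have "P (-1) 0 0 (-1)" using S[OF _ S[OF _ one]] by simp
        thus ?thesis using TK[of "-1" "-1" 0 0 "-b"] ae True by simp
      qed
    next
      case False
      define k a' b' where "k = a div c" and "a' = a - k * c" and "b' = b - k * e"
      have "\<bar>a mod c\<bar> < \<bar>c\<bar>" using False by (rule abs_mod_less)
      hence lt: "nat \<bar>- a'\<bar> < nat \<bar>c\<bar>" using False unfolding a'_def k_def minus_div_mult_eq_mod by auto
      have d: "c * (- b') - e * (- a') = 1" using less.prems by (simp add: a'_def b'_def algebra_simps)
      have "P c e (- a') (- b')" by (rule less.hyps[OF lt d])
      hence "P a' b' c e" using S[OF d] by simp
      moreover have "a' * e - b' * c = 1" using d by (simp add: algebra_simps)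
      ultimately show ?thesis using TK[of a' e b' c k] by (simp add: a'_def b'_def)
    qed
  qed
qed

lemma moebius_denom_nonzero:
  assumes "a * e - b * c = 1" "Im \<tau> > 0"
  shows "of_int c * \<tau> + of_int e \<noteq> 0"
proof
  assume "of_int c * \<tau> + of_int e = 0"
  hence "Im (of_int c * \<tau> + of_int e) = 0" "Re (of_int c * \<tau> + of_int e) = 0" by simp_all
  hence "c = 0" "e = 0" using assms(2) by auto
  thus False using assms(1) by simp
qed

lemma Im_moebius_pos:
  assumes det: "a * e - b * c = 1" and \<tau>: "Im \<tau> > 0"
  shows "Im (moebius a b c e \<tau>) > 0"
proof -
  let ?z = "of_int c * \<tau> + of_int e"
  have z: "?z \<noteq> 0" by (rule moebius_denom_nonzero[OF assms])
  have "moebius a b c e \<tau> = ((of_int a * \<tau> + of_int b) * cnj ?z) / of_real ((norm ?z)\<^sup>2)"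
    unfolding moebius_def by (rule complex_div_cnj)
  hence "Im (moebius a b c e \<tau>) = Im ((of_int a * \<tau> + of_int b) * cnj ?z) / (norm ?z)\<^sup>2"
    by (simp only: Im_divide_of_real)
  also have "Im ((of_int a * \<tau> + of_int b) * cnj ?z) = of_int (a * e - b * c) * Im \<tau>"
    by (simp add: algebra_simps)
  finally show ?thesis using det \<tau> z by simp
qed

lemma moebius_one: "moebius 1 0 0 1 \<tau> = \<tau>"
  by (simp add: moebius_def)

lemma moebius_T:
  assumes "a * e - b * c = 1" "Im \<tau> > 0"
  shows "moebius (a + c) (b + e) c e \<tau> = moebius a b c e \<tau> + 1"
    and "moebius (a - c) (b - e) c e \<tau> = moebius a b c e \<tau> - 1"
  using moebius_denom_nonzero[OF assms] by (simp_all add: moebius_def field_simps)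

lemma moebius_S:
  "moebius (- c) (- e) a b \<tau> = - 1 / moebius a b c e \<tau>"
  by (simp add: moebius_def divide_simps)

lemma moebius_denom_S:
  assumes "a * e - b * c = 1" "Im \<tau> > 0"
  shows "of_int a * \<tau> + of_int b = moebius a b c e \<tau> * (of_int c * \<tau> + of_int e)"
  using moebius_denom_nonzero[OF assms] by (simp add: moebius_def)

lemma csqrt_power2_tau: "(csqrt (- \<i> * \<tau>)) ^ 2 = - \<i> * \<tau>"
  by (rule power2_csqrt)

text \<open>
The 24th power of \<open>\<eta>\<close> is a modular form of weight 12 without character, since it is one for the generators.
\<close>

lemma dedekind_eta_power24:
  assumes det: "a * e - b * c = 1" and \<tau>: "Im \<tau> > 0"
  shows "dedekind_eta (moebius a b c e \<tau>) ^ 24 = (of_int c * \<tau> + of_int e) ^ 12 * dedekind_eta \<tau> ^ 24"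
proof -
  have Tr: "dedekind_eta (\<sigma> + 1) ^ 24 = dedekind_eta \<sigma> ^ 24" for \<sigma>
    unfolding dedekind_eta_translation power_mult_distrib exp_of_nat_mult[symmetric]
    using exp_two_pi_int[of 1] by (simp add: mult_ac)
  have In: "dedekind_eta (- 1 / \<sigma>) ^ 24 = \<sigma> ^ 12 * dedekind_eta \<sigma> ^ 24" if "Im \<sigma> > 0" for \<sigma>
  proof -
    have "csqrt (- \<i> * \<sigma>) ^ 24 = ((csqrt (- \<i> * \<sigma>))\<^sup>2) ^ 12" by (simp only: power_mult[symmetric]) simp
    also have "\<dots> = ((- \<i>) ^ 4) ^ 3 * \<sigma> ^ 12"
      unfolding csqrt_power2_tau power_mult_distrib by (simp only: power_mult[symmetric]) simp
    also have "(- \<i>) ^ 4 = (1 :: complex)" by (simp add: eval_nat_numeral)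
    finally have "csqrt (- \<i> * \<sigma>) ^ 24 = \<sigma> ^ 12" by simp
    thus ?thesis unfolding dedekind_eta_inversion[OF that] power_mult_distrib by simp
  qed
  have "\<forall>\<tau>. Im \<tau> > 0 \<longrightarrow> dedekind_eta (moebius a b c e \<tau>) ^ 24 = (of_int c * \<tau> + of_int e) ^ 12 * dedekind_eta \<tau> ^ 24"
    using det
  proof (rule sl2_induct)
    show "\<forall>\<tau>. Im \<tau> > 0 \<longrightarrow> dedekind_eta (moebius 1 0 0 1 \<tau>) ^ 24 = (of_int 0 * \<tau> + of_int 1) ^ 12 * dedekind_eta \<tau> ^ 24"
      by (simp add: moebius_one)
  next
    fix a b c e :: int
    assume d: "a * e - b * c = 1"
      and IH: "\<forall>\<tau>. Im \<tau> > 0 \<longrightarrow> dedekind_eta (moebius a b c e \<tau>) ^ 24 = (of_int c * \<tau> + of_int e) ^ 12 * dedekind_eta \<tau> ^ 24"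
    show "\<forall>\<tau>. Im \<tau> > 0 \<longrightarrow> dedekind_eta (moebius (a + c) (b + e) c e \<tau>) ^ 24 = (of_int c * \<tau> + of_int e) ^ 12 * dedekind_eta \<tau> ^ 24"
      using IH by (simp add: moebius_T[OF d] Tr)
    show "\<forall>\<tau>. Im \<tau> > 0 \<longrightarrow> dedekind_eta (moebius (a - c) (b - e) c e \<tau>) ^ 24 = (of_int c * \<tau> + of_int e) ^ 12 * dedekind_eta \<tau> ^ 24"
      using IH Tr[of "moebius a b c e \<tau> - 1" for \<tau>] by (simp add: moebius_T[OF d])
    show "\<forall>\<tau>. Im \<tau> > 0 \<longrightarrow> dedekind_eta (moebius (- c) (- e) a b \<tau>) ^ 24 = (of_int a * \<tau> + of_int b) ^ 12 * dedekind_eta \<tau> ^ 24"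
    proof (intro allI impI)
      fix \<tau> :: complex assume \<tau>: "Im \<tau> > 0"
      show "dedekind_eta (moebius (- c) (- e) a b \<tau>) ^ 24 = (of_int a * \<tau> + of_int b) ^ 12 * dedekind_eta \<tau> ^ 24"
        unfolding moebius_S In[OF Im_moebius_pos[OF d \<tau>]] moebius_denom_S[OF d \<tau>] power_mult_distrib
        using IH \<tau> by simp
    qed
  qed
  thus ?thesis using \<tau> by blast
qed

lemma powr_half_power2: "w \<noteq> 0 \<Longrightarrow> (w powr (1/2)) ^ 2 = (w :: complex)"
  by (simp add: power2_eq_square powr_add[symmetric])

text \<open>
The quotient defining the multiplier has 24th power 1. Being continuous on the connected upper half plane,
it is constant. So the description in the definition of \<open>eta_mult\<close> has a unique solution, and that
solution is a 24th root of unity.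
\<close>

lemma eta_multiplier:
  assumes det: "a * e - b * c = 1"
  shows "Im \<tau> > 0 \<Longrightarrow> dedekind_eta (moebius a b c e \<tau>) = eta_mult a b c e * (of_int c * \<tau> + of_int e) powr (1/2) * dedekind_eta \<tau>"
    and "eta_mult a b c e ^ 24 = 1"
proof -
  define H :: "complex set" where "H = {\<tau>. Im \<tau> > 0}"
  have conH: "connected H" unfolding H_def by (intro convex_connected convex_halfspace_Im_gt)
  define p where "p \<tau> = (of_int c * \<tau> + of_int e) powr (1/2)" for \<tau> :: complex
  define g where "g \<tau> = dedekind_eta (moebius a b c e \<tau>) / (p \<tau> * dedekind_eta \<tau>)" for \<tau>
  have nz: "of_int c * \<tau> + of_int e \<noteq> 0" if "\<tau> \<in> H" for \<tau>
    by (rule moebius_denom_nonzero[OF det]) (use that in \<open>simp add: H_def\<close>)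
  have p2: "p \<tau> ^ 2 = of_int c * \<tau> + of_int e" if "\<tau> \<in> H" for \<tau>
    unfolding p_def by (rule powr_half_power2[OF nz[OF that]])
  have p0: "p \<tau> \<noteq> 0" if "\<tau> \<in> H" for \<tau> using p2[OF that] nz[OF that] by auto
  have e0: "dedekind_eta \<tau> \<noteq> 0" if "\<tau> \<in> H" for \<tau>
    using that dedekind_eta_nonzero by (simp add: H_def)
  have g24: "g \<tau> ^ 24 = 1" if "\<tau> \<in> H" for \<tau>
  proof -
    have "(p \<tau> * dedekind_eta \<tau>) ^ 24 = (p \<tau> ^ 2) ^ 12 * dedekind_eta \<tau> ^ 24"
      by (simp only: power_mult_distrib power_mult[symmetric]) simp
    also have "\<dots> = dedekind_eta (moebius a b c e \<tau>) ^ 24"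
      unfolding p2[OF that] using dedekind_eta_power24[OF det, of \<tau>] that by (simp add: H_def)
    finally have "(p \<tau> * dedekind_eta \<tau>) ^ 24 = dedekind_eta (moebius a b c e \<tau>) ^ 24" .
    moreover have "(p \<tau> * dedekind_eta \<tau>) ^ 24 \<noteq> 0" using p0[OF that] e0[OF that] by simp
    ultimately show ?thesis unfolding g_def power_divide by (metis divide_self)
  qed
  have contp: "continuous_on H p"
  proof (cases "c = 0")
    case True
    thus ?thesis by (simp add: p_def)
  next
    case False
    have "of_int c * \<tau> + of_int e \<notin> \<real>\<^sub>\<le>\<^sub>0" if "\<tau> \<in> H" for \<tau>
      using that False by (auto simp: H_def complex_nonpos_Reals_iff)
    hence "p holomorphic_on H" unfolding p_def by (intro holomorphic_intros) auto
    thus ?thesis by (rule holomorphic_on_imp_continuous_on)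
  qed
  have "(\<lambda>\<tau>. dedekind_eta (moebius a b c e \<tau>)) holomorphic_on H"
  proof -
    have "moebius a b c e holomorphic_on H" unfolding moebius_def by (intro holomorphic_intros nz)
    moreover have "moebius a b c e ` H \<subseteq> H" using Im_moebius_pos[OF det] by (auto simp: H_def)
    ultimately show ?thesis
      using holomorphic_on_compose_gen[of "moebius a b c e" H dedekind_eta H] dedekind_eta_holomorphic
      by (simp add: o_def H_def)
  qed
  hence contg: "continuous_on H g" unfolding g_def
    by (intro continuous_on_divide continuous_on_mult contp holomorphic_on_imp_continuous_on)
       (use dedekind_eta_holomorphic p0 e0 in \<open>auto simp: H_def\<close>)
  have "finite {z::complex. z ^ 24 = 1}" by (rule finite_roots_unity) simp
  hence "finite (g ` H)" by (rule finite_subset[rotated]) (use g24 in auto)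
  hence "g constant_on H" by (rule continuous_finite_range_constant[OF conH contg])
  then obtain v where v: "\<And>\<tau>. \<tau> \<in> H \<Longrightarrow> g \<tau> = v" by (auto simp: constant_on_def)
  have works: "dedekind_eta (moebius a b c e \<tau>) = v * (of_int c * \<tau> + of_int e) powr (1/2) * dedekind_eta \<tau>" if "Im \<tau> > 0" for \<tau>
  proof -
    have "\<tau> \<in> H" using that by (simp add: H_def)
    thus ?thesis using v[of \<tau>] p0[of \<tau>] e0[of \<tau>] unfolding g_def p_def by (simp add: field_simps)
  qed
  have iH: "\<i> \<in> H" by (simp add: H_def)
  have "eta_mult a b c e = v" unfolding eta_mult_def
  proof (rule the_equality)
    show "\<forall>\<tau>. Im \<tau> > 0 \<longrightarrow> dedekind_eta (moebius a b c e \<tau>) = v * (of_int c * \<tau> + of_int e) powr (1/2) * dedekind_eta \<tau>"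
      using works by blast
    fix u assume u: "\<forall>\<tau>. Im \<tau> > 0 \<longrightarrow> dedekind_eta (moebius a b c e \<tau>) = u * (of_int c * \<tau> + of_int e) powr (1/2) * dedekind_eta \<tau>"
    have "u * p \<i> * dedekind_eta \<i> = v * p \<i> * dedekind_eta \<i>"
      using u works[of \<i>] by (simp add: p_def)
    thus "u = v" using p0[OF iH] e0[OF iH] by simp
  qed
  thus "Im \<tau> > 0 \<Longrightarrow> dedekind_eta (moebius a b c e \<tau>) = eta_mult a b c e * (of_int c * \<tau> + of_int e) powr (1/2) * dedekind_eta \<tau>"
    and "eta_mult a b c e ^ 24 = 1"
    using works v[OF iH] g24[OF iH] by auto
qed

lemma cform_scale: "cform (k *s z) (k *s z) = k ^ 2 * cform z z"
  by (simp add: cform_def sum_distrib_left power2_eq_square mult_ac)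

lemma automorphy_exponent:
  fixes Q C G W A :: complex
  assumes "W \<noteq> 0" "G \<noteq> 0" "1 + C * (G * W) = A * W"
  shows "(inverse W)\<^sup>2 * Q / G + C * Q / W = A * Q / (G * W)"
proof -
  have "(inverse W)\<^sup>2 * Q / G + C * Q / W = Q * (1 + C * (G * W)) / (W * (G * W))"
    using assms(1,2) by (simp add: field_simps power2_eq_square)
  thus ?thesis unfolding assms(3) using assms(1,2) by simp
qed

text \<open>
A transformation law of weight \<open>r / 2\<close> and character \<open>d\<close> holds for the whole modular group if it holds for
the two generators. Half-integral powers of \<open>c \<tau> + e\<close> do not form a cocycle. They are avoided by the
automorphy factor \<open>(\<eta>(A \<tau>) / \<eta>(\<tau>))^d (c \<tau> + e)^m\<close> with \<open>r = d + 2 m\<close>, which has an integral exponent \<open>m\<close>.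
\<close>

lemma jacobi_transformation:
  fixes \<phi> :: "complex \<Rightarrow> complex ^ 'n \<Rightarrow> complex" and r d :: nat and m :: int
  assumes rd: "int r - int d = 2 * m"
    and T: "\<And>\<tau> z. Im \<tau> > 0 \<Longrightarrow> \<phi> (\<tau> + 1) z = exp (two_pi_i * of_nat d / 24) * \<phi> \<tau> z"
    and S: "\<And>\<tau> z. Im \<tau> > 0 \<Longrightarrow> \<phi> (- 1 / \<tau>) (inverse \<tau> *s z) =
        \<i> powi m * csqrt (- \<i> * \<tau>) ^ r * exp (pi_i * (cform z z / \<tau>)) * \<phi> \<tau> z"
    and det: "a * e - b * c = 1" and \<tau>: "Im \<tau> > 0"
  shows "\<phi> (moebius a b c e \<tau>) (inverse (of_int c * \<tau> + of_int e) *s z) =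
      eta_mult a b c e ^ d * (of_int c * \<tau> + of_int e) powr of_real (real r / 2) *
      exp (pi_i * (of_int c * cform z z / (of_int c * \<tau> + of_int e))) * \<phi> \<tau> z"
proof -
  define j where "j a b c e \<tau> z \<longleftrightarrow> \<phi> (moebius a b c e \<tau>) (inverse (of_int c * \<tau> + of_int e) *s z) * dedekind_eta \<tau> ^ d =
      dedekind_eta (moebius a b c e \<tau>) ^ d * (of_int c * \<tau> + of_int e) powi m *
      exp (pi_i * (of_int c * cform z z / (of_int c * \<tau> + of_int e))) * \<phi> \<tau> z" for a b c e :: int and \<tau> z
  have T': "\<phi> (\<sigma> + 1) z * dedekind_eta \<sigma> ^ d = dedekind_eta (\<sigma> + 1) ^ d * \<phi> \<sigma> z" if "Im \<sigma> > 0" for \<sigma> z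
  proof -
    have "exp (two_pi_i * of_nat d / 24) = exp (two_pi_i / 24 :: complex) ^ d"
      unfolding exp_of_nat_mult[symmetric] by (rule arg_cong[where f = exp]) simp
    thus ?thesis unfolding T[OF that] dedekind_eta_translation power_mult_distrib by (simp add: mult_ac)
  qed
  have S': "\<phi> (- 1 / \<sigma>) (inverse \<sigma> *s z) * dedekind_eta \<sigma> ^ d =
      dedekind_eta (- 1 / \<sigma>) ^ d * \<sigma> powi m * exp (pi_i * (cform z z / \<sigma>)) * \<phi> \<sigma> z" if "Im \<sigma> > 0" for \<sigma> z
  proof -
    define s where "s = csqrt (- \<i> * \<sigma>)"
    have s2: "\<sigma> = \<i> * s ^ 2" unfolding s_def csqrt_power2_tau by simp
    have s0: "s \<noteq> 0" using that s2 by auto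
    have "\<sigma> powi m = \<i> powi m * s powi (2 * m)"
      unfolding s2 power_int_mult_distrib by (simp add: power_int_mult)
    moreover have "s powi (2 * m) * s ^ d = s ^ r"
      using s0 rd power_int_add[of s "2 * m" "int d"] by (simp add: rd[symmetric] power_int_of_nat)
    ultimately have "\<i> powi m * s ^ r = s ^ d * \<sigma> powi m" by (simp add: mult_ac)
    thus ?thesis unfolding S[OF that] dedekind_eta_inversion[OF that] s_def[symmetric] power_mult_distrib
      by (simp add: mult_ac)
  qed
  have "\<forall>\<tau> z. Im \<tau> > 0 \<longrightarrow> j a b c e \<tau> z"
    using det
  proof (rule sl2_induct)
    show "\<forall>\<tau> z. Im \<tau> > 0 \<longrightarrow> j 1 0 0 1 \<tau> z" by (simp add: j_def moebius_one)
  next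
    fix a b c e :: int
    assume d: "a * e - b * c = 1" and IH: "\<forall>\<tau> z. Im \<tau> > 0 \<longrightarrow> j a b c e \<tau> z"
    have nz: "of_int c * \<tau> + of_int e \<noteq> 0" if "Im \<tau> > 0" for \<tau>
      by (rule moebius_denom_nonzero[OF d that])
    show "\<forall>\<tau> z. Im \<tau> > 0 \<longrightarrow> j (a + c) (b + e) c e \<tau> z"
    proof safe
      fix \<tau> :: complex and z :: "complex ^ 'n" assume \<tau>: "Im \<tau> > 0"
      let ?\<sigma> = "moebius a b c e \<tau>" let ?z = "inverse (of_int c * \<tau> + of_int e) *s z"
      have im: "Im ?\<sigma> > 0" by (rule Im_moebius_pos[OF d \<tau>])
      have 0: "dedekind_eta ?\<sigma> ^ d \<noteq> 0" using dedekind_eta_nonzero[OF im] by simp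
      have "(\<phi> (?\<sigma> + 1) ?z * dedekind_eta ?\<sigma> ^ d) * dedekind_eta \<tau> ^ d = dedekind_eta (?\<sigma> + 1) ^ d * (\<phi> ?\<sigma> ?z * dedekind_eta \<tau> ^ d)"
        unfolding T'[OF im] by (simp only: mult_ac)
      also have "\<phi> ?\<sigma> ?z * dedekind_eta \<tau> ^ d = dedekind_eta ?\<sigma> ^ d * ((of_int c * \<tau> + of_int e) powi m *
         exp (pi_i * (of_int c * cform z z / (of_int c * \<tau> + of_int e))) * \<phi> \<tau> z)"
        using IH \<tau> unfolding j_def by (simp only: mult_ac)
      finally have "dedekind_eta ?\<sigma> ^ d * (\<phi> (?\<sigma> + 1) ?z * dedekind_eta \<tau> ^ d) = dedekind_eta ?\<sigma> ^ d * (dedekind_eta (?\<sigma> + 1) ^ d * ((of_int c * \<tau> + of_int e) powi m *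
         exp (pi_i * (of_int c * cform z z / (of_int c * \<tau> + of_int e))) * \<phi> \<tau> z))"
        by (simp only: mult_ac)
      thus "j (a + c) (b + e) c e \<tau> z"
        unfolding j_def moebius_T[OF d \<tau>] mult_left_cancel[OF 0] by (simp only: mult_ac)
    qed
    show "\<forall>\<tau> z. Im \<tau> > 0 \<longrightarrow> j (a - c) (b - e) c e \<tau> z"
    proof safe
      fix \<tau> :: complex and z :: "complex ^ 'n" assume \<tau>: "Im \<tau> > 0"
      let ?\<sigma> = "moebius a b c e \<tau> - 1" let ?z = "inverse (of_int c * \<tau> + of_int e) *s z"
      have im: "Im ?\<sigma> > 0" using Im_moebius_pos[OF d \<tau>] by simp
      have im1: "Im (?\<sigma> + 1) > 0" using im by simp
      have 0: "dedekind_eta (?\<sigma> + 1) ^ d \<noteq> 0" using dedekind_eta_nonzero[OF im1] by simp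
      have s1: "moebius a b c e \<tau> = ?\<sigma> + 1" by simp
      have "dedekind_eta (?\<sigma> + 1) ^ d * (\<phi> ?\<sigma> ?z * dedekind_eta \<tau> ^ d) = dedekind_eta ?\<sigma> ^ d * (\<phi> (?\<sigma> + 1) ?z * dedekind_eta \<tau> ^ d)"
        using T'[OF im, of ?z] by (simp only: mult_ac)
      also have "\<phi> (?\<sigma> + 1) ?z * dedekind_eta \<tau> ^ d = dedekind_eta (?\<sigma> + 1) ^ d * ((of_int c * \<tau> + of_int e) powi m *
         exp (pi_i * (of_int c * cform z z / (of_int c * \<tau> + of_int e))) * \<phi> \<tau> z)"
        using IH \<tau> unfolding j_def s1[symmetric] by (simp only: mult_ac)
      finally have "dedekind_eta (?\<sigma> + 1) ^ d * (\<phi> ?\<sigma> ?z * dedekind_eta \<tau> ^ d) = dedekind_eta (?\<sigma> + 1) ^ d * (dedekind_eta ?\<sigma> ^ d * ((of_int c * \<tau> + of_int e) powi m *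
         exp (pi_i * (of_int c * cform z z / (of_int c * \<tau> + of_int e))) * \<phi> \<tau> z))"
        by (simp only: mult_ac)
      thus "j (a - c) (b - e) c e \<tau> z"
        unfolding j_def moebius_T[OF d \<tau>] mult_left_cancel[OF 0] by (simp only: mult_ac)
    qed
    show "\<forall>\<tau> z. Im \<tau> > 0 \<longrightarrow> j (- c) (- e) a b \<tau> z"
    proof safe
      fix \<tau> :: complex and z :: "complex ^ 'n" assume \<tau>: "Im \<tau> > 0"
      let ?\<sigma> = "moebius a b c e \<tau>" let ?w = "of_int c * \<tau> + of_int e" let ?z = "inverse ?w *s z"
      have im: "Im ?\<sigma> > 0" by (rule Im_moebius_pos[OF d \<tau>])
      have 0: "dedekind_eta ?\<sigma> ^ d \<noteq> 0" using dedekind_eta_nonzero[OF im] by simp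
      have \<sigma>0: "?\<sigma> \<noteq> 0" using im by auto
      have den: "of_int a * \<tau> + of_int b = ?\<sigma> * ?w" by (rule moebius_denom_S[OF d \<tau>])
      have zz: "inverse (of_int a * \<tau> + of_int b) *s z = inverse ?\<sigma> *s ?z"
        unfolding den by simp
      have ex: "exp (pi_i * (cform ?z ?z / ?\<sigma>)) * exp (pi_i * (of_int c * cform z z / ?w)) =
          exp (pi_i * (of_int a * cform z z / (of_int a * \<tau> + of_int b)))"
      proof -
        have d': "of_int a * of_int e - of_int b * of_int c = (1::complex)"
          using d by (metis of_int_1 of_int_diff of_int_mult)
        have "1 + of_int c * (?\<sigma> * ?w) = of_int a * ?w"
          unfolding den[symmetric] using d' by (simp add: algebra_simps)
        hence "cform ?z ?z / ?\<sigma> + of_int c * cform z z / ?w = of_int a * cform z z / (?\<sigma> * ?w)"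
          unfolding cform_scale by (rule automorphy_exponent[OF nz[OF \<tau>] \<sigma>0])
        thus ?thesis unfolding den mult_exp_exp distrib_left[symmetric] by simp
      qed
      have "(\<phi> (- 1 / ?\<sigma>) (inverse ?\<sigma> *s ?z) * dedekind_eta ?\<sigma> ^ d) * dedekind_eta \<tau> ^ d =
         dedekind_eta (- 1 / ?\<sigma>) ^ d * ?\<sigma> powi m * exp (pi_i * (cform ?z ?z / ?\<sigma>)) * (\<phi> ?\<sigma> ?z * dedekind_eta \<tau> ^ d)"
        unfolding S'[OF im] by (simp only: mult_ac)
      also have "\<phi> ?\<sigma> ?z * dedekind_eta \<tau> ^ d = dedekind_eta ?\<sigma> ^ d * (?w powi m *
         exp (pi_i * (of_int c * cform z z / ?w)) * \<phi> \<tau> z)"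
        using IH \<tau> unfolding j_def by (simp only: mult_ac)
      finally have "dedekind_eta ?\<sigma> ^ d * (\<phi> (- 1 / ?\<sigma>) (inverse ?\<sigma> *s ?z) * dedekind_eta \<tau> ^ d) =
         dedekind_eta ?\<sigma> ^ d * (dedekind_eta (- 1 / ?\<sigma>) ^ d * (?\<sigma> powi m * ?w powi m) *
          (exp (pi_i * (cform ?z ?z / ?\<sigma>)) * exp (pi_i * (of_int c * cform z z / ?w))) * \<phi> \<tau> z)"
        by (simp only: mult_ac)
      thus "j (- c) (- e) a b \<tau> z"
        unfolding j_def moebius_S mult_left_cancel[OF 0] zz ex power_int_mult_distrib[symmetric]
        unfolding den by (simp only: mult_ac)
    qed
  qed
  hence J: "j a b c e \<tau> z" using \<tau> by blast
  define w where "w = of_int c * \<tau> + of_int e"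
  define p where "p = w powr (1/2)"
  have w0: "w \<noteq> 0" unfolding w_def by (rule moebius_denom_nonzero[OF det \<tau>])
  have p2: "p ^ 2 = w" unfolding p_def by (rule powr_half_power2[OF w0])
  have p0: "p \<noteq> 0" using p2 w0 by auto
  have pr: "p ^ d * w powi m = w powr of_real (real r / 2)"
  proof -
    have "p ^ d * w powi m = p powi (int d + 2 * m)"
      using p0 by (simp add: p2[symmetric] power_int_add power_int_mult)
    also have "\<dots> = p ^ r" using rd by (metis add.commute diff_add_cancel power_int_of_nat)
    also have "p ^ r = w powr (of_nat r * (1/2))"
      unfolding p_def using w0 by (simp add: powr_def exp_of_nat_mult[symmetric])
    finally show ?thesis by simp
  qed
  have 0: "dedekind_eta \<tau> ^ d \<noteq> 0" using dedekind_eta_nonzero[OF \<tau>] by simp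
  have "dedekind_eta (moebius a b c e \<tau>) ^ d = eta_mult a b c e ^ d * p ^ d * dedekind_eta \<tau> ^ d"
    unfolding eta_multiplier(1)[OF det \<tau>] w_def[symmetric] p_def[symmetric] power_mult_distrib ..
  with J have "dedekind_eta \<tau> ^ d * \<phi> (moebius a b c e \<tau>) (inverse w *s z) = dedekind_eta \<tau> ^ d * (eta_mult a b c e ^ d * (p ^ d * w powi m) *
      exp (pi_i * (of_int c * cform z z / w)) * \<phi> \<tau> z)"
    unfolding j_def w_def[symmetric] by (simp only: mult_ac)
  thus ?thesis unfolding mult_left_cancel[OF 0] pr unfolding w_def .
qed

section \<open>Products of Jacobi forms in disjoint sets of variables\<close>

text \<open>
The exponential function of index \<open>\<nu>\<close> in \<open>\<tau>\<close> and \<open>l\<close> in \<open>z\<close>.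
\<close>

abbreviation "fexp \<nu> l \<tau> z \<equiv> exp (2 * of_real pi * \<i> * (of_real \<nu> * \<tau> + cform (cvec l) z))"

text \<open>
The conditions on the index \<open>(\<nu>, l)\<close> of a Fourier coefficient for the character \<open>d\<close>: the vector \<open>l\<close> is supported on
the coordinates in \<open>I\<close> and dual to the orthogonal sum of the lattices \<open>b i \<int>\<close>, and the hyperbolic norm
\<open>2 \<nu> - (l, l)\<close> is nonnegative, or positive if \<open>strict\<close> holds.
\<close>

abbreviation admissible ::
  "bool \<Rightarrow> 'n::finite set \<Rightarrow> nat \<Rightarrow> ('n \<Rightarrow> real) \<Rightarrow> real \<Rightarrow> real ^ 'n \<Rightarrow> bool" where
  "admissible strict I d b \<nu> l \<equiv>
     \<nu> - of_nat d / 24 \<in> \<int> \<and> (\<forall>i\<in>I. b i * l $ i \<in> \<int>) \<and> (\<forall>i. i \<notin> I \<longrightarrow> l $ i = 0) \<and>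
     l \<bullet> l \<le> 2 * \<nu> \<and> (strict \<longrightarrow> l \<bullet> l < 2 * \<nu>)"

text \<open>
The transformation law of weight \<open>r / 2\<close> and character \<open>d\<close> under \<open>\<tau> \<mapsto> -1/\<tau>\<close>, in the coordinates in \<open>I\<close>.
\<close>

abbreviation inversion_at ::
  "'n::finite set \<Rightarrow> nat \<Rightarrow> nat \<Rightarrow> (complex \<Rightarrow> complex ^ 'n \<Rightarrow> complex) \<Rightarrow> complex \<Rightarrow> complex ^ 'n \<Rightarrow> bool" where
  "inversion_at I r d \<phi> \<tau> z \<equiv> \<phi> (- 1 / \<tau>) (inverse \<tau> *s z) =
     exp (pi_i * (of_nat r - of_nat d) / 4) * csqrt (- \<i> * \<tau>) ^ r *
     exp (pi_i * ((\<Sum>i\<in>I. (z $ i)\<^sup>2) / \<tau>)) * \<phi> \<tau> z"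

abbreviation "inversion_law I r d \<phi> \<equiv> \<forall>\<tau> z. Im \<tau> > 0 \<longrightarrow> inversion_at I r d \<phi> \<tau> z"

text \<open>
Quasi-periodicity under the vectors with coordinates \<open>b i x i\<close> and \<open>b i y i\<close>. Coordinates outside \<open>I\<close> may be
shifted as well; the functions in question do not depend on them.
\<close>

abbreviation lattice_at ::
  "'n::finite set \<Rightarrow> ('n \<Rightarrow> real) \<Rightarrow> (complex \<Rightarrow> complex ^ 'n \<Rightarrow> complex) \<Rightarrow> complex \<Rightarrow> complex ^ 'n \<Rightarrow> ('n \<Rightarrow> int) \<Rightarrow> ('n \<Rightarrow> int) \<Rightarrow> bool" where
  "lattice_at I b \<phi> \<tau> z x y \<equiv>
     \<phi> \<tau> (z + (\<chi> i. of_real (b i) * (of_int (x i) * \<tau> + of_int (y i)))) =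
     exp (- of_real pi * \<i> * (\<Sum>i\<in>I. (of_real (b i) * of_int (x i))\<^sup>2 * \<tau> + 2 * (of_real (b i) * of_int (x i)) * z $ i)) * \<phi> \<tau> z"

abbreviation "lattice_law I b \<phi> \<equiv> \<forall>\<tau> z x y. Im \<tau> > 0 \<longrightarrow> lattice_at I b \<phi> \<tau> z x y"

text \<open>
A Fourier expansion with admissible indices. Different \<open>k\<close> may have the same index, so the expansions of two
functions can be multiplied termwise.
\<close>

definition block_expansion ::
  "bool \<Rightarrow> 'n::finite set \<Rightarrow> nat \<Rightarrow> ('n \<Rightarrow> real) \<Rightarrow> (complex \<Rightarrow> complex ^ 'n \<Rightarrow> complex) \<Rightarrow> bool" where
  "block_expansion strict I d b \<phi> \<longleftrightarrow>
     (\<exists>(c :: nat \<Rightarrow> complex) (\<nu> :: nat \<Rightarrow> real) (l :: nat \<Rightarrow> real ^ 'n).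
        (\<forall>k. c k \<noteq> 0 \<longrightarrow> admissible strict I d b (\<nu> k) (l k)) \<and>
        (\<forall>\<tau> z. Im \<tau> > 0 \<longrightarrow>
           ((\<lambda>k. c k * fexp (\<nu> k) (l k) \<tau> z) has_sum \<phi> \<tau> z) UNIV))"

text \<open>
A Jacobi form in the coordinates \<open>z $ i\<close>, \<open>i \<in> I\<close>, of weight \<open>r / 2\<close> and character \<open>v_\<eta>^d\<close>, for the orthogonal sum
of the even lattices \<open>b i \<int>\<close>; it is a cusp form if \<open>strict\<close> holds. The translation law is not required, since
it follows from the expansion. The point \<open>\<i>\<close> serves as a common base point at which all factors are nonzero, so
that products of forms in disjoint sets of variables are nonzero.
\<close>

definition jacobi_block ::
  "bool \<Rightarrow> 'n::finite set \<Rightarrow> nat \<Rightarrow> nat \<Rightarrow> ('n \<Rightarrow> real) \<Rightarrow> (complex \<Rightarrow> complex ^ 'n \<Rightarrow> complex) \<Rightarrow> bool" where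
  "jacobi_block strict I r d b \<phi> \<longleftrightarrow>
     (\<forall>i\<in>I. b i > 0 \<and> (\<exists>k::int. (b i)\<^sup>2 = 2 * of_int k)) \<and>
     holomorphic_on_upper \<phi> \<and>
     (\<forall>\<tau> z z'. Im \<tau> > 0 \<longrightarrow> (\<forall>i\<in>I. z $ i = z' $ i) \<longrightarrow> \<phi> \<tau> z = \<phi> \<tau> z') \<and>
     (inversion_law I r d \<phi>) \<and>
     (lattice_law I b \<phi>) \<and>
     block_expansion strict I d b \<phi> \<and>
     (\<exists>z. \<phi> \<i> z \<noteq> 0)"

text \<open>
In order: evenness of the lattice, holomorphy, dependence on the coordinates in \<open>I\<close> only, inversion,
quasi-periodicity, expansion, nonvanishing.
\<close>

lemmas jacobi_blockD =
  jacobi_block_def[THEN iffD1, THEN conjunct1]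
  jacobi_block_def[THEN iffD1, THEN conjunct2, THEN conjunct1]
  jacobi_block_def[THEN iffD1, THEN conjunct2, THEN conjunct2, THEN conjunct1]
  jacobi_block_def[THEN iffD1, THEN conjunct2, THEN conjunct2, THEN conjunct2, THEN conjunct1]
  jacobi_block_def[THEN iffD1, THEN conjunct2, THEN conjunct2, THEN conjunct2, THEN conjunct2, THEN conjunct1]
  jacobi_block_def[THEN iffD1, THEN conjunct2, THEN conjunct2, THEN conjunct2, THEN conjunct2, THEN conjunct2, THEN conjunct1]
  jacobi_block_def[THEN iffD1, THEN conjunct2, THEN conjunct2, THEN conjunct2, THEN conjunct2, THEN conjunct2, THEN conjunct2]

lemma block_expansionI:
  fixes c :: "'k::countable \<Rightarrow> complex" and \<nu> :: "'k \<Rightarrow> real" and l :: "'k \<Rightarrow> real ^ 'n::finite"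
  assumes 1: "\<And>k. c k \<noteq> 0 \<Longrightarrow> admissible strict I d b (\<nu> k) (l k)"
    and 2: "\<And>\<tau> z. Im \<tau> > 0 \<Longrightarrow>
           ((\<lambda>k. c k * fexp (\<nu> k) (l k) \<tau> z) has_sum \<phi> \<tau> z) UNIV"
  shows "block_expansion strict I d b \<phi>"
proof -
  define c' where "c' j = (if j \<in> range (to_nat :: 'k \<Rightarrow> nat) then c (from_nat j) else 0)" for j
  define \<nu>' where "\<nu>' j = \<nu> (from_nat j)" for j
  define l' where "l' j = l (from_nat j)" for j
  have "((\<lambda>j. c' j * exp (two_pi_i * (of_real (\<nu>' j) * \<tau> + cform (cvec (l' j)) z))) has_sum \<phi> \<tau> z) UNIV"
    (is "(?f has_sum _) _") if "Im \<tau> > 0" for \<tau> z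
  proof -
    have "(?f has_sum \<phi> \<tau> z) (range (to_nat :: 'k \<Rightarrow> nat))"
      using 2[OF that, of z] by (subst has_sum_reindex) (simp_all add: o_def c'_def \<nu>'_def l'_def)
    thus ?thesis by (rule has_sum_cong_neutral[THEN iffD1, rotated -1]) (auto simp: c'_def)
  qed
  moreover have "c' j \<noteq> 0 \<Longrightarrow> c (from_nat j) \<noteq> 0" for j by (simp add: c'_def split: if_splits)
  ultimately show ?thesis unfolding block_expansion_def using 1
    by (intro exI[of _ c'] exI[of _ \<nu>'] exI[of _ l'] conjI allI impI; simp add: \<nu>'_def l'_def)
qed

lemma cvec_add: "cvec (x + y) = cvec x + cvec y"
  by (simp add: cvec_def vec_eq_iff)

lemma cform_add_left: "cform (x + y) z = cform x z + cform y z"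
  by (simp add: cform_def sum.distrib algebra_simps)

lemma has_sum_mult_complex:
  fixes f :: "'a \<Rightarrow> complex" and g :: "'b \<Rightarrow> complex"
  assumes f: "(f has_sum S) UNIV" and g: "(g has_sum T) UNIV"
  shows "((\<lambda>(x, y). f x * g y) has_sum (S * T)) UNIV"
proof -
  have nf: "(\<lambda>x. norm (f x)) summable_on UNIV" and ng: "(\<lambda>x. norm (g x)) summable_on UNIV"
    using f g summable_on_iff_abs_summable_on_complex has_sum_imp_summable by blast+
  have "(\<lambda>p. norm (case p of (x, y) \<Rightarrow> f x * g y)) summable_on (Sigma UNIV (\<lambda>_. UNIV))"
  proof (rule Infinite_Sum.abs_summable_on_Sigma_iff[THEN iffD2], intro conjI ballI)
    fix x
    show "(\<lambda>y. norm (case (x, y) of (x, y) \<Rightarrow> f x * g y)) summable_on UNIV"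
      using ng by (simp add: norm_mult summable_on_cmult_right)
  next
    have "(\<lambda>x. norm (f x) * (\<Sum>\<^sub>\<infinity>y. norm (g y))) summable_on UNIV"
      by (rule summable_on_cmult_left[OF nf])
    moreover have "(\<Sum>\<^sub>\<infinity>y. norm (case (x, y) of (x, y) \<Rightarrow> f x * g y)) = norm (f x) * (\<Sum>\<^sub>\<infinity>y. norm (g y))" for x
      by (simp add: norm_mult infsum_cmult_right')
    moreover have "(\<Sum>\<^sub>\<infinity>y. norm (g y)) \<ge> 0" by (rule infsum_nonneg) simp
    ultimately show "(\<lambda>x. norm (\<Sum>\<^sub>\<infinity>y. norm (case (x, y) of (x, y) \<Rightarrow> f x * g y))) summable_on UNIV"
      by (simp add: norm_mult)
  qed
  hence summ: "(\<lambda>(x, y). f x * g y) summable_on (Sigma UNIV (\<lambda>_. UNIV))"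
    by (rule abs_summable_summable)
  have "((\<lambda>(x, y). f x * g y) has_sum (S * T)) (Sigma UNIV (\<lambda>_. UNIV))"
  proof (rule has_sum_SigmaI[OF _ _ summ])
    show "((\<lambda>y. case (x, y) of (x, y) \<Rightarrow> f x * g y) has_sum f x * T) UNIV" for x
      using has_sum_cmult_right[OF g] by simp
    show "((\<lambda>x. f x * T) has_sum S * T) UNIV" by (rule has_sum_cmult_left[OF f])
  qed
  thus ?thesis by simp
qed

lemma inner_disjoint_support:
  fixes x y :: "real ^ 'n::finite"
  assumes "I \<inter> J = {}" "\<forall>i. i \<notin> I \<longrightarrow> x $ i = 0" "\<forall>i. i \<notin> J \<longrightarrow> y $ i = 0"
  shows "(x + y) \<bullet> (x + y) = x \<bullet> x + y \<bullet> y"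
proof -
  have "x $ i * y $ i = 0" for i using assms by auto
  hence "x \<bullet> y = 0" unfolding inner_vec_def by (intro sum.neutral) simp
  thus ?thesis by (simp add: inner_add inner_commute)
qed

lemma block_expansion_mult:
  fixes \<phi> \<psi> :: "complex \<Rightarrow> complex ^ 'n::finite \<Rightarrow> complex"
  assumes 1: "block_expansion s I d b \<phi>" and 2: "block_expansion s' J d' b \<psi>" and disj: "I \<inter> J = {}"
  shows "block_expansion (s \<or> s') (I \<union> J) (d + d') b (\<lambda>\<tau> z. \<phi> \<tau> z * \<psi> \<tau> z)"
proof -
  obtain c :: "nat \<Rightarrow> complex" and \<nu> :: "nat \<Rightarrow> real" and l :: "nat \<Rightarrow> real ^ 'n" where
    A: "\<forall>k. c k \<noteq> 0 \<longrightarrow> admissible s I d b (\<nu> k) (l k)"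
    "\<forall>\<tau> z. Im \<tau> > 0 \<longrightarrow> ((\<lambda>k. c k * fexp (\<nu> k) (l k) \<tau> z) has_sum \<phi> \<tau> z) UNIV"
    using 1 unfolding block_expansion_def by (elim exE conjE) (rule that)
  obtain c' :: "nat \<Rightarrow> complex" and \<nu>' :: "nat \<Rightarrow> real" and l' :: "nat \<Rightarrow> real ^ 'n" where
    B: "\<forall>k. c' k \<noteq> 0 \<longrightarrow> admissible s' J d' b (\<nu>' k) (l' k)"
    "\<forall>\<tau> z. Im \<tau> > 0 \<longrightarrow> ((\<lambda>k. c' k * fexp (\<nu>' k) (l' k) \<tau> z) has_sum \<psi> \<tau> z) UNIV"
    using 2 unfolding block_expansion_def by (elim exE conjE) (rule that)
  show ?thesis
  proof (rule block_expansionI[where c = "\<lambda>(j, k). c j * c' k" and \<nu> = "\<lambda>(j, k). \<nu> j + \<nu>' k" and l = "\<lambda>(j, k). l j + l' k"])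
    fix p :: "nat \<times> nat"
    obtain j k where p: "p = (j, k)" by fastforce
    assume "(case p of (j, k) \<Rightarrow> c j * c' k) \<noteq> 0"
    hence nz: "c j \<noteq> 0" "c' k \<noteq> 0" by (auto simp: p)
    note a = A(1)[rule_format, OF nz(1)] and b = B(1)[rule_format, OF nz(2)]
    have "\<nu> j + \<nu>' k - of_nat (d + d') / 24 = (\<nu> j - of_nat d / 24) + (\<nu>' k - of_nat d' / 24)"
      by (simp add: add_divide_distrib)
    hence "\<nu> j + \<nu>' k - of_nat (d + d') / 24 \<in> \<int>" using a b by (metis Ints_add)
    moreover have "b i * (l j + l' k) $ i \<in> \<int>" if "i \<in> I \<union> J" for i
      using that a b disj by auto
    moreover have "(l j + l' k) \<bullet> (l j + l' k) = l j \<bullet> l j + l' k \<bullet> l' k"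
      using a b by (intro inner_disjoint_support[OF disj]) auto
    ultimately show "(case p of (j, k) \<Rightarrow> \<nu> j + \<nu>' k) - real (d + d') / 24 \<in> \<int> \<and>
         (\<forall>i\<in>I \<union> J. b i * (case p of (j, k) \<Rightarrow> l j + l' k) $ i \<in> \<int>) \<and>
         (\<forall>i. i \<notin> I \<union> J \<longrightarrow> (case p of (j, k) \<Rightarrow> l j + l' k) $ i = 0) \<and>
         (case p of (j, k) \<Rightarrow> l j + l' k) \<bullet> (case p of (j, k) \<Rightarrow> l j + l' k) \<le> 2 * (case p of (j, k) \<Rightarrow> \<nu> j + \<nu>' k) \<and>
         (s \<or> s' \<longrightarrow> (case p of (j, k) \<Rightarrow> l j + l' k) \<bullet> (case p of (j, k) \<Rightarrow> l j + l' k) < 2 * (case p of (j, k) \<Rightarrow> \<nu> j + \<nu>' k))"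
      using a b by (auto simp: p)
  next
    fix \<tau> :: complex and z :: "complex ^ 'n" assume \<tau>: "Im \<tau> > 0"
    have eq: "(c j * exp (two_pi_i * (of_real (\<nu> j) * \<tau> + cform (cvec (l j)) z))) *
        (c' k * fexp (\<nu>' k) (l' k) \<tau> z) =
        c j * c' k * exp (two_pi_i * (of_real (\<nu> j + \<nu>' k) * \<tau> + cform (cvec (l j + l' k)) z))" for j k
    proof -
      have "two_pi_i * (of_real (\<nu> j + \<nu>' k) * \<tau> + cform (cvec (l j + l' k)) z) =
        two_pi_i * (of_real (\<nu> j) * \<tau> + cform (cvec (l j)) z) + two_pi_i * (of_real (\<nu>' k) * \<tau> + cform (cvec (l' k)) z)"
        by (simp add: cvec_add cform_add_left algebra_simps)
      thus ?thesis by (simp only: exp_add mult_ac)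
    qed
    show "((\<lambda>p. (case p of (j, k) \<Rightarrow> c j * c' k) * exp (two_pi_i * (of_real (case p of (j, k) \<Rightarrow> \<nu> j + \<nu>' k) * \<tau> + cform (cvec (case p of (j, k) \<Rightarrow> l j + l' k)) z)))
       has_sum \<phi> \<tau> z * \<psi> \<tau> z) UNIV"
      using has_sum_mult_complex[OF A(2)[rule_format, OF \<tau>, of z] B(2)[rule_format, OF \<tau>, of z]] unfolding eq
      by (simp add: case_prod_unfold)
  qed
qed

lemma holomorphic_on_upper_mult:
  assumes "holomorphic_on_upper \<phi>" "holomorphic_on_upper \<psi>"
  shows "holomorphic_on_upper (\<lambda>\<tau> z. \<phi> \<tau> z * \<psi> \<tau> z)"
  unfolding holomorphic_on_upper_def
proof (intro allI impI)
  fix \<tau> :: complex and z :: "complex ^ 'a" assume "Im \<tau> > 0"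
  then obtain D E where D: "((\<lambda>p. \<phi> (fst p) (snd p)) has_derivative D) (at (\<tau>, z))" "\<And>s t w. D (s * t, s *s w) = s * D (t, w)"
    and E: "((\<lambda>p. \<psi> (fst p) (snd p)) has_derivative E) (at (\<tau>, z))" "\<And>s t w. E (s * t, s *s w) = s * E (t, w)"
    using assms unfolding holomorphic_on_upper_def by meson
  show "\<exists>D. ((\<lambda>p. \<phi> (fst p) (snd p) * \<psi> (fst p) (snd p)) has_derivative D) (at (\<tau>, z)) \<and> (\<forall>s t w. D (s * t, s *s w) = s * D (t, w))"
    by (rule exI, rule conjI, rule has_derivative_mult[OF D(1) E(1)]) (simp add: D(2) E(2) algebra_simps)
qed

lemma holomorphic_on_upper_add:
  assumes "holomorphic_on_upper \<phi>" "holomorphic_on_upper \<psi>"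
  shows "holomorphic_on_upper (\<lambda>\<tau> z. \<phi> \<tau> z + \<psi> \<tau> z)"
  unfolding holomorphic_on_upper_def
proof (intro allI impI)
  fix \<tau> :: complex and z :: "complex ^ 'a" assume "Im \<tau> > 0"
  then obtain D E where D: "((\<lambda>p. \<phi> (fst p) (snd p)) has_derivative D) (at (\<tau>, z))" "\<And>s t w. D (s * t, s *s w) = s * D (t, w)"
    and E: "((\<lambda>p. \<psi> (fst p) (snd p)) has_derivative E) (at (\<tau>, z))" "\<And>s t w. E (s * t, s *s w) = s * E (t, w)"
    using assms unfolding holomorphic_on_upper_def by meson
  show "\<exists>D. ((\<lambda>p. \<phi> (fst p) (snd p) + \<psi> (fst p) (snd p)) has_derivative D) (at (\<tau>, z)) \<and> (\<forall>s t w. D (s * t, s *s w) = s * D (t, w))"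
    by (rule exI, rule conjI, rule has_derivative_add[OF D(1) E(1)]) (simp add: D(2) E(2) algebra_simps)
qed

lemma jacobi_block_cong:
  fixes \<phi> :: "complex \<Rightarrow> complex ^ 'n::finite \<Rightarrow> complex"
  assumes 1: "jacobi_block s I r d b \<phi>" and b: "\<And>i. i \<in> I \<Longrightarrow> b' i = b i"
  shows "jacobi_block s I r d b' \<phi>"
proof -
  have dep: "\<phi> \<tau> z = \<phi> \<tau> z'" if "Im \<tau> > 0" "\<forall>i\<in>I. z $ i = z' $ i" for \<tau> z z'
    using jacobi_blockD(3)[OF 1] that by blast
  have exp: "block_expansion s I d b' \<phi>"
  proof -
    have e: "(\<forall>i\<in>I. b' i * v $ i \<in> \<int>) \<longleftrightarrow> (\<forall>i\<in>I. b i * v $ i \<in> \<int>)" for v :: "real ^ 'n"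
      by (simp add: b)
    show ?thesis using jacobi_blockD(6)[OF 1] unfolding block_expansion_def e .
  qed
  have lat: "lattice_at I b' \<phi> \<tau> z x y"
    if \<tau>: "Im \<tau> > 0" for \<tau> z and x y :: "'n \<Rightarrow> int"
  proof -
    have "\<phi> \<tau> (z + (\<chi> i. of_real (b' i) * (of_int (x i) * \<tau> + of_int (y i)))) = \<phi> \<tau> (z + (\<chi> i. of_real (b i) * (of_int (x i) * \<tau> + of_int (y i))))"
      by (rule dep[OF \<tau>]) (simp add: b)
    also have "\<dots> = exp (- of_real pi * \<i> * (\<Sum>i\<in>I. (of_real (b i) * of_int (x i))\<^sup>2 * \<tau> + 2 * (of_real (b i) * of_int (x i)) * z $ i)) * \<phi> \<tau> z"
      using jacobi_blockD(5)[OF 1] \<tau> by blast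
    also have "(\<Sum>i\<in>I. (of_real (b i) * of_int (x i))\<^sup>2 * \<tau> + 2 * (of_real (b i) * of_int (x i)) * z $ i) =
        (\<Sum>i\<in>I. (of_real (b' i) * of_int (x i))\<^sup>2 * \<tau> + 2 * (of_real (b' i) * of_int (x i)) * z $ i)"
      by (intro sum.cong refl) (simp add: b)
    finally show ?thesis .
  qed
  have pos: "\<forall>i\<in>I. b' i > 0 \<and> (\<exists>k::int. (b' i)\<^sup>2 = 2 * of_int k)"
    using jacobi_blockD(1)[OF 1] b by simp
  show ?thesis unfolding jacobi_block_def
    by (intro conjI pos jacobi_blockD(2,3,4,7)[OF 1] exp) (use lat in blast)
qed

lemma jacobi_block_mult:
  fixes \<phi> \<psi> :: "complex \<Rightarrow> complex ^ 'n::finite \<Rightarrow> complex"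
  assumes 1: "jacobi_block s I r d b \<phi>" and 2: "jacobi_block s' J r' d' b \<psi>" and disj: "I \<inter> J = {}"
  shows "jacobi_block (s \<or> s') (I \<union> J) (r + r') (d + d') b (\<lambda>\<tau> z. \<phi> \<tau> z * \<psi> \<tau> z)"
  unfolding jacobi_block_def
proof (intro conjI)
  have sumIJ: "sum f (I \<union> J) = sum f I + sum f J" for f :: "'n \<Rightarrow> complex"
    by (rule sum.union_disjoint) (use disj in auto)
  show "\<forall>i\<in>I \<union> J. 0 < b i \<and> (\<exists>k::int. (b i)\<^sup>2 = 2 * of_int k)"
    using jacobi_blockD(1)[OF 1] jacobi_blockD(1)[OF 2] by blast
  show "holomorphic_on_upper (\<lambda>\<tau> z. \<phi> \<tau> z * \<psi> \<tau> z)"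
    by (rule holomorphic_on_upper_mult[OF jacobi_blockD(2)[OF 1] jacobi_blockD(2)[OF 2]])
  have dep: "\<phi> \<tau> z = \<phi> \<tau> z'" if "Im \<tau> > 0" "\<forall>i\<in>I. z $ i = z' $ i" for \<tau> z z'
    using jacobi_blockD(3)[OF 1] that by blast
  have dep': "\<psi> \<tau> z = \<psi> \<tau> z'" if "Im \<tau> > 0" "\<forall>i\<in>J. z $ i = z' $ i" for \<tau> z z'
    using jacobi_blockD(3)[OF 2] that by blast
  show "\<forall>\<tau> z z'. 0 < Im \<tau> \<longrightarrow> (\<forall>i\<in>I \<union> J. z $ i = z' $ i) \<longrightarrow> \<phi> \<tau> z * \<psi> \<tau> z = \<phi> \<tau> z' * \<psi> \<tau> z'"
    using dep dep' by (metis UnCI)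
  show "\<forall>\<tau> z. Im \<tau> > 0 \<longrightarrow> \<phi> (- 1 / \<tau>) (inverse \<tau> *s z) * \<psi> (- 1 / \<tau>) (inverse \<tau> *s z) =
        exp (pi_i * (of_nat (r + r') - of_nat (d + d')) / 4) * csqrt (- \<i> * \<tau>) ^ (r + r') *
        exp (pi_i * ((\<Sum>i\<in>I \<union> J. (z $ i)\<^sup>2) / \<tau>)) * (\<phi> \<tau> z * \<psi> \<tau> z)"
  proof (intro allI impI)
    fix \<tau> :: complex and z :: "complex ^ 'n" assume \<tau>: "Im \<tau> > 0"
    have "inversion_at I r d \<phi> \<tau> z"
      and "inversion_at J r' d' \<psi> \<tau> z"
      using jacobi_blockD(4)[OF 1] jacobi_blockD(4)[OF 2] \<tau> by blast+
    moreover have "pi_i * (of_nat (r + r') - of_nat (d + d')) / 4 =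
        pi_i * (of_nat r - of_nat d) / 4 + pi_i * (of_nat r' - of_nat d') / (4 :: complex)"
      by (simp add: field_simps)
    moreover have "pi_i * ((\<Sum>i\<in>I \<union> J. (z $ i)\<^sup>2) / \<tau>) = pi_i * ((\<Sum>i\<in>I. (z $ i)\<^sup>2) / \<tau>) + pi_i * ((\<Sum>i\<in>J. (z $ i)\<^sup>2) / \<tau>)"
      unfolding sumIJ by (simp add: add_divide_distrib distrib_left)
    ultimately show "\<phi> (- 1 / \<tau>) (inverse \<tau> *s z) * \<psi> (- 1 / \<tau>) (inverse \<tau> *s z) =
        exp (pi_i * (of_nat (r + r') - of_nat (d + d')) / 4) * csqrt (- \<i> * \<tau>) ^ (r + r') *
        exp (pi_i * ((\<Sum>i\<in>I \<union> J. (z $ i)\<^sup>2) / \<tau>)) * (\<phi> \<tau> z * \<psi> \<tau> z)"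
      by (simp only: exp_add power_add mult_ac)
  qed
  show "\<forall>\<tau> z (x :: 'n \<Rightarrow> int) (y :: 'n \<Rightarrow> int). Im \<tau> > 0 \<longrightarrow>
        \<phi> \<tau> (z + (\<chi> i. of_real (b i) * (of_int (x i) * \<tau> + of_int (y i)))) * \<psi> \<tau> (z + (\<chi> i. of_real (b i) * (of_int (x i) * \<tau> + of_int (y i)))) =
        exp (- of_real pi * \<i> * (\<Sum>i\<in>I \<union> J. (of_real (b i) * of_int (x i))\<^sup>2 * \<tau> + 2 * (of_real (b i) * of_int (x i)) * z $ i)) * (\<phi> \<tau> z * \<psi> \<tau> z)"
  proof (intro allI impI)
    fix \<tau> :: complex and z :: "complex ^ 'n" and x y :: "'n \<Rightarrow> int" assume \<tau>: "Im \<tau> > 0"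
    have "lattice_at I b \<phi> \<tau> z x y"
      and "lattice_at J b \<psi> \<tau> z x y"
      using jacobi_blockD(5)[OF 1] jacobi_blockD(5)[OF 2] \<tau> by blast+
    thus "\<phi> \<tau> (z + (\<chi> i. of_real (b i) * (of_int (x i) * \<tau> + of_int (y i)))) * \<psi> \<tau> (z + (\<chi> i. of_real (b i) * (of_int (x i) * \<tau> + of_int (y i)))) =
        exp (- of_real pi * \<i> * (\<Sum>i\<in>I \<union> J. (of_real (b i) * of_int (x i))\<^sup>2 * \<tau> + 2 * (of_real (b i) * of_int (x i)) * z $ i)) * (\<phi> \<tau> z * \<psi> \<tau> z)"
      unfolding sumIJ by (simp only: distrib_left exp_add mult_ac)
  qed
  show "block_expansion (s \<or> s') (I \<union> J) (d + d') b (\<lambda>\<tau> z. \<phi> \<tau> z * \<psi> \<tau> z)"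
    by (rule block_expansion_mult[OF jacobi_blockD(6)[OF 1] jacobi_blockD(6)[OF 2] disj])
  obtain z z' where z: "\<phi> \<i> z \<noteq> 0" "\<psi> \<i> z' \<noteq> 0" using jacobi_blockD(7)[OF 1] jacobi_blockD(7)[OF 2] by blast
  define z'' where "z'' = (\<chi> i. if i \<in> I then z $ i else z' $ i)"
  have "\<phi> \<i> z'' = \<phi> \<i> z" by (rule dep) (auto simp: z''_def)
  moreover have "\<psi> \<i> z'' = \<psi> \<i> z'" by (rule dep') (use disj in \<open>auto simp: z''_def\<close>)
  ultimately show "\<exists>z. \<phi> \<i> z * \<psi> \<i> z \<noteq> 0" using z by (intro exI[of _ z'']) simp
qed

text \<open>
Existence of such a form for some choice of the lattice.
\<close>

definition has_block :: "bool \<Rightarrow> 'n::finite set \<Rightarrow> nat \<Rightarrow> nat \<Rightarrow> bool" where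
  "has_block strict I r d \<longleftrightarrow> (\<exists>b \<phi>. jacobi_block strict I r d b \<phi>)"

lemma has_block_union:
  assumes "has_block s I r d" "has_block s' J r' d'" "I \<inter> J = {}"
  shows "has_block (s \<or> s') (I \<union> J) (r + r') (d + d')"
proof -
  obtain b \<phi> b' \<psi> where bl: "jacobi_block s I r d b \<phi>" "jacobi_block s' J r' d' b' \<psi>"
    using assms unfolding has_block_def by blast
  define b'' where "b'' i = (if i \<in> I then b i else b' i)" for i
  have "jacobi_block s I r d b'' \<phi>" by (rule jacobi_block_cong[OF bl(1)]) (simp add: b''_def)
  moreover have "jacobi_block s' J r' d' b'' \<psi>" by (rule jacobi_block_cong[OF bl(2)]) (use assms(3) in \<open>auto simp: b''_def\<close>)
  ultimately show ?thesis using jacobi_block_mult[OF _ _ assms(3)] unfolding has_block_def by blast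
qed

section \<open>The elementary theta functions\<close>

lemma theta_level_has_sum:
  assumes c: "periodic N c" and \<tau>: "Im \<tau> > 0"
  shows "((\<lambda>m. c m * exp (two_pi_i * (of_real ((of_int m)\<^sup>2 / (2 * real N)) * \<tau> + of_real (of_int m / sqrt (real N)) * w)))
            has_sum theta_level N c \<tau> w) UNIV"
proof -
  have N: "N > 0" using c by (simp add: periodic_def)
  have im: "Im (\<tau> / of_nat N) > 0" using \<tau> N by (simp add: Im_divide_nat)
  have "theta_term c (\<tau> / of_nat N) (w / of_real (sqrt (real N))) =
     (\<lambda>m. c m * exp (two_pi_i * (of_real ((of_int m)\<^sup>2 / (2 * real N)) * \<tau> + of_real (of_int m / sqrt (real N)) * w)))"
  proof
    fix m
    have "pi_i * (of_int m)\<^sup>2 * (\<tau> / of_nat N) + two_pi_i * of_int m * (w / of_real (sqrt (real N))) =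
      two_pi_i * (of_real ((of_int m)\<^sup>2 / (2 * real N)) * \<tau> + of_real (of_int m / sqrt (real N)) * w)"
      by (simp add: algebra_simps)
    thus "theta_term c (\<tau> / of_nat N) (w / of_real (sqrt (real N))) m =
      c m * exp (two_pi_i * (of_real ((of_int m)\<^sup>2 / (2 * real N)) * \<tau> + of_real (of_int m / sqrt (real N)) * w))"
      by (simp only: theta_term_def)
  qed
  with theta_has_sum[of c _ "\<tau> / of_nat N" "w / of_real (sqrt (real N))", OF periodic_bounded[OF c] im]
  show ?thesis unfolding theta_level_def by (simp only:)
qed

lemma theta_level_eigen_inversion:
  assumes c: "periodic N c" and dft: "\<And>k. dft N c k = \<mu> * of_real (sqrt (real N)) * c k" and \<tau>: "Im \<tau> > 0"
  shows "theta_level N c (- 1 / \<tau>) (w / \<tau>) = \<mu> * csqrt (- \<i> * \<tau>) * exp (pi_i * (w\<^sup>2 / \<tau>)) * theta_level N c \<tau> w"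
proof -
  have N: "N > 0" using c by (simp add: periodic_def)
  have "dft N c = (\<lambda>k. (\<mu> * of_real (sqrt (real N))) * c k)" using dft by auto
  hence "theta_level N (dft N c) \<tau> w = \<mu> * of_real (sqrt (real N)) * theta_level N c \<tau> w"
    by (simp only: theta_level_def theta_cmult)
  thus ?thesis using theta_level_inversion[OF c \<tau>, of w] N by (simp add: field_simps)
qed

lemma theta_level_holomorphic_on_upper:
  fixes i :: "'n::finite"
  assumes c: "periodic N c"
  shows "holomorphic_on_upper (\<lambda>\<tau> z :: complex ^ 'n. theta_level N c \<tau> (a * z $ i))"
  unfolding holomorphic_on_upper_def
proof (intro allI impI)
  fix \<tau> :: complex and z :: "complex ^ 'n" assume \<tau>: "Im \<tau> > 0"
  have N: "N > 0" using c by (simp add: periodic_def)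
  define s :: complex where "s = of_real (sqrt (real N))"
  have im: "Im (\<tau> / of_nat N) > 0" using \<tau> N by (simp add: Im_divide_nat)
  obtain A B where AB: "((\<lambda>p. theta c (fst p) (snd p)) has_derivative (\<lambda>h. A * fst h + B * snd h)) (at (\<tau> / of_nat N, a * z $ i / s))"
    using theta_has_derivative[of c _ "\<tau> / of_nat N" "a * z $ i / s", OF periodic_bounded[OF c] im] by blast
  define g where "g p = (fst p / of_nat N, a * snd p $ i / s)" for p :: "complex \<times> (complex ^ 'n)"
  have "bounded_linear (\<lambda>p :: complex \<times> (complex ^ 'n). fst p / of_nat N)"
    by (intro bounded_linear_divide[THEN bounded_linear_compose] bounded_linear_fst)
  moreover have "bounded_linear (\<lambda>p :: complex \<times> (complex ^ 'n). a * snd p $ i / s)"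
    by (intro bounded_linear_divide[THEN bounded_linear_compose] bounded_linear_const_mult
        bounded_linear_compose[OF bounded_linear_vec_nth] bounded_linear_snd)
  ultimately have "bounded_linear g" unfolding g_def by (rule bounded_linear_Pair)
  hence "(g has_derivative g) (at (\<tau>, z))" by (rule bounded_linear_imp_has_derivative)
  moreover have "g (\<tau>, z) = (\<tau> / of_nat N, a * z $ i / s)" by (simp add: g_def)
  ultimately have "((\<lambda>p. theta c (fst (g p)) (snd (g p))) has_derivative (\<lambda>h. A * fst (g h) + B * snd (g h))) (at (\<tau>, z))"
    using has_derivative_compose[of g g "(\<tau>, z)" UNIV "\<lambda>p. theta c (fst p) (snd p)"] AB by simp
  hence "((\<lambda>p. theta_level N c (fst p) (a * snd p $ i)) has_derivative (\<lambda>h. A * fst (g h) + B * snd (g h))) (at (\<tau>, z))"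
    unfolding theta_level_def s_def[symmetric] by (simp add: g_def)
  moreover have "A * fst (g (k * t, k *s w)) + B * snd (g (k * t, k *s w)) = k * (A * fst (g (t, w)) + B * snd (g (t, w)))" for k t w
    by (simp add: g_def algebra_simps)
  ultimately show "\<exists>D. ((\<lambda>p. theta_level N c (fst p) (a * snd p $ i)) has_derivative D) (at (\<tau>, z)) \<and> (\<forall>s t w. D (s * t, s *s w) = s * D (t, w))"
    by blast
qed

lemma cform_axis: "cform (cvec (axis i a)) z = of_real a * z $ i"
proof -
  have "cform (cvec (axis i a)) z = (\<Sum>j\<in>UNIV. if j = i then of_real a * z $ i else 0)"
    unfolding cform_def cvec_def by (intro sum.cong) (auto simp: axis_def)
  thus ?thesis by simp
qed

lemma inner_axis_self: "axis i a \<bullet> axis i (a :: real) = a\<^sup>2"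
  by (simp add: inner_axis_axis power2_eq_square)

text \<open>
A criterion for nonvanishing: the series is a fixed multiple of a series of nonnegative reals after
the terms of index \<open>m\<close> and \<open>-m\<close> are combined.
\<close>

lemma has_sum_positive_multiple:
  fixes f :: "int \<Rightarrow> complex" and \<rho> :: "int \<Rightarrow> real"
  assumes f: "(f has_sum S) UNIV" and sym: "\<And>m. f m + f (- m) = \<kappa> * of_real (\<rho> m)"
    and nonneg: "\<And>m. \<rho> m \<ge> 0" and pos: "\<rho> m0 > 0" and \<kappa>: "\<kappa> \<noteq> 0"
  shows "\<exists>s>0. S = \<kappa> * of_real s"
proof -
  have "((\<lambda>m. f (- m)) has_sum S) UNIV"
    using has_sum_reindex_bij_betw[OF bij_uminus[where 'a = int], of f] f by simp
  from has_sum_cmult_right[OF has_sum_add[OF f this], of "1 / \<kappa>"]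
  have h: "((\<lambda>m. of_real (\<rho> m) :: complex) has_sum (2 * S / \<kappa>)) UNIV"
    using \<kappa> by (simp add: sym)
  have re: "(\<rho> has_sum Re (2 * S / \<kappa>)) UNIV"
    using has_sum_Re[OF h] by simp
  have "((\<lambda>_::int. 0::real) has_sum Im (2 * S / \<kappa>)) UNIV"
    using has_sum_Im[OF h] by simp
  hence im: "Im (2 * S / \<kappa>) = 0" using has_sum_0 infsumI by fastforce
  have "0 < Re (2 * S / \<kappa>)"
    by (rule has_sum_strict_mono[where f = "\<lambda>_. 0" and g = \<rho> and A = UNIV and x = m0])
      (use re pos nonneg in auto)
  moreover have "S = \<kappa> * of_real (Re (2 * S / \<kappa>) / 2)"
  proof -
    have "of_real (Re (2 * S / \<kappa>)) = 2 * S / \<kappa>" using im by (simp add: complex_eq_iff)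
    thus ?thesis using \<kappa> by simp
  qed
  ultimately show ?thesis by (intro exI[of _ "Re (2 * S / \<kappa>) / 2"]) simp
qed

lemma theta_level_positive_multiple:
  fixes t :: real and \<rho> :: "int \<Rightarrow> real"
  assumes c: "periodic N c"
    and sym: "\<And>m. c m * exp (two_pi_i * of_int m * of_real t) + c (- m) * exp (two_pi_i * of_int (- m) * of_real t) = \<kappa> * of_real (\<rho> m)"
    and nonneg: "\<And>m. \<rho> m \<ge> 0" and pos: "\<rho> m0 > 0" and \<kappa>: "\<kappa> \<noteq> 0"
  shows "\<exists>s>0. theta_level N c \<i> (of_real (sqrt (real N) * t)) = \<kappa> * of_real s"
proof (rule has_sum_positive_multiple[OF theta_level_has_sum[OF c]])
  have N: "N > 0" using c by (simp add: periodic_def)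
  fix m :: int
  have e: "exp (two_pi_i * (of_real ((of_int m)\<^sup>2 / (2 * real N)) * \<i> + of_real (of_int m / sqrt (real N)) * of_real (sqrt (real N) * t))) =
      of_real (exp (- pi * (of_int m)\<^sup>2 / real N)) * exp (two_pi_i * of_int m * of_real t)" for m :: int
    unfolding exp_of_real[symmetric] mult_exp_exp using N
    by (intro arg_cong[where f = exp]) (simp add: field_simps)
  show "c m * exp (two_pi_i * (of_real ((of_int m)\<^sup>2 / (2 * real N)) * \<i> + of_real (of_int m / sqrt (real N)) * of_real (sqrt (real N) * t))) +
      c (- m) * exp (two_pi_i * (of_real ((of_int (- m))\<^sup>2 / (2 * real N)) * \<i> + of_real (of_int (- m) / sqrt (real N)) * of_real (sqrt (real N) * t))) =
      \<kappa> * of_real (\<rho> m * exp (- pi * (of_int m)\<^sup>2 / real N))"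
  proof -
    define x :: complex where "x = of_real (exp (- pi * (of_int m)\<^sup>2 / real N))"
    have x': "of_real (exp (- pi * (of_int (- m))\<^sup>2 / real N)) = x" by (simp add: x_def)
    have "c m * (x * exp (two_pi_i * of_int m * of_real t)) + c (- m) * (x * exp (two_pi_i * of_int (- m) * of_real t)) =
      x * (c m * exp (two_pi_i * of_int m * of_real t) + c (- m) * exp (two_pi_i * of_int (- m) * of_real t))"
      by (simp only: distrib_left mult_ac)
    also have "\<dots> = \<kappa> * of_real (\<rho> m * exp (- pi * (of_int m)\<^sup>2 / real N))"
      unfolding sym x_def by simp
    finally show ?thesis unfolding e x' x_def[symmetric] .
  qed
  show "\<rho> m * exp (- pi * (of_int m)\<^sup>2 / real N) \<ge> 0" using nonneg by simp
next
  show "\<rho> m0 * exp (- pi * (of_int m0)\<^sup>2 / real N) > 0" using pos by simp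
qed (use \<kappa> in auto)

lemma periodic_chi4: "periodic 4 chi4"
  by (simp add: periodic_def chi4_def)

lemma periodic_parity_ind: "periodic 2 (parity_ind j)"
  by (simp add: periodic_def parity_ind_def)

lemma periodic_chi3_parity: "periodic 6 (chi3_parity j)"
proof -
  have "(m + 6) mod 2 = m mod 2" "(m + 6) mod 3 = m mod 3" for m :: int by presburger+
  thus ?thesis by (simp add: periodic_def chi3_parity_def)
qed

text \<open>
At this point the exponential contributes \<open>\<i>^(-m)\<close>, which compensates the sign of the character.
\<close>

lemma theta_chi4_nonzero: "theta_level 4 chi4 \<i> (of_real (- 1 / 2)) \<noteq> 0"
proof -
  have "\<exists>s>0. theta_level 4 chi4 \<i> (of_real (sqrt (real 4) * (- 1 / 4))) = (- 2 * \<i>) * of_real s"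
  proof (rule theta_level_positive_multiple[OF periodic_chi4, where \<rho> = "\<lambda>m. if odd m then 1 else 0" and ?m0.0 = 1])
    fix m :: int
    have e: "exp (two_pi_i * of_int m * of_real (- 1 / 4)) = zeta12 ^ ((3 * nat (m mod 4)) mod 12)" for m :: int
      using zeta12_kernel[of 4 3 1 m] by (simp add: mult_ac)
    have "m mod 4 = 0 \<and> (- m) mod 4 = 0 \<and> even m \<or> m mod 4 = 1 \<and> (- m) mod 4 = 3 \<and> odd m \<or> m mod 4 = 2 \<and> (- m) mod 4 = 2 \<and> even m \<or>
       m mod 4 = 3 \<and> (- m) mod 4 = 1 \<and> odd m" by presburger
    thus "chi4 m * exp (two_pi_i * of_int m * of_real (- 1 / 4)) + chi4 (- m) * exp (two_pi_i * of_int (- m) * of_real (- 1 / 4)) =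
        - 2 * \<i> * of_real (if odd m then 1 else 0)"
      unfolding e chi4_def by (elim disjE conjE) (simp_all add: zeta12_table)
  qed auto
  thus ?thesis by auto
qed

lemma theta_parity_positive: "\<exists>s>0. theta_level 2 (parity_ind j) \<i> 0 = of_real s" if "j < 2" for j
proof -
  have "\<exists>s>0. theta_level 2 (parity_ind j) \<i> (of_real (sqrt (real 2) * 0)) = 2 * of_real s"
  proof (rule theta_level_positive_multiple[OF periodic_parity_ind, where \<rho> = "\<lambda>m. if m mod 2 = int j then 1 else 0" and ?m0.0 = "int j"])
    fix m :: int
    have "(- m) mod 2 = m mod 2" by presburger
    thus "parity_ind j m * exp (two_pi_i * of_int m * of_real 0) + parity_ind j (- m) * exp (two_pi_i * of_int (- m) * of_real 0) =
        2 * of_real (if m mod 2 = int j then 1 else 0)"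
      by (simp add: parity_ind_def)
  qed (use that in auto)
  then obtain s where "s > 0" "theta_level 2 (parity_ind j) \<i> 0 = 2 * of_real s" by auto
  thus ?thesis by (intro exI[of _ "2 * s"]) simp
qed

text \<open>
The exponential contributes a cube root of unity; its odd part has the sign of the character, up to a constant.
\<close>

lemma theta_chi3_positive: "\<exists>s>0. theta_level 6 (chi3_parity j) \<i> (of_real (sqrt (real 6) * (- 1 / 3))) = (- \<i> * of_real (sqrt 3)) * of_real s" if "j < 2" for j
proof (rule theta_level_positive_multiple[OF periodic_chi3_parity, where \<rho> = "\<lambda>m. if m mod 2 = int j \<and> m mod 3 \<noteq> 0 then 1 else 0" and ?m0.0 = "2 - int j"])
  fix m :: int
  have e: "exp (two_pi_i * of_int m * of_real (- 1 / 3)) = zeta12 ^ ((4 * nat (m mod 3)) mod 12)" for m :: int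
    using zeta12_kernel[of 3 4 1 m] by (simp add: mult_ac)
  have m2: "(- m) mod 2 = m mod 2" by presburger
  have "m mod 3 = 0 \<and> (- m) mod 3 = 0 \<or> m mod 3 = 1 \<and> (- m) mod 3 = 2 \<or> m mod 3 = 2 \<and> (- m) mod 3 = 1" by presburger
  thus "chi3_parity j m * exp (two_pi_i * of_int m * of_real (- 1 / 3)) + chi3_parity j (- m) * exp (two_pi_i * of_int (- m) * of_real (- 1 / 3)) =
      (- \<i> * of_real (sqrt 3)) * of_real (if m mod 2 = int j \<and> m mod 3 \<noteq> 0 then 1 else 0)"
    unfolding e chi3_parity_def m2 by (elim disjE conjE) (simp_all add: zeta12_table complex_eq_iff)
next
  have "j = 0 \<or> j = 1" using that by auto
  thus "(if (2 - int j) mod 2 = int j \<and> (2 - int j) mod 3 \<noteq> 0 then 1 else 0 :: real) > 0" by auto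
qed auto

lemma sqrt_even_square: "even N \<Longrightarrow> \<exists>k::int. (sqrt (real N))\<^sup>2 = 2 * of_int k"
proof -
  assume "even N"
  then obtain k where "N = 2 * k" by (elim evenE)
  hence "(sqrt (real N))\<^sup>2 = 2 * of_int (int k)" by simp
  thus ?thesis by blast
qed

lemma vec_lattice_nth:
  "(z + (\<chi> i. of_real (b i) * (of_int (x i) * \<tau> + of_int (y i)))) $ i = z $ i + of_real (b i) * (of_int (x i) * \<tau> + of_int (y i))" for z :: "complex ^ 'n"
  by simp

lemma sum_singleton: "sum h {i} = h i"
  by simp

text \<open>
A periodic coefficient function that is an eigenfunction of the finite Fourier transform and is supported on
\<open>m^2 \<equiv> N d / 12\<close> modulo \<open>2 N\<close> gives a form of singular weight in one variable.
\<close>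

lemma has_block_theta_level:
  fixes i :: "'n::finite"
  assumes ev: "even N" and c: "periodic N c"
    and dft: "\<And>k. dft N c k = exp (pi_i * (1 - of_nat d) / 4) * of_real (sqrt (real N)) * c k"
    and coef: "\<And>m. c m \<noteq> 0 \<Longrightarrow> (of_int m)\<^sup>2 / (2 * real N) - real d / 24 \<in> \<int>"
    and nz: "theta_level N c \<i> w \<noteq> 0"
  shows "has_block False {i} 1 d"
proof -
  have N: "N > 0" using c by (simp add: periodic_def)
  define \<phi> where "\<phi> \<tau> z = theta_level N c \<tau> (z $ i)" for \<tau> and z :: "complex ^ 'n"
  have "jacobi_block False {i} 1 d (\<lambda>_. sqrt (real N)) \<phi>"
    unfolding jacobi_block_def
  proof (intro conjI)
    show "\<forall>i\<in>{i}. 0 < sqrt (real N) \<and> (\<exists>k::int. (sqrt (real N))\<^sup>2 = 2 * of_int k)"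
      using sqrt_even_square[OF ev] N by simp
    show "holomorphic_on_upper \<phi>"
      using theta_level_holomorphic_on_upper[OF c, of 1 i] unfolding \<phi>_def by simp
    show "inversion_law {i} 1 d \<phi>"
    proof (intro allI impI)
      fix \<tau> :: complex and z :: "complex ^ 'n" assume \<tau>: "Im \<tau> > 0"
      have sc: "(inverse \<tau> *s z) $ i = z $ i / \<tau>" by (simp add: divide_inverse mult.commute)
      show "inversion_at {i} 1 d \<phi> \<tau> z"
        unfolding \<phi>_def sc sum_singleton theta_level_eigen_inversion[OF c dft \<tau>]
        by (simp only: power_one_right of_nat_1)
    qed
    show "lattice_law {i} (\<lambda>_. sqrt (real N)) \<phi>"
    proof (intro allI impI)
      fix \<tau> :: complex and z :: "complex ^ 'n" and x y :: "'n \<Rightarrow> int" assume \<tau>: "Im \<tau> > 0"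
      show "lattice_at {i} (\<lambda>_. sqrt (real N)) \<phi> \<tau> z x y"
        unfolding \<phi>_def vec_lattice_nth theta_level_lattice[OF c \<tau>] sum_singleton by (simp only: mult.assoc)
    qed
    show "block_expansion False {i} d (\<lambda>_. sqrt (real N)) \<phi>"
    proof (rule block_expansionI[where c = c and \<nu> = "\<lambda>m. (of_int m)\<^sup>2 / (2 * real N)" and l = "\<lambda>m. axis i (of_int m / sqrt (real N))"])
      fix m assume "c m \<noteq> 0"
      have norm: "axis i (of_int m / sqrt (real N)) \<bullet> axis i (of_int m / sqrt (real N)) = 2 * ((of_int m)\<^sup>2 / (2 * real N))"
        by (simp add: inner_axis_self power_divide)
      show "(of_int m)\<^sup>2 / (2 * real N) - of_nat d / 24 \<in> \<int> \<and>
          (\<forall>j\<in>{i}. sqrt (real N) * axis i (of_int m / sqrt (real N)) $ j \<in> \<int>) \<and>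
          (\<forall>j. j \<notin> {i} \<longrightarrow> axis i (of_int m / sqrt (real N)) $ j = 0) \<and>
          axis i (of_int m / sqrt (real N)) \<bullet> axis i (of_int m / sqrt (real N)) \<le> 2 * ((of_int m)\<^sup>2 / (2 * real N)) \<and>
          (False \<longrightarrow> axis i (of_int m / sqrt (real N)) \<bullet> axis i (of_int m / sqrt (real N)) < 2 * ((of_int m)\<^sup>2 / (2 * real N)))"
        unfolding norm using coef[OF \<open>c m \<noteq> 0\<close>] N by (simp add: axis_def)
    next
      fix \<tau> :: complex and z :: "complex ^ 'n" assume "Im \<tau> > 0"
      thus "((\<lambda>m. c m * exp (two_pi_i * (of_real ((of_int m)\<^sup>2 / (2 * real N)) * \<tau> + cform (cvec (axis i (of_int m / sqrt (real N)))) z))) has_sum \<phi> \<tau> z) UNIV"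
        unfolding cform_axis \<phi>_def by (rule theta_level_has_sum[OF c])
    qed
    show "\<exists>z. \<phi> \<i> z \<noteq> 0" using nz by (intro exI[of _ "\<chi> j. w"]) (simp add: \<phi>_def)
  qed (simp add: \<phi>_def)
  thus ?thesis unfolding has_block_def by blast
qed

lemma chi4_coef: "chi4 m \<noteq> 0 \<Longrightarrow> (of_int m)\<^sup>2 / 8 - 1 / 8 \<in> (\<int> :: real set)"
proof -
  assume "chi4 m \<noteq> 0"
  hence "m mod 4 = 1 \<or> m mod 4 = 3" by (auto simp: chi4_def split: if_splits)
  hence "odd m" by presburger
  then obtain k where k: "m = 2 * k + 1" by (elim oddE)
  have "even (k * (k + 1))" by simp
  then obtain j where j: "k * (k + 1) = 2 * j" by (elim evenE)
  have "m\<^sup>2 = 8 * j + 1" unfolding k using j by (simp add: power2_eq_square algebra_simps)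
  hence "(of_int m)\<^sup>2 = (8 * of_int j + 1 :: real)" by (metis of_int_1 of_int_add of_int_mult of_int_numeral of_int_power)
  hence "(of_int m)\<^sup>2 / 8 - 1 / 8 = (of_int j :: real)" by (simp add: field_simps)
  thus ?thesis by simp
qed

lemma chi12_coef: "chi12 m \<noteq> 0 \<Longrightarrow> (of_int m)\<^sup>2 / 24 - 1 / 24 \<in> (\<int> :: real set)"
proof -
  assume "chi12 m \<noteq> 0"
  hence "m mod 12 \<in> {1, 5, 7, 11}" by (auto simp: chi12_def split: if_splits)
  then obtain r where r: "r \<in> {1, 5, 7, 11}" "m mod 12 = r" by blast
  define q where "q = m div 12"
  have m: "m = 12 * q + r" using r(2) mult_div_mod_eq[of 12 m] by (simp add: q_def)
  have "m\<^sup>2 = 24 * (6 * q\<^sup>2 + q * r) + r\<^sup>2" unfolding m by (simp add: power2_eq_square algebra_simps)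
  moreover have "\<exists>s. r\<^sup>2 = 24 * s + 1" using r(1)
    by (elim insertE emptyE) (auto intro: exI[of _ 0] exI[of _ 1] exI[of _ 2] exI[of _ 5])
  ultimately obtain j where "m\<^sup>2 = 24 * j + 1"
    by (metis add.assoc distrib_left)
  hence "(of_int m)\<^sup>2 = (24 * of_int j + 1 :: real)" by (metis of_int_1 of_int_add of_int_mult of_int_numeral of_int_power)
  hence "(of_int m)\<^sup>2 / 24 - 1 / 24 = (of_int j :: real)" by (simp add: field_simps)
  thus ?thesis by simp
qed

lemma exp_minus_i_half: "exp (pi_i * (1 - of_nat 3) / 4) = - \<i>"
proof -
  have "exp (pi_i * (1 - of_nat 3) / 4) = cis (- (pi / 2))" by (simp add: cis_conv_exp mult.commute)
  thus ?thesis by (simp add: complex_eq_iff)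
qed

lemma has_block_theta: "has_block False {i} 1 3"
proof (rule has_block_theta_level[where N = 4 and c = chi4])
  show "dft 4 chi4 k = exp (pi_i * (1 - of_nat 3) / 4) * of_real (sqrt (real 4)) * chi4 k" for k
    unfolding exp_minus_i_half dft_chi4 by simp
  show "(of_int m)\<^sup>2 / (2 * real 4) - real 3 / 24 \<in> \<int>" if "chi4 m \<noteq> 0" for m
    using chi4_coef[OF that] by simp
qed (use periodic_chi4 theta_chi4_nonzero in auto)

lemma theta_chi12_nonzero: "theta_level 12 chi12 \<i> 0 \<noteq> 0"
  using dedekind_eta_theta[of \<i>] dedekind_eta_nonzero[of \<i>] by simp

lemma has_block_quintuple: "has_block False {i} 1 1"
proof (rule has_block_theta_level[where N = 12 and c = chi12])
  show "dft 12 chi12 k = exp (pi_i * (1 - of_nat 1) / 4) * of_real (sqrt (real 12)) * chi12 k" for k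
    unfolding dft_chi12 by simp
  show "(of_int m)\<^sup>2 / (2 * real 12) - real 1 / 24 \<in> \<int>" if "chi12 m \<noteq> 0" for m
    using chi12_coef[OF that] by simp
qed (use periodic_chi12 theta_chi12_nonzero in auto)

text \<open>
The eta function as a form without variables; it is a cusp form because the index 0 does not occur.
\<close>

lemma has_block_eta: "has_block True ({} :: 'n::finite set) 1 1"
proof -
  define \<phi> where "\<phi> \<tau> (z :: complex ^ 'n) = theta_level 12 chi12 \<tau> 0" for \<tau> z
  have "jacobi_block True {} 1 1 (\<lambda>_. 1) \<phi>"
    unfolding jacobi_block_def
  proof (intro conjI)
    show "holomorphic_on_upper \<phi>"
      using theta_level_holomorphic_on_upper[OF periodic_chi12, of 0] unfolding \<phi>_def by simp
    show "inversion_law {} 1 1 \<phi>"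
      using theta_level_eigen_inversion[OF periodic_chi12, where \<mu> = 1 and w = 0] dft_chi12 by (simp add: \<phi>_def)
    show "block_expansion True {} 1 (\<lambda>_. 1) \<phi>"
    proof (rule block_expansionI[where c = chi12 and \<nu> = "\<lambda>m. (of_int m)\<^sup>2 / (2 * real 12)" and l = "\<lambda>_. 0"])
      fix m assume "chi12 m \<noteq> 0"
      moreover from this have "m \<noteq> 0" by (auto simp: chi12_def)
      ultimately show "(of_int m)\<^sup>2 / (2 * real 12) - of_nat 1 / 24 \<in> \<int> \<and> (\<forall>i\<in>{}. 1 * (0 :: real ^ 'n) $ i \<in> \<int>) \<and>
          (\<forall>i. i \<notin> {} \<longrightarrow> (0 :: real ^ 'n) $ i = 0) \<and> (0 :: real ^ 'n) \<bullet> 0 \<le> 2 * ((of_int m)\<^sup>2 / (2 * real 12)) \<and>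
          (True \<longrightarrow> (0 :: real ^ 'n) \<bullet> 0 < 2 * ((of_int m)\<^sup>2 / (2 * real 12)))"
        using chi12_coef[of m] by simp
    next
      fix \<tau> :: complex and z :: "complex ^ 'n" assume "Im \<tau> > 0"
      from theta_level_has_sum[OF periodic_chi12 this, of 0]
      show "((\<lambda>m. chi12 m * exp (two_pi_i * (of_real ((of_int m)\<^sup>2 / (2 * real 12)) * \<tau> + cform (cvec 0) z))) has_sum \<phi> \<tau> z) UNIV"
        by (simp add: \<phi>_def cform_def cvec_def)
    qed
    show "\<exists>z. \<phi> \<i> z \<noteq> 0" using theta_chi12_nonzero by (simp add: \<phi>_def)
  qed (simp_all add: \<phi>_def)
  thus ?thesis unfolding has_block_def by blast
qed

lemma holomorphic_product_nonzero:
  assumes f: "f holomorphic_on UNIV" and g: "g holomorphic_on UNIV" and nz: "f a \<noteq> 0" "g b \<noteq> 0"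
  shows "\<exists>z::complex. f z * g z \<noteq> 0"
proof (rule ccontr)
  assume "\<not> ?thesis"
  hence fg: "f z * g z = 0" for z by blast
  have "open {z. f z \<noteq> 0}"
    using open_Collect_neq[of f "\<lambda>_. 0"] holomorphic_on_imp_continuous_on[OF f] by simp
  hence "g b = 0"
    by (rule analytic_continuation_open[of "{z. f z \<noteq> 0}" UNIV g "\<lambda>_. 0" b]) (use f g nz fg in auto)
  thus False using nz by simp
qed

lemma theta_level_add:
  assumes "periodic N c" "periodic N c'" "Im \<tau> > 0"
  shows "theta_level N (\<lambda>m. c m + c' m) \<tau> w = theta_level N c \<tau> w + theta_level N c' \<tau> w"
  unfolding theta_level_def
  by (rule theta_add[OF periodic_bounded[OF assms(1)] periodic_bounded[OF assms(2)]])
    (use assms in \<open>simp add: Im_divide_nat periodic_def\<close>)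

lemma theta_level_diff:
  assumes "periodic N c" "periodic N c'" "Im \<tau> > 0"
  shows "theta_level N (\<lambda>m. c m - c' m) \<tau> w = theta_level N c \<tau> w - theta_level N c' \<tau> w"
proof -
  have "periodic N (\<lambda>m. (-1) * c' m)" using assms(2) by (simp add: periodic_def)
  from theta_level_add[OF assms(1) this assms(3), of w] show ?thesis
    using theta_cmult[of "-1" c' "\<tau> / of_nat N" "w / of_real (sqrt (real N))"] by (simp add: theta_level_def)
qed

lemma theta_level_cmult: "theta_level N (\<lambda>m. k * c m) \<tau> w = k * theta_level N c \<tau> w"
  by (simp add: theta_level_def theta_cmult)

text \<open>
The exponents of \<open>\<tau>\<close> in the hexagonal theta function are congruent to \<open>1/3\<close> modulo \<open>\<int>\<close>.
\<close>

lemma hexagonal_coef: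
  assumes "(u - v) mod 2 = (0::int)" "v mod 3 \<noteq> 0"
  shows "(of_int u)\<^sup>2 / 4 + (of_int v)\<^sup>2 / 12 - 8 / 24 \<in> (\<int> :: real set)"
proof -
  have "v mod 3 = 1 \<or> v mod 3 = 2" using assms(2) by presburger
  hence "\<exists>k. v = 3 * k + 1 \<or> v = 3 * k + 2" by presburger
  then obtain k where "v = 3 * k + 1 \<or> v = 3 * k + 2" by blast
  hence "v\<^sup>2 = 3 * (3 * k\<^sup>2 + 2 * k) + 1 \<or> v\<^sup>2 = 3 * (3 * k\<^sup>2 + 4 * k + 1) + 1"
    by (auto simp: power2_eq_square algebra_simps)
  moreover have "X mod 3 = 1" if "X = 3 * q + 1" for X q :: int using that by presburger
  ultimately have v3: "v\<^sup>2 mod 3 = 1" by blast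
  obtain a where "u - v = 2 * a" using mod_0_imp_dvd[OF assms(1)] by (elim dvdE)
  hence a: "u = v + 2 * a" by simp
  have "3 * u\<^sup>2 + v\<^sup>2 = 4 * (v\<^sup>2 + 3 * v * a + 3 * a\<^sup>2)" unfolding a by (simp add: power2_eq_square algebra_simps)
  moreover have "X mod 12 = 0" if "X = 3 * a + b - 4" "3 * a + b = 4 * k" "b mod 3 = 1" for X a b k :: int
    using that by presburger
  ultimately have "(3 * u\<^sup>2 + v\<^sup>2 - 4) mod 12 = 0" using v3 by blast
  then obtain j where "3 * u\<^sup>2 + v\<^sup>2 - 4 = 12 * j" using mod_0_imp_dvd by (elim dvdE[OF mod_0_imp_dvd])
  hence "of_int (3 * u\<^sup>2 + v\<^sup>2 - 4) = (of_int (12 * j) :: real)" by (simp only:)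
  hence "(of_int u)\<^sup>2 / 4 + (of_int v)\<^sup>2 / 12 - 8 / 24 = (of_int j :: real)" by (simp add: field_simps)
  thus ?thesis by simp
qed

text \<open>
The dual of the hexagonal root lattice consists of the vectors \<open>(u / \<surd>2, v / \<surd>6)\<close> with \<open>u \<equiv> v\<close> modulo 2, and
\<open>v\<close> modulo 3 is the class of such a vector modulo the lattice itself. Its theta function with the odd
character of \<open>v\<close> modulo 3 is the sum, over the two parities of \<open>u\<close> and \<open>v\<close>, of products of theta series in one
variable. Under inversion both pairs of factors transform by the matrix with rows \<open>(1, 1), (1, -1)\<close>, up to
scalars, and the sum of the products is preserved up to a scalar.
\<close>

lemma has_block_hexagonal:
  fixes i j :: "'n::finite"
  assumes ij: "i \<noteq> j"
  shows "has_block False {i, j} 2 8"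
proof -
  note per = periodic_parity_ind periodic_chi3_parity
  define A where "A k \<tau> z = theta_level 2 (parity_ind k) \<tau> (z $ i)" for k \<tau> and z :: "complex ^ 'n"
  define B where "B k \<tau> z = theta_level 6 (chi3_parity k) \<tau> (z $ j)" for k \<tau> and z :: "complex ^ 'n"
  define \<phi> where "\<phi> \<tau> z = A 0 \<tau> z * B 0 \<tau> z + A 1 \<tau> z * B 1 \<tau> z" for \<tau> and z :: "complex ^ 'n"
  define b where "b k = (if k = i then sqrt (real 2) else sqrt (real 6))" for k
  have b: "b i = sqrt (real 2)" "b j = sqrt (real 6)" using ij by (auto simp: b_def)
  have "jacobi_block False {i, j} 2 8 b \<phi>"
    unfolding jacobi_block_def
  proof (intro conjI)
    show "\<forall>k\<in>{i, j}. 0 < b k \<and> (\<exists>m::int. (b k)\<^sup>2 = 2 * of_int m)"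
      using sqrt_even_square[of 2] sqrt_even_square[of 6] by (simp add: b)
    have "holomorphic_on_upper (A k)" "holomorphic_on_upper (B k)" for k
      using theta_level_holomorphic_on_upper[OF per(1)[of k], where a = 1 and i = i] theta_level_holomorphic_on_upper[OF per(2)[of k], where a = 1 and i = j]
      unfolding A_def B_def by simp_all
    thus "holomorphic_on_upper \<phi>" unfolding \<phi>_def
      by (intro holomorphic_on_upper_add holomorphic_on_upper_mult)
    show "\<forall>\<tau> z z'. Im \<tau> > 0 \<longrightarrow> (\<forall>k\<in>{i, j}. z $ k = z' $ k) \<longrightarrow> \<phi> \<tau> z = \<phi> \<tau> z'"
      by (simp add: \<phi>_def A_def B_def)
    show "inversion_law {i, j} 2 8 \<phi>"
    proof (intro allI impI)
      fix \<tau> :: complex and z :: "complex ^ 'n" assume \<tau>: "Im \<tau> > 0"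
      define s where "s = csqrt (- \<i> * \<tau>)"
      define Ei where "Ei = exp (pi_i * (z $ i)\<^sup>2 / \<tau>)"
      define Ej where "Ej = exp (pi_i * (z $ j)\<^sup>2 / \<tau>)"
      define r2 r3 r6 :: complex where "r2 = of_real (sqrt 2)" and "r3 = of_real (sqrt 3)" and "r6 = of_real (sqrt 6)"
      have r: "r2 \<noteq> 0" "r3 \<noteq> 0" "r6 = r2 * r3" "r2 * r2 = 2"
        using real_sqrt_mult[of 2 3] by (simp_all add: r2_def r3_def r6_def of_real_mult[symmetric] del: of_real_mult)
      have sc: "(inverse \<tau> *s z) $ k = z $ k / \<tau>" for k by (simp add: divide_inverse mult.commute)
      have d2: "dft 2 (parity_ind 0) = (\<lambda>k. parity_ind 0 k + parity_ind 1 k)"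
        "dft 2 (parity_ind 1) = (\<lambda>k. parity_ind 0 k - parity_ind 1 k)"
        using dft_parity_ind by auto
      have d6: "dft 6 (chi3_parity 0) = (\<lambda>k. (\<i> * r3) * (chi3_parity 0 k + chi3_parity 1 k))"
        "dft 6 (chi3_parity 1) = (\<lambda>k. (\<i> * r3) * (chi3_parity 0 k - chi3_parity 1 k))"
        using dft_chi3_parity by (auto simp: r3_def)
      have A': "A 0 (- 1 / \<tau>) (inverse \<tau> *s z) = s / r2 * Ei * (A 0 \<tau> z + A 1 \<tau> z)"
        "A 1 (- 1 / \<tau>) (inverse \<tau> *s z) = s / r2 * Ei * (A 0 \<tau> z - A 1 \<tau> z)"
        unfolding A_def sc theta_level_inversion[OF per(1) \<tau>] d2 theta_level_add[OF per(1) per(1) \<tau>] theta_level_diff[OF per(1) per(1) \<tau>]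
        by (simp_all add: s_def Ei_def r2_def)
      have B': "B 0 (- 1 / \<tau>) (inverse \<tau> *s z) = s / r6 * Ej * (\<i> * r3 * (B 0 \<tau> z + B 1 \<tau> z))"
        "B 1 (- 1 / \<tau>) (inverse \<tau> *s z) = s / r6 * Ej * (\<i> * r3 * (B 0 \<tau> z - B 1 \<tau> z))"
        unfolding B_def sc theta_level_inversion[OF per(2) \<tau>] d6 theta_level_cmult theta_level_add[OF per(2) per(2) \<tau>] theta_level_diff[OF per(2) per(2) \<tau>]
        by (simp_all add: s_def Ej_def r6_def)
      have "\<phi> (- 1 / \<tau>) (inverse \<tau> *s z) = s\<^sup>2 * (Ei * Ej) * \<i> * (2 * \<phi> \<tau> z / (r2 * r2))"
        unfolding \<phi>_def A' B' using r(1,2) unfolding r(3) by (simp add: field_simps power2_eq_square)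
      hence "\<phi> (- 1 / \<tau>) (inverse \<tau> *s z) = \<i> * s\<^sup>2 * (Ei * Ej) * \<phi> \<tau> z"
        unfolding r(4) by (simp add: mult_ac)
      moreover have "Ei * Ej = exp (pi_i * ((\<Sum>k\<in>{i, j}. (z $ k)\<^sup>2) / \<tau>))"
        using ij unfolding Ei_def Ej_def mult_exp_exp by (simp add: add_divide_distrib distrib_left)
      moreover have "exp (pi_i * (of_nat 2 - of_nat 8) / 4) = \<i>"
      proof -
        have "exp (pi_i * (of_nat 2 - of_nat 8) / 4) = exp (2 * of_int (-1) * of_real pi * \<i>) * exp (\<i> * of_real (pi / 2))"
          unfolding mult_exp_exp by (rule arg_cong[where f = exp]) simp
        also have "\<dots> = cis (pi / 2)" unfolding exp_two_pi_int cis_conv_exp by simp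
        finally show ?thesis by simp
      qed
      ultimately show "inversion_at {i, j} 2 8 \<phi> \<tau> z"
        by (simp only: s_def)
    qed
    show "lattice_law {i, j} b \<phi>"
    proof (intro allI impI)
      fix \<tau> :: complex and z :: "complex ^ 'n" and x y :: "'n \<Rightarrow> int" assume \<tau>: "Im \<tau> > 0"
      define z' where "z' = z + (\<chi> k. of_real (b k) * (of_int (x k) * \<tau> + of_int (y k)))"
      define Ei where "Ei = exp (- of_real pi * \<i> * ((of_real (b i) * of_int (x i))\<^sup>2 * \<tau> + 2 * of_real (b i) * of_int (x i) * z $ i))"
      define Ej where "Ej = exp (- of_real pi * \<i> * ((of_real (b j) * of_int (x j))\<^sup>2 * \<tau> + 2 * of_real (b j) * of_int (x j) * z $ j))"
      have z': "z' $ i = z $ i + of_real (sqrt (real 2)) * (of_int (x i) * \<tau> + of_int (y i))"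
        "z' $ j = z $ j + of_real (sqrt (real 6)) * (of_int (x j) * \<tau> + of_int (y j))"
        unfolding z'_def vec_lattice_nth b by simp_all
      have "A k \<tau> z' = Ei * A k \<tau> z" "B k \<tau> z' = Ej * B k \<tau> z" for k
        unfolding A_def B_def z' theta_level_lattice[OF per(1) \<tau>] theta_level_lattice[OF per(2) \<tau>] Ei_def Ej_def b by simp_all
      hence "\<phi> \<tau> z' = (Ei * Ej) * \<phi> \<tau> z" by (simp add: \<phi>_def algebra_simps)
      also have "Ei * Ej = exp (- of_real pi * \<i> * (\<Sum>k\<in>{i, j}. (of_real (b k) * of_int (x k))\<^sup>2 * \<tau> + 2 * (of_real (b k) * of_int (x k)) * z $ k))"
        using ij unfolding Ei_def Ej_def mult_exp_exp by (intro arg_cong[where f = exp]) (simp add: algebra_simps)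
      finally show "lattice_at {i, j} b \<phi> \<tau> z x y"
        unfolding z'_def .
    qed
    define c where "c = (\<lambda>(u, v). parity_ind 0 u * chi3_parity 0 v + parity_ind 1 u * chi3_parity 1 v)"
    define \<nu> :: "int \<times> int \<Rightarrow> real" where "\<nu> = (\<lambda>(u, v). (of_int u)\<^sup>2 / (2 * real 2) + (of_int v)\<^sup>2 / (2 * real 6))"
    define l :: "int \<times> int \<Rightarrow> real ^ 'n" where "l = (\<lambda>(u, v). axis i (of_int u / sqrt (real 2)) + axis j (of_int v / sqrt (real 6)))"
    show "block_expansion False {i, j} 8 b \<phi>"
    proof (rule block_expansionI[where c = c and \<nu> = \<nu> and l = l])
      fix p :: "int \<times> int"
      obtain u v where p: "p = (u, v)" by fastforce
      assume "c p \<noteq> 0"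
      hence "parity_ind 0 u * chi3_parity 0 v \<noteq> 0 \<or> parity_ind 1 u * chi3_parity 1 v \<noteq> 0" by (auto simp: c_def p)
      hence uv: "u mod 2 = v mod 2" "v mod 3 \<noteq> 0" by (auto simp: parity_ind_def chi3_parity_def split: if_splits)
      have "(u - v) mod 2 = 0" using uv(1) by presburger
      from hexagonal_coef[OF this uv(2)] have "\<nu> p - real 8 / 24 \<in> \<int>" by (simp add: \<nu>_def p)
      moreover have "b i * l p $ i = of_int u" "b j * l p $ j = of_int v" using ij by (simp_all add: l_def p b axis_def)
      moreover have "l p $ k = 0" if "k \<notin> {i, j}" for k using that by (simp add: l_def p axis_def)
      moreover have "l p \<bullet> l p = 2 * \<nu> p"
      proof -
        have "l p \<bullet> l p = axis i (of_int u / sqrt (real 2)) \<bullet> axis i (of_int u / sqrt (real 2)) + axis j (of_int v / sqrt (real 6)) \<bullet> axis j (of_int v / sqrt (real 6))"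
          unfolding l_def p prod.case by (rule inner_disjoint_support[of "{i}" "{j}"]) (use ij in \<open>auto simp: axis_def\<close>)
        thus ?thesis by (simp add: inner_axis_self power_divide \<nu>_def p)
      qed
      ultimately show "\<nu> p - real 8 / 24 \<in> \<int> \<and> (\<forall>k\<in>{i, j}. b k * l p $ k \<in> \<int>) \<and> (\<forall>k. k \<notin> {i, j} \<longrightarrow> l p $ k = 0) \<and>
          l p \<bullet> l p \<le> 2 * \<nu> p \<and> (False \<longrightarrow> l p \<bullet> l p < 2 * \<nu> p)"
        by simp
    next
      fix \<tau> :: complex and z :: "complex ^ 'n" assume \<tau>: "Im \<tau> > 0"
      define e where "e p = exp (two_pi_i * (of_real (\<nu> p) * \<tau> + cform (cvec (l p)) z))" for p
      have e: "exp (two_pi_i * (of_real ((of_int u)\<^sup>2 / (2 * real 2)) * \<tau> + of_real (of_int u / sqrt (real 2)) * z $ i)) *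
          exp (two_pi_i * (of_real ((of_int v)\<^sup>2 / (2 * real 6)) * \<tau> + of_real (of_int v / sqrt (real 6)) * z $ j)) = e (u, v)" for u v :: int
        unfolding e_def \<nu>_def l_def prod.case cvec_add cform_add_left cform_axis mult_exp_exp
        by (rule arg_cong[where f = exp]) (simp add: algebra_simps)
      have "((\<lambda>(u, v). (parity_ind k u * chi3_parity k v) * e (u, v)) has_sum A k \<tau> z * B k \<tau> z) UNIV" for k
        using has_sum_mult_complex[OF theta_level_has_sum[OF per(1) \<tau>] theta_level_has_sum[OF per(2) \<tau>], of k "z $ i" k "z $ j"]
        unfolding A_def B_def e[symmetric] by (simp only: mult_ac)
      from has_sum_add[OF this[of 0] this[of 1]]
      show "((\<lambda>p. c p * exp (two_pi_i * (of_real (\<nu> p) * \<tau> + cform (cvec (l p)) z))) has_sum \<phi> \<tau> z) UNIV"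
        unfolding e_def[symmetric] \<phi>_def c_def by (simp add: case_prod_unfold distrib_right)
    qed
    show "\<exists>z. \<phi> \<i> z \<noteq> 0"
    proof -
      let ?t = "of_real (sqrt (real 6) * (- 1 / 3)) :: complex"
      obtain a0 a1 b0 b1 where s: "a0 > 0" "a1 > 0" "b0 > 0" "b1 > 0"
        and v: "theta_level 2 (parity_ind 0) \<i> 0 = of_real a0" "theta_level 2 (parity_ind 1) \<i> 0 = of_real a1"
        "theta_level 6 (chi3_parity 0) \<i> ?t = (- \<i> * of_real (sqrt 3)) * of_real b0"
        "theta_level 6 (chi3_parity 1) \<i> ?t = (- \<i> * of_real (sqrt 3)) * of_real b1"
        using theta_parity_positive[of 0] theta_parity_positive[of 1] theta_chi3_positive[of 0] theta_chi3_positive[of 1] by auto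
      define z :: "complex ^ 'n" where "z = (\<chi> k. if k = i then 0 else ?t)"
      have z: "z $ i = 0" "z $ j = ?t" using ij by (simp_all add: z_def)
      have "\<phi> \<i> z = (- \<i> * of_real (sqrt 3)) * of_real (a0 * b0 + a1 * b1)"
        unfolding \<phi>_def A_def B_def z v by (simp add: algebra_simps)
      moreover have "a0 * b0 + a1 * b1 > 0" using s by (intro add_pos_pos mult_pos_pos)
      ultimately have "\<phi> \<i> z \<noteq> 0" by (simp add: of_real_eq_0_iff del: of_real_add of_real_mult)
      thus ?thesis by blast
    qed
  qed
  thus ?thesis unfolding has_block_def by blast
qed

lemma minus_i_product:
  fixes q E1 E2 T1 T2 :: complex
  shows "(- \<i> * q * E1 * T1) * (- \<i> * q * E2 * T2) = (- 1) * q ^ 2 * (E1 * E2) * (T1 * T2)"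
proof -
  have "\<i> * \<i> = - 1" by simp
  thus ?thesis by algebra
qed

text \<open>
The product \<open>\<theta>(z) \<theta>(2z)\<close>, with \<open>z\<close> scaled by \<open>1 / \<surd>5\<close> such that the quadratic form is \<open>z^2\<close>. For the indices
\<open>u, v\<close> the hyperbolic norm is \<open>(2 u - v)^2 / 20\<close>, and \<open>v\<close> is odd.
\<close>

lemma has_block_theta_theta:
  fixes i :: "'n::finite"
  shows "has_block True {i} 2 6"
proof -
  note per = periodic_chi4
  define r5 :: complex where "r5 = of_real (sqrt 5)"
  have r5: "r5 \<noteq> 0" "r5 * r5 = 5" by (simp_all add: r5_def of_real_mult[symmetric] del: of_real_mult)
  have s20: "sqrt 20 = 2 * sqrt (5::real)" using real_sqrt_mult[of 4 5] by simp
  define \<phi> where "\<phi> \<tau> z = theta_level 4 chi4 \<tau> (z $ i / r5) * theta_level 4 chi4 \<tau> (2 * z $ i / r5)" for \<tau> and z :: "complex ^ 'n"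
  have "jacobi_block True {i} 2 6 (\<lambda>_. sqrt 20) \<phi>"
    unfolding jacobi_block_def
  proof (intro conjI)
    show "\<forall>k\<in>{i}. 0 < sqrt 20 \<and> (\<exists>m::int. (sqrt (20::real))\<^sup>2 = 2 * of_int m)"
      using sqrt_even_square[of 20] by simp
    show "holomorphic_on_upper \<phi>"
      using holomorphic_on_upper_mult[OF theta_level_holomorphic_on_upper[OF per, of "1 / r5" i] theta_level_holomorphic_on_upper[OF per, of "2 / r5" i]]
      unfolding \<phi>_def by simp
    show "\<forall>\<tau> z z'. Im \<tau> > 0 \<longrightarrow> (\<forall>k\<in>{i}. z $ k = z' $ k) \<longrightarrow> \<phi> \<tau> z = \<phi> \<tau> z'"
      by (simp add: \<phi>_def)
    show "inversion_law {i} 2 6 \<phi>"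
    proof (intro allI impI)
      fix \<tau> :: complex and z :: "complex ^ 'n" assume \<tau>: "Im \<tau> > 0"
      have dft: "dft 4 chi4 k = (- \<i>) * of_real (sqrt (real 4)) * chi4 k" for k unfolding dft_chi4 by simp
      note S = theta_level_eigen_inversion[OF per dft \<tau>]
      have sc: "(inverse \<tau> *s z) $ i / r5 = z $ i / r5 / \<tau>" "2 * (inverse \<tau> *s z) $ i / r5 = 2 * z $ i / r5 / \<tau>"
        by (simp_all add: divide_inverse mult_ac)
      have "\<phi> (- 1 / \<tau>) (inverse \<tau> *s z) = (- 1) * csqrt (- \<i> * \<tau>) ^ 2 *
         (exp (pi_i * ((z $ i / r5)\<^sup>2 / \<tau>)) * exp (pi_i * ((2 * z $ i / r5)\<^sup>2 / \<tau>))) * \<phi> \<tau> z"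
        unfolding \<phi>_def sc S by (rule minus_i_product)
      also have "exp (pi_i * ((z $ i / r5)\<^sup>2 / \<tau>)) * exp (pi_i * ((2 * z $ i / r5)\<^sup>2 / \<tau>)) =
          exp (pi_i * ((\<Sum>k\<in>{i}. (z $ k)\<^sup>2) / \<tau>))"
      proof -
        have "(z $ i / r5)\<^sup>2 + (2 * z $ i / r5)\<^sup>2 = 5 * (z $ i)\<^sup>2 / (r5 * r5)"
          by (simp add: power2_eq_square add_divide_distrib[symmetric])
        also have "\<dots> = (z $ i)\<^sup>2" unfolding r5(2) by simp
        finally have "(z $ i / r5)\<^sup>2 / \<tau> + (2 * z $ i / r5)\<^sup>2 / \<tau> = (z $ i)\<^sup>2 / \<tau>"
          by (simp only: add_divide_distrib[symmetric])
        thus ?thesis unfolding mult_exp_exp distrib_left[symmetric] by simp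
      qed
      finally have eq: "\<phi> (- 1 / \<tau>) (inverse \<tau> *s z) = (- 1) * csqrt (- \<i> * \<tau>) ^ 2 *
         exp (pi_i * ((\<Sum>k\<in>{i}. (z $ k)\<^sup>2) / \<tau>)) * \<phi> \<tau> z"
        unfolding \<phi>_def .
      have m1: "exp (pi_i * (of_nat 2 - of_nat 6) / 4) = (- 1 :: complex)"
        by (simp add: exp_minus)
      show "inversion_at {i} 2 6 \<phi> \<tau> z"
        unfolding m1 by (rule eq)
    qed
    show "lattice_law {i} (\<lambda>_. sqrt 20) \<phi>"
    proof (intro allI impI)
      fix \<tau> :: complex and z :: "complex ^ 'n" and x y :: "'n \<Rightarrow> int" assume \<tau>: "Im \<tau> > 0"
      define z' where "z' = z + (\<chi> k. of_real (sqrt 20) * (of_int (x k) * \<tau> + of_int (y k)))"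
      have c20: "of_real (sqrt 20) = 2 * r5" unfolding s20 r5_def by simp
      have z': "z' $ i / r5 = z $ i / r5 + of_real (sqrt (real 4)) * (of_int (x i) * \<tau> + of_int (y i))"
        "2 * z' $ i / r5 = 2 * z $ i / r5 + of_real (sqrt (real 4)) * (of_int (2 * x i) * \<tau> + of_int (2 * y i))"
        unfolding z'_def vec_lattice_nth c20 using r5(1) by (simp_all add: field_simps)
      have "\<phi> \<tau> z' = (exp (- of_real pi * \<i> * ((of_real (sqrt (real 4)) * of_int (x i))\<^sup>2 * \<tau> + 2 * of_real (sqrt (real 4)) * of_int (x i) * (z $ i / r5))) *
          exp (- of_real pi * \<i> * ((of_real (sqrt (real 4)) * of_int (2 * x i))\<^sup>2 * \<tau> + 2 * of_real (sqrt (real 4)) * of_int (2 * x i) * (2 * z $ i / r5)))) * \<phi> \<tau> z"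
        unfolding \<phi>_def z' theta_level_lattice[OF per \<tau>] by (simp only: mult_ac)
      also have "exp (- of_real pi * \<i> * ((of_real (sqrt (real 4)) * of_int (x i))\<^sup>2 * \<tau> + 2 * of_real (sqrt (real 4)) * of_int (x i) * (z $ i / r5))) *
          exp (- of_real pi * \<i> * ((of_real (sqrt (real 4)) * of_int (2 * x i))\<^sup>2 * \<tau> + 2 * of_real (sqrt (real 4)) * of_int (2 * x i) * (2 * z $ i / r5))) =
          exp (- of_real pi * \<i> * (\<Sum>k\<in>{i}. (of_real (sqrt 20) * of_int (x k))\<^sup>2 * \<tau> + 2 * (of_real (sqrt 20) * of_int (x k)) * z $ k))"
      proof -
        have q: "of_real (sqrt (real 4)) = (2 :: complex)" by simp
        have w: "5 * (z $ i / r5) = r5 * z $ i" using r5(1) by (simp add: r5(2)[symmetric])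
        have "((2 * of_int (x i))\<^sup>2 * \<tau> + 2 * 2 * of_int (x i) * (z $ i / r5)) + ((2 * of_int (2 * x i))\<^sup>2 * \<tau> + 2 * 2 * of_int (2 * x i) * (2 * z $ i / r5)) =
            4 * 5 * (of_int (x i))\<^sup>2 * \<tau> + 4 * of_int (x i) * (5 * (z $ i / r5))"
          by (simp add: power2_eq_square algebra_simps)
        also have "\<dots> = (2 * r5 * of_int (x i))\<^sup>2 * \<tau> + 2 * (2 * r5 * of_int (x i)) * z $ i"
          unfolding w r5(2)[symmetric] by (simp add: power2_eq_square algebra_simps)
        finally show ?thesis unfolding q c20 mult_exp_exp distrib_left[symmetric] by simp
      qed
      finally show "lattice_at {i} (\<lambda>_. sqrt 20) \<phi> \<tau> z x y"
        unfolding z'_def .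
    qed
    define c where "c = (\<lambda>(u, v). chi4 u * chi4 v)"
    define \<nu> :: "int \<times> int \<Rightarrow> real" where "\<nu> = (\<lambda>(u, v). (of_int u)\<^sup>2 / (2 * real 4) + (of_int v)\<^sup>2 / (2 * real 4))"
    define l :: "int \<times> int \<Rightarrow> real ^ 'n" where "l = (\<lambda>(u, v). axis i (of_int (u + 2 * v) / sqrt 20))"
    show "block_expansion True {i} 6 (\<lambda>_. sqrt 20) \<phi>"
    proof (rule block_expansionI[where c = c and \<nu> = \<nu> and l = l])
      fix p :: "int \<times> int"
      obtain u v where p: "p = (u, v)" by fastforce
      assume "c p \<noteq> 0"
      hence uv: "chi4 u \<noteq> 0" "chi4 v \<noteq> 0" by (auto simp: c_def p)
      have "v mod 4 = 1 \<or> v mod 4 = 3" using uv(2) by (auto simp: chi4_def split: if_splits)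
      hence "2 * u - v \<noteq> 0" by presburger
      hence pos: "(of_int (2 * u - v) :: real)\<^sup>2 > 0" by simp
      have "\<nu> p - real 6 / 24 = ((of_int u)\<^sup>2 / 8 - 1 / 8) + ((of_int v)\<^sup>2 / 8 - 1 / 8)" by (simp add: \<nu>_def p)
      hence "\<nu> p - real 6 / 24 \<in> \<int>" using Ints_add[OF chi4_coef[OF uv(1)] chi4_coef[OF uv(2)]] by simp
      moreover have "sqrt 20 * l p $ i = of_int (u + 2 * v)" by (simp add: l_def p axis_def)
      moreover have "l p $ k = 0" if "k \<notin> {i}" for k using that by (simp add: l_def p axis_def)
      moreover have "2 * \<nu> p = l p \<bullet> l p + (of_int (2 * u - v))\<^sup>2 / 20"
        by (simp add: l_def p inner_axis_self power_divide \<nu>_def power2_eq_square field_simps)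
      ultimately show "\<nu> p - real 6 / 24 \<in> \<int> \<and> (\<forall>k\<in>{i}. sqrt 20 * l p $ k \<in> \<int>) \<and> (\<forall>k. k \<notin> {i} \<longrightarrow> l p $ k = 0) \<and>
          l p \<bullet> l p \<le> 2 * \<nu> p \<and> (True \<longrightarrow> l p \<bullet> l p < 2 * \<nu> p)"
        using pos by simp
    next
      fix \<tau> :: complex and z :: "complex ^ 'n" assume \<tau>: "Im \<tau> > 0"
      define e where "e p = exp (two_pi_i * (of_real (\<nu> p) * \<tau> + cform (cvec (l p)) z))" for p
      have e: "exp (two_pi_i * (of_real ((of_int u)\<^sup>2 / (2 * real 4)) * \<tau> + of_real (of_int u / sqrt (real 4)) * (z $ i / r5))) *
          exp (two_pi_i * (of_real ((of_int v)\<^sup>2 / (2 * real 4)) * \<tau> + of_real (of_int v / sqrt (real 4)) * (2 * z $ i / r5))) = e (u, v)" for u v :: int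
        unfolding e_def \<nu>_def l_def prod.case cform_axis mult_exp_exp s20
        by (rule arg_cong[where f = exp]) (simp add: r5_def field_simps)
      have "((\<lambda>(u, v). (chi4 u * chi4 v) * e (u, v)) has_sum \<phi> \<tau> z) UNIV"
        using has_sum_mult_complex[OF theta_level_has_sum[OF per \<tau>] theta_level_has_sum[OF per \<tau>], of "z $ i / r5" "2 * z $ i / r5"]
        unfolding \<phi>_def e[symmetric] by (simp only: mult_ac)
      thus "((\<lambda>p. c p * exp (two_pi_i * (of_real (\<nu> p) * \<tau> + cform (cvec (l p)) z))) has_sum \<phi> \<tau> z) UNIV"
        unfolding e_def[symmetric] c_def by (simp add: case_prod_unfold)
    qed
    show "\<exists>z. \<phi> \<i> z \<noteq> 0"
    proof -
      have hol: "theta_level 4 chi4 \<i> holomorphic_on UNIV"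
      proof -
        have "(\<lambda>w. theta chi4 (\<i> / of_nat 4) (w / of_real (sqrt (real 4)))) holomorphic_on UNIV"
          by (intro theta_holomorphic_compose[OF periodic_bounded[OF per]] holomorphic_intros) auto
        thus ?thesis unfolding theta_level_def .
      qed
      have "(\<lambda>w. theta_level 4 chi4 \<i> (2 * w)) holomorphic_on UNIV"
        using holomorphic_on_compose_gen[of "\<lambda>w. 2 * w" UNIV "theta_level 4 chi4 \<i>" UNIV] hol
        by (simp add: o_def holomorphic_intros)
      moreover have "theta_level 4 chi4 \<i> (2 * of_real (- 1 / 4)) \<noteq> 0" using theta_chi4_nonzero by simp
      ultimately obtain w where w: "theta_level 4 chi4 \<i> w * theta_level 4 chi4 \<i> (2 * w) \<noteq> 0"
        using holomorphic_product_nonzero[OF hol _ theta_chi4_nonzero] by blast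
      have "\<phi> \<i> (\<chi> k. r5 * w) \<noteq> 0" using w r5(1) by (simp add: \<phi>_def)
      thus ?thesis by blast
    qed
  qed
  thus ?thesis unfolding has_block_def by blast
qed

section \<open>From products of theta functions to Jacobi cusp forms\<close>

text \<open>
The orthogonal sum of the lattices \<open>b i \<int>\<close>.
\<close>

definition orthogonal_lattice :: "('n::finite \<Rightarrow> real) \<Rightarrow> (real ^ 'n) set" where
  "orthogonal_lattice b = {x. \<forall>i. \<exists>k::int. x $ i = b i * of_int k}"

lemma even_orthogonal_lattice:
  fixes b :: "'n::finite \<Rightarrow> real"
  assumes b: "\<And>i. b i > 0 \<and> (\<exists>k::int. (b i)\<^sup>2 = 2 * of_int k)"
  shows "even_lattice (orthogonal_lattice b)"
  unfolding even_lattice_def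
proof (intro conjI ballI)
  define f where "f i = axis i (b i)" for i :: 'n
  have b0: "b i \<noteq> 0" for i using b[of i] by simp
  have inj: "inj f" using b0 by (auto simp: inj_def f_def axis_eq_axis)
  have ind: "independent (range f)"
  proof (rule pairwise_orthogonal_independent)
    show "pairwise orthogonal (range f)"
      by (auto simp: pairwise_def f_def orthogonal_def inner_axis_axis)
    show "0 \<notin> range f" using b0 by (auto simp: f_def axis_eq_0_iff)
  qed
  have span: "span (range f) = UNIV"
  proof -
    have "Basis \<subseteq> span (range f)"
    proof
      fix v :: "real ^ 'n" assume "v \<in> Basis"
      then obtain i where v: "v = axis i 1" by (auto simp: Basis_vec_def)
      have "v = (1 / b i) *\<^sub>R f i" using b0 by (simp add: v f_def axis_def vec_eq_iff)
      moreover have "f i \<in> span (range f)" by (intro span_base) simp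
      ultimately show "v \<in> span (range f)" using span_scale by metis
    qed
    hence "span (Basis :: (real ^ 'n) set) \<subseteq> span (range f)" by (rule span_minimal) (rule subspace_span)
    thus ?thesis by auto
  qed
  have comp: "(\<Sum>v\<in>range f. of_int (m v) *\<^sub>R v) $ i = b i * of_int (m (f i))" for m :: "real ^ 'n \<Rightarrow> int" and i
  proof -
    have "(\<Sum>v\<in>range f. of_int (m v) *\<^sub>R v) $ i = (\<Sum>j\<in>UNIV. of_int (m (f j)) * (f j $ i))"
      by (subst sum.reindex[OF inj]) simp
    also have "\<dots> = (\<Sum>j\<in>UNIV. if j = i then b i * of_int (m (f i)) else 0)"
      by (intro sum.cong) (auto simp: f_def axis_def)
    finally show ?thesis by simp
  qed
  have "orthogonal_lattice b = {\<Sum>v\<in>range f. of_int (m v) *\<^sub>R v | m :: real ^ 'n \<Rightarrow> int. True}" (is "_ = ?R")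
  proof safe
    fix x assume "x \<in> orthogonal_lattice b"
    then obtain k where k: "\<And>i. x $ i = b i * of_int (k i)" unfolding orthogonal_lattice_def by (auto, metis)
    define m where "m v = k (inv f v)" for v
    have "x = (\<Sum>v\<in>range f. of_int (m v) *\<^sub>R v)"
      unfolding vec_eq_iff comp using inj by (simp add: m_def k)
    thus "\<exists>m :: real ^ 'n \<Rightarrow> int. x = (\<Sum>v\<in>range f. of_int (m v) *\<^sub>R v) \<and> True"
      by (intro exI[of _ m]) simp
  next
    fix m :: "real ^ 'n \<Rightarrow> int"
    show "(\<Sum>v\<in>range f. of_int (m v) *\<^sub>R v) \<in> orthogonal_lattice b"
      unfolding orthogonal_lattice_def mem_Collect_eq comp by blast
  qed
  thus "full_lattice (orthogonal_lattice b)" unfolding full_lattice_def using ind span by blast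
next
  fix x assume "x \<in> orthogonal_lattice b"
  then obtain k where k: "\<And>i. x $ i = b i * of_int (k i)" unfolding orthogonal_lattice_def by (auto, metis)
  obtain q where q: "\<And>i. (b i)\<^sup>2 = 2 * of_int (q i)" using b by metis
  have "x \<bullet> x = (\<Sum>i\<in>UNIV. (b i)\<^sup>2 * (of_int (k i))\<^sup>2)"
    by (simp add: inner_vec_def k power2_eq_square mult_ac)
  also have "\<dots> = 2 * of_int (\<Sum>i\<in>UNIV. q i * (k i)\<^sup>2)"
    unfolding q by (simp add: sum_distrib_left mult.assoc)
  finally show "\<exists>m::int. x \<bullet> x = 2 * of_int m" by blast
qed

lemma dual_orthogonal_lattice:
  fixes l :: "real ^ 'n::finite"
  assumes "\<And>i. b i * l $ i \<in> \<int>"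
  shows "l \<in> dual_lattice (orthogonal_lattice b)"
  unfolding dual_lattice_def mem_Collect_eq
proof
  fix x assume "x \<in> orthogonal_lattice b"
  then obtain k where k: "\<And>i. x $ i = b i * of_int (k i)" unfolding orthogonal_lattice_def by (auto, metis)
  have "x \<bullet> l = (\<Sum>i\<in>UNIV. of_int (k i) * (b i * l $ i))" by (simp add: inner_vec_def k mult_ac)
  also have "\<dots> \<in> \<int>" by (intro Ints_sum Ints_mult[OF Ints_of_int assms])
  finally show "x \<bullet> l \<in> \<int>" .
qed

text \<open>
Collecting all indices with the same pair of exponents turns an expansion over an arbitrary index set
into a Fourier expansion indexed by the exponents.
\<close>

lemma block_fourier_expansion:
  fixes \<phi> :: "complex \<Rightarrow> complex ^ 'n::finite \<Rightarrow> complex"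
  assumes exp: "block_expansion True UNIV d0 b \<phi>" and d: "[d = int d0] (mod 24)"
  shows "\<exists>f. fourier_expansion (orthogonal_lattice b) d f \<phi> \<and>
            (\<forall>(n, l) \<in> fourier_index (orthogonal_lattice b) d. f n l \<noteq> 0 \<longrightarrow> 2 * n - l \<bullet> l > 0)"
proof -
  obtain c :: "nat \<Rightarrow> complex" and \<nu> :: "nat \<Rightarrow> real" and l :: "nat \<Rightarrow> real ^ 'n" where
    A: "\<forall>k. c k \<noteq> 0 \<longrightarrow> admissible True UNIV d0 b (\<nu> k) (l k)"
    and hs: "\<forall>\<tau> z. Im \<tau> > 0 \<longrightarrow> ((\<lambda>k. c k * fexp (\<nu> k) (l k) \<tau> z) has_sum \<phi> \<tau> z) UNIV"
    using exp unfolding block_expansion_def by (elim exE conjE) (rule that)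
  define FI where "FI = fourier_index (orthogonal_lattice b) d"
  define K where "K p = {k. c k \<noteq> 0 \<and> (\<nu> k, l k) = p}" for p
  define f where "f n v = infsum c (K (n, v))" for n v
  obtain j where j: "d = int d0 + 24 * j"
    using d by (metis cong_iff_lin cong_sym mult.commute)
  have inFI: "(\<nu> k, l k) \<in> FI" if "c k \<noteq> 0" for k
  proof -
    note a = A[rule_format, OF that]
    have eq: "\<nu> k - of_int d / 24 = (\<nu> k - of_nat d0 / 24) - of_int j" by (simp add: j field_simps)
    have int: "\<nu> k - of_int d / 24 \<in> \<int>" unfolding eq using a by (intro Ints_diff[OF _ Ints_of_int]) auto
    then obtain q where "\<nu> k - of_int d / 24 = of_int q" by (auto elim: Ints_cases)
    hence "\<nu> k = of_rat (of_int q + of_int d / 24)" by (simp add: of_rat_add of_rat_divide)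
    hence rat: "\<nu> k \<in> \<rat>" by simp
    have "\<nu> k \<ge> 0" using a inner_ge_zero[of "l k"] by linarith
    moreover have "l k \<in> dual_lattice (orthogonal_lattice b)" using a by (intro dual_orthogonal_lattice) auto
    ultimately show ?thesis using int rat a unfolding FI_def fourier_index_def by auto
  qed
  have "fourier_expansion (orthogonal_lattice b) d f \<phi>"
    unfolding fourier_expansion_def
  proof (intro allI impI)
    fix \<tau> :: complex and z :: "complex ^ 'n" assume \<tau>: "Im \<tau> > 0"
    define e where "e p = exp (two_pi_i * (of_real (fst p) * \<tau> + cform (cvec (snd p)) z))" for p :: "real \<times> (real ^ 'n)"
    define t where "t k = c k * e (\<nu> k, l k)" for k
    have t: "(t has_sum \<phi> \<tau> z) UNIV" using hs \<tau> unfolding t_def e_def by simp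
    have tS: "((\<lambda>(p, k). t k) has_sum \<phi> \<tau> z) (Sigma FI K)"
    proof -
      have "(t has_sum \<phi> \<tau> z) (snd ` Sigma FI K)"
      proof (rule has_sum_cong_neutral[THEN iffD1, OF _ _ _ t])
        fix k assume k: "k \<in> UNIV - snd ` Sigma FI K"
        show "t k = 0"
        proof (rule ccontr)
          assume "t k \<noteq> 0"
          hence "c k \<noteq> 0" by (simp add: t_def)
          hence "((\<nu> k, l k), k) \<in> Sigma FI K" using inFI by (simp add: K_def)
          hence "k \<in> snd ` Sigma FI K" by force
          thus False using k by simp
        qed
      qed auto
      moreover have "inj_on snd (Sigma FI K)" by (auto simp: inj_on_def K_def)
      ultimately have "((t \<circ> snd) has_sum \<phi> \<tau> z) (Sigma FI K)" by (subst (asm) has_sum_reindex) auto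
      thus ?thesis by (simp add: o_def case_prod_unfold)
    qed
    have fib: "((\<lambda>k. case (p, k) of (p, k) \<Rightarrow> t k) has_sum f (fst p) (snd p) * e p) (K p)" for p
    proof -
      have "t summable_on K p" using t has_sum_imp_summable summable_on_subset_banach by blast
      moreover have tc: "t k = c k * e p" if "k \<in> K p" for k using that by (auto simp: t_def K_def)
      ultimately have "(\<lambda>k. c k * e p) summable_on K p" using summable_on_cong by (metis (no_types, lifting))
      hence "((\<lambda>k. c k * e p) has_sum infsum (\<lambda>k. c k * e p) (K p)) (K p)" by (rule has_sum_infsum)
      also have "infsum (\<lambda>k. c k * e p) (K p) = f (fst p) (snd p) * e p"
        unfolding f_def by (simp add: infsum_cmult_left')
      finally have "((\<lambda>k. c k * e p) has_sum f (fst p) (snd p) * e p) (K p)" .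
      thus ?thesis using has_sum_cong[of "K p" t "\<lambda>k. c k * e p"] tc by simp
    qed
    have "((\<lambda>p. f (fst p) (snd p) * e p) has_sum \<phi> \<tau> z) FI"
      by (rule has_sum_SigmaD[OF tS]) (rule fib)
    thus "((\<lambda>(n, v). f n v * exp (two_pi_i * (of_real n * \<tau> + cform (cvec v) z))) has_sum \<phi> \<tau> z) (fourier_index (orthogonal_lattice b) d)"
      unfolding FI_def e_def by (simp add: case_prod_unfold)
  qed
  moreover have "2 * n - v \<bullet> v > 0" if "f n v \<noteq> 0" for n v
  proof -
    have "K (n, v) \<noteq> {}" using that by (auto simp: f_def)
    then obtain k where "c k \<noteq> 0" "\<nu> k = n" "l k = v" by (auto simp: K_def)
    thus ?thesis using A by auto
  qed
  ultimately show ?thesis by blast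
qed

lemma block_translation:
  fixes \<phi> :: "complex \<Rightarrow> complex ^ 'n::finite \<Rightarrow> complex"
  assumes exp: "block_expansion s I d b \<phi>" and \<tau>: "Im \<tau> > 0"
  shows "\<phi> (\<tau> + 1) z = exp (two_pi_i * of_nat d / 24) * \<phi> \<tau> z"
proof -
  obtain c :: "nat \<Rightarrow> complex" and \<nu> :: "nat \<Rightarrow> real" and l :: "nat \<Rightarrow> real ^ 'n" where
    A: "\<forall>k. c k \<noteq> 0 \<longrightarrow> admissible s I d b (\<nu> k) (l k)"
    and hs: "\<forall>\<tau> z. Im \<tau> > 0 \<longrightarrow> ((\<lambda>k. c k * fexp (\<nu> k) (l k) \<tau> z) has_sum \<phi> \<tau> z) UNIV"
    using exp unfolding block_expansion_def by (elim exE conjE) (rule that)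
  have eq: "c k * exp (two_pi_i * (of_real (\<nu> k) * (\<tau> + 1) + cform (cvec (l k)) z)) =
      exp (two_pi_i * of_nat d / 24) * (c k * fexp (\<nu> k) (l k) \<tau> z)" for k
  proof (cases "c k = 0")
    case False
    hence "\<nu> k - of_nat d / 24 \<in> \<int>" using A by blast
    then obtain q where "\<nu> k - of_nat d / 24 = of_int q" by (elim Ints_cases)
    hence q: "\<nu> k = of_int q + of_nat d / 24" by simp
    have "exp (two_pi_i * (of_real (\<nu> k) * (\<tau> + 1) + cform (cvec (l k)) z)) =
      exp (2 * of_int q * of_real pi * \<i>) * (exp (two_pi_i * of_nat d / 24) * fexp (\<nu> k) (l k) \<tau> z)"
      unfolding mult_exp_exp by (rule arg_cong[where f = exp]) (simp add: q field_simps)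
    thus ?thesis unfolding exp_two_pi_int by (simp add: mult_ac)
  qed simp
  have "Im (\<tau> + 1) > 0" using \<tau> by simp
  from hs[rule_format, OF this, of z]
  have "((\<lambda>k. exp (two_pi_i * of_nat d / 24) * (c k * fexp (\<nu> k) (l k) \<tau> z)) has_sum \<phi> (\<tau> + 1) z) UNIV"
    unfolding eq .
  moreover have "((\<lambda>k. exp (two_pi_i * of_nat d / 24) * (c k * fexp (\<nu> k) (l k) \<tau> z)) has_sum exp (two_pi_i * of_nat d / 24) * \<phi> \<tau> z) UNIV"
    by (rule has_sum_cmult_right[OF hs[rule_format, OF \<tau>]])
  ultimately show ?thesis by (rule has_sum_unique)
qed

lemma jacobi_cusp_form_of_block:
  fixes \<phi> :: "complex \<Rightarrow> complex ^ 'n::finite \<Rightarrow> complex"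
  assumes bl: "jacobi_block True UNIV r d0 b \<phi>" and d: "[d = int d0] (mod 24)" and par: "int r - int d0 = 2 * m"
  shows "\<phi> \<in> jacobi_cusp_forms (real r / 2) (orthogonal_lattice b) d"
proof -
  note bl' = jacobi_blockD[OF bl]
  obtain f where f: "fourier_expansion (orthogonal_lattice b) d f \<phi>"
      "\<forall>(n, l) \<in> fourier_index (orthogonal_lattice b) d. f n l \<noteq> 0 \<longrightarrow> 2 * n - l \<bullet> l > 0"
    using block_fourier_expansion[OF bl'(6) d] by blast
  have S: "\<phi> (- 1 / \<tau>) (inverse \<tau> *s z) =
        \<i> powi m * csqrt (- \<i> * \<tau>) ^ r * exp (pi_i * (cform z z / \<tau>)) * \<phi> \<tau> z" if "Im \<tau> > 0" for \<tau> z
  proof -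
    have "of_nat r - of_nat d0 = (of_int (2 * m) :: complex)" using par by (metis of_int_diff of_int_of_nat_eq)
    hence "exp (pi_i * (of_nat r - of_nat d0) / 4) = exp (of_int m * (\<i> * of_real (pi / 2)) :: complex)"
      by (intro arg_cong[where f = exp]) (simp add: field_simps)
    also have "\<dots> = \<i> powi m"
      unfolding exp_power_int[symmetric] by (simp only: cis_conv_exp[symmetric] cis_pi_half)
    finally have "exp (pi_i * (of_nat r - of_nat d0) / 4) = \<i> powi m" .
    moreover have "(\<Sum>i\<in>UNIV. (z $ i)\<^sup>2) = cform z z" by (simp add: cform_def power2_eq_square)
    ultimately show ?thesis using bl'(4)[rule_format, OF that, of z] by simp
  qed
  have mod: "\<phi> (moebius a b' c e \<tau>) (inverse (of_int c * \<tau> + of_int e) *s z) =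
              eta_mult a b' c e powi d * (of_int c * \<tau> + of_int e) powr of_real (real r / 2) *
              exp (pi_i * (of_int c * cform z z / (of_int c * \<tau> + of_int e))) * \<phi> \<tau> z"
    if det: "a * e - b' * c = 1" and \<tau>: "Im \<tau> > 0" for a b' c e :: int and \<tau> z
  proof -
    obtain j where j: "d = int d0 + 24 * j"
      using d by (metis cong_iff_lin cong_sym mult.commute)
    have 24: "eta_mult a b' c e ^ 24 = 1" by (rule eta_multiplier(2)[OF det])
    hence nz: "eta_mult a b' c e \<noteq> 0" by auto
    have "eta_mult a b' c e powi (24 * j) = (eta_mult a b' c e ^ 24) powi j"
      by (simp add: power_int_mult)
    hence "eta_mult a b' c e powi d = eta_mult a b' c e ^ d0"
      unfolding j using nz 24 by (simp add: power_int_add)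
    thus ?thesis
      using jacobi_transformation[OF par block_translation[OF bl'(6)] S det \<tau>, of z] by simp
  qed
  have lat: "\<phi> \<tau> (z + \<tau> *s cvec x + cvec y) = exp (- of_real pi * \<i> * (of_real (x \<bullet> x) * \<tau> + 2 * cform (cvec x) z)) * \<phi> \<tau> z"
    if x: "x \<in> orthogonal_lattice b" and y: "y \<in> orthogonal_lattice b" and \<tau>: "Im \<tau> > 0" for x y \<tau> z
  proof -
    obtain k where k: "\<And>i. x $ i = b i * of_int (k i)" using x unfolding orthogonal_lattice_def by (auto, metis)
    obtain k' where k': "\<And>i. y $ i = b i * of_int (k' i)" using y unfolding orthogonal_lattice_def by (auto, metis)
    have 1: "z + \<tau> *s cvec x + cvec y = z + (\<chi> i. of_real (b i) * (of_int (k i) * \<tau> + of_int (k' i)))"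
      by (simp add: vec_eq_iff cvec_def k k' algebra_simps)
    have 2: "(\<Sum>i\<in>UNIV. (of_real (b i) * of_int (k i))\<^sup>2 * \<tau> + 2 * (of_real (b i) * of_int (k i)) * z $ i) =
        of_real (x \<bullet> x) * \<tau> + 2 * cform (cvec x) z"
      unfolding inner_vec_def cform_def cvec_def sum.distrib
      by (simp add: k sum_distrib_left sum_distrib_right power2_eq_square mult_ac)
    show ?thesis unfolding 1 bl'(5)[rule_format, OF \<tau>] 2 ..
  qed
  have "\<phi> \<in> jacobi_forms (real r / 2) (orthogonal_lattice b) d"
    unfolding jacobi_forms_def mem_Collect_eq using bl'(2) mod lat f(1) by blast
  thus ?thesis unfolding jacobi_cusp_forms_def using f by blast
qed

section \<open>Matching the characters\<close>

text \<open>
Filling the variables in \<open>J\<close> with \<open>a\<close> odd theta functions and \<open>card J - a\<close> quintuple product theta functions.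
\<close>

lemma has_block_extend:
  fixes I J :: "'n::finite set"
  assumes bl: "has_block True I r d" and "finite J" "I \<inter> J = {}" "a \<le> card J"
  shows "has_block True (I \<union> J) (r + card J) (d + card J + 2 * a)"
  using assms(2-4)
proof (induction J arbitrary: a rule: finite_induct)
  case empty
  thus ?case using bl by simp
next
  case (insert j J)
  have j: "j \<notin> I \<union> J" using insert by auto
  show ?case
  proof (cases "a \<le> card J")
    case True
    have "has_block True (I \<union> J) (r + card J) (d + card J + 2 * a)" using insert True by auto
    from has_block_union[OF this has_block_quintuple[of j]] j show ?thesis using insert by simp
  next
    case False
    hence a: "a = card J + 1" using insert by simp
    have "has_block True (I \<union> J) (r + card J) (d + card J + 2 * card J)"
      by (rule insert.IH) (use insert.prems in auto)
    from has_block_union[OF this has_block_theta[of j]] j show ?thesis using insert a by (simp add: numeral_3_eq_3)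
  qed
qed

lemma has_block_extend_hexagonal:
  fixes I J :: "'n::finite set"
  assumes bl: "has_block True I r d" and "card J = 2 * c" "I \<inter> J = {}"
  shows "has_block True (I \<union> J) (r + 2 * c) (d + 8 * c)"
  using assms(2,3)
proof (induction c arbitrary: J)
  case 0
  hence "J = {}" by simp
  thus ?case using bl by simp
next
  case (Suc c)
  hence "card J = Suc (Suc (2 * c))" by simp
  then obtain i J1 where 1: "J = insert i J1" "i \<notin> J1" "card J1 = Suc (2 * c)" by (auto simp: card_Suc_eq)
  then obtain j J' where 2: "J1 = insert j J'" "j \<notin> J'" "card J' = 2 * c" by (auto simp: card_Suc_eq)
  have "has_block True (I \<union> J') (r + 2 * c) (d + 8 * c)" using Suc 1 2 by auto
  moreover have "(I \<union> J') \<inter> {i, j} = {}" "i \<noteq> j" using Suc.prems 1 2 by auto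
  ultimately have "has_block True ((I \<union> J') \<union> {i, j}) (r + 2 * c + 2) (d + 8 * c + 8)"
    using has_block_union[OF _ has_block_hexagonal[of i j]] by fastforce
  moreover have "(I \<union> J') \<union> {i, j} = I \<union> J" using 1 2 by auto
  moreover have "r + 2 * c + 2 = r + 2 * Suc c" "d + 8 * c + 8 = d + 8 * Suc c" by simp_all
  ultimately show ?case by metis
qed

text \<open>
With \<open>\<eta>\<close>, \<open>c\<close> hexagonal factors and \<open>a\<close> odd theta functions, the character is \<open>8 + 6 c + 2 a\<close>; this leaves only
the class of 30 to the other critical factor.
\<close>

lemma has_block_rank_7:
  fixes K :: "'n::finite set"
  assumes K: "card K = 7" and e: "even e" "8 \<le> e" "e \<le> 30"
  shows "has_block True K 8 e"
proof -
  have eta: "has_block True K 8 (8 + 6 * c + 2 * a)" if "2 * c \<le> 7" "a \<le> 7 - 2 * c" for a c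
  proof -
    have "2 * c \<le> card K" using K that by simp
    then obtain J where J: "J \<subseteq> K" "card J = 2 * c" by (rule obtain_subset_with_card_n)
    have "has_block True J (1 + 2 * c) (1 + 8 * c)"
      using has_block_extend_hexagonal[OF has_block_eta J(2)] by simp
    moreover have "card (K - J) = 7 - 2 * c" using J K by (simp add: card_Diff_subset)
    ultimately have "has_block True (J \<union> (K - J)) (1 + 2 * c + (7 - 2 * c)) (1 + 8 * c + (7 - 2 * c) + 2 * a)"
      using has_block_extend[of J "1 + 2 * c" "1 + 8 * c" "K - J" a] that by auto
    moreover have "J \<union> (K - J) = K" "1 + 2 * c + (7 - 2 * c) = 8" "1 + 8 * c + (7 - 2 * c) + 2 * a = 8 + 6 * c + 2 * a"
      using J that by auto
    ultimately show ?thesis by metis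
  qed
  have theta: "has_block True K 8 30"
  proof -
    have "card K = Suc 6" using K by simp
    then obtain i J where "K = insert i J" "i \<notin> J" "card J = 6"
      using card_Suc_eq[of K 6] by blast
    thus ?thesis using has_block_extend_hexagonal[OF has_block_theta_theta[of i], of J 3] by simp
  qed
  obtain q where q: "e = 2 * q" using e(1) by (elim evenE)
  hence "e = 8 + 2 * (q - 4) \<and> q - 4 \<le> 7 \<or> e = 24 \<or> e = 26 \<or> e = 28 \<or> e = 30" using e by auto
  thus ?thesis
    using eta[of 0 "q - 4"] eta[of 1 5] eta[of 2 3] eta[of 3 1] theta by auto
qed

theorem proposition3p10:
  fixes n :: nat and d :: int
  assumes rank: "n = CARD('n::finite)"
    and n: "(odd n \<and> n \<ge> 7) \<or> (even n \<and> n \<ge> 8)"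
    and d: "[d = int n + 1] (mod 2)"
  shows "\<exists>L :: (real ^ 'n) set. even_lattice L \<and>
           (\<exists>\<phi> \<in> jacobi_cusp_forms ((real n + 1) / 2) L d.
              \<exists>\<tau> z. Im \<tau> > 0 \<and> \<phi> \<tau> z \<noteq> 0)"
proof -
  have n7: "n \<ge> 7" using n by auto
  obtain K :: "'n set" where K: "card K = 7"
    using obtain_subset_with_card_n[of 7 "UNIV :: 'n set"] n7 rank by auto
  \<comment> \<open>the contribution of the first seven variables, after the other \<open>n - 7\<close> variables have used up \<open>3 (n - 7)\<close>\<close>
  define s where "s = (d - 3 * (int n - 7) - 8) mod 24"
  define e where "e = nat (8 + s)"
  have "even (d - int n - 1)" using d by (simp add: cong_iff_dvd_diff algebra_simps)
  hence "even (d - 3 * (int n - 7) - 8)" by simp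
  hence s2: "even s" unfolding s_def by (simp add: dvd_mod_iff)
  have s: "0 \<le> s" "s < 24" by (auto simp: s_def)
  have "s \<le> 22" using s s2 by presburger
  hence "even e" "8 \<le> e" "e \<le> 30" using s s2 by (auto simp: e_def even_nat_iff)
  hence "has_block True K 8 e" by (rule has_block_rank_7[OF K])
  moreover have card: "card (UNIV - K) = n - 7" using K rank by (simp add: card_Diff_subset)
  ultimately have "has_block True (K \<union> (UNIV - K)) (8 + (n - 7)) (e + (n - 7) + 2 * (n - 7))"
    using has_block_extend[of K 8 e "UNIV - K" "n - 7"] by simp
  hence "has_block True (UNIV :: 'n set) (n + 1) (e + 3 * (n - 7))"
    using n7 by (simp add: algebra_simps)
  then obtain b \<phi> where bl: "jacobi_block True (UNIV :: 'n set) (n + 1) (e + 3 * (n - 7)) b \<phi>"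
    unfolding has_block_def by blast
  have d0: "int (e + 3 * (n - 7)) = 8 + s + 3 * (int n - 7)" using s n7 by (simp add: e_def of_nat_diff)
  have cong: "[d = int (e + 3 * (n - 7))] (mod 24)"
  proof -
    have "[s = d - 3 * (int n - 7) - 8] (mod 24)" unfolding s_def by (simp add: cong_def)
    from cong_add[OF this cong_refl[of "8 + 3 * (int n - 7)"]]
    have "[8 + s + 3 * (int n - 7) = d] (mod 24)" by (simp add: add_ac)
    thus ?thesis unfolding d0 by (rule cong_sym)
  qed
  have "even (int (n + 1) - int (e + 3 * (n - 7)))" unfolding d0 using s2 by simp
  then obtain m where m: "int (n + 1) - int (e + 3 * (n - 7)) = 2 * m" by (elim evenE)
  have "\<phi> \<in> jacobi_cusp_forms (real (n + 1) / 2) (orthogonal_lattice b) d"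
    by (rule jacobi_cusp_form_of_block[OF bl cong m])
  moreover have "even_lattice (orthogonal_lattice b)"
    using jacobi_blockD(1)[OF bl] by (intro even_orthogonal_lattice) simp
  moreover obtain z where "\<phi> \<i> z \<noteq> 0" using jacobi_blockD(7)[OF bl] by blast
  ultimately show ?thesis
    by (intro exI[of _ "orthogonal_lattice b"] conjI bexI[of _ \<phi>] exI[of _ \<i>] exI[of _ z]) (auto simp: add.commute)
qed

end
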